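(* Let $\mathcal E$ be a complex separable Hilbert space, let $m\geqslant2$ and let $\pmb\mu=(\mu_1,\ldots,\mu_{m-1})$ be an $(m-1)$-tuple of $\mathcal B(\mathcal E)$-valued semi-spectral measures on the unit circle $\mathbb T$. Then the multiplication operator $M_z$ on $\mathcal H_{\pmb\mu}(\mathcal E)$ satisfies $$\langle\beta_r(M_z)f,f\rangle=D_{\mu_r,0}(f)+\sum_{n=1}^\infty\big\langle\beta_{r+1}(M_z)L_{M_z}^nf,L_{M_z}^nf\big\rangle,\qquad f\in\mathcal H_{\pmb\mu}(\mathcal E),\ r=1,\ldots,m-1.$$ In particular, $$\beta_r(M_z)\geqslant\sum_{n=1}^\infty{L_{M_z}^*}^{n}\beta_{r+1}(M_z)L_{M_z}^n,\qquad r=1,\ldots,m-1.$$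
   Context: $\mathbb D$ is the open unit disc, $dA$ its normalized Lebesgue area measure, $d\sigma$ the normalized arc length measure on $\mathbb T$, and $\mathcal O(\mathbb D,\mathcal E)$ the space of $\mathcal E$-valued holomorphic functions on $\mathbb D$. A $\mathcal B(\mathcal E)$-valued semi-spectral measure on $\mathbb T$ is a finitely additive set function $\mu$ from the Borel $\sigma$-algebra of $\mathbb T$ into the positive operators in $\mathcal B(\mathcal E)$ such that $\mu_{x,y}(\cdot):=\langle\mu(\cdot)x,y\rangle$ is a regular complex Borel measure for all $x,y\in\mathcal E$. Its Poisson integral is $P_\mu(z)=\int_{\mathbb T}\frac{1-|z|^2}{|z-\zeta|^2}d\mu(\zeta)$, $z\in\mathbb D$. For $n\ge1$ and $f\in\mathcal O(\mathbb D,\mathcal E)$, $$D_{\mu,n}(f):=\frac1{n!(n-1)!}\int_{\mathbb D}\langle P_\mu(z)f^{(n)}(z),f^{(n)}(z)\rangle(1-|z|^2)^{n-1}dA(z),$$ and $D_{\mu,0}(f):=\lim_{R\to1^-}\int_{\mathbb T}\langle P_\mu(R\zeta)f(R\zeta),f(R\zeta)\rangle d\sigma(\zeta)$ whenever the limit exists (it exists and is finite if $D_{\mu,n}(f)<\infty$ for some $n\ge1$). $\mathcal H_{\mu,n}(\mathcal E):=\{f\in\mathcal O(\mathbb D,\mathcal E):D_{\mu,n}(f)<\infty\}$ for $n\ge1$. $H^2(\mathcal E)$ is the Hardy space of functions $\sum_{j\ge0}a_jz^j$, $a_j\in\mathcal E$, with $\|f\|^2_{H^2(\mathcal E)}=\sum_j\|a_j\|^2<\infty$.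 $\mathcal H_{\pmb\mu}(\mathcal E):=\bigcap_{j=1}^{m-1}\mathcal H_{\mu_j,j}(\mathcal E)\cap H^2(\mathcal E)$, a Hilbert space with norm $\|f\|^2_{\pmb\mu}=\|f\|^2_{H^2(\mathcal E)}+\sum_{j=1}^{m-1}D_{\mu_j,j}(f)$. $(M_zf)(z)=zf(z)$ is bounded and left invertible on $\mathcal H_{\pmb\mu}(\mathcal E)$. For a bounded operator $T$ and $k\ge1$, $\beta_k(T):=\sum_{j=0}^k\binom kj(-1)^{k-j}{T^*}^jT^j$; for left invertible $T$, $L_T:=(T^*T)^{-1}T^*$. Inner products and adjoints are those of $\mathcal H_{\pmb\mu}(\mathcal E)$. An inequality $B\geqslant\sum_{n=1}^\infty C_n$ between self-adjoint operators means that for every vector $x$ the series $\sum_n\langle C_nx,x\rangle$ converges and is at most $\langle Bx,x\rangle$. *)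

theory Defs
  imports "HOL-Analysis.Analysis"
begin

section \<open>Complex Hilbert spaces and bounded operators\<close>

text \<open>The complex inner product is linear in its first argument; norm and topology are those
  of the underlying real inner product, which is its real part.\<close>

class complex_hilbert_space = real_inner + banach +
  fixes scaleC :: "complex \<Rightarrow> 'a \<Rightarrow> 'a" (infixr \<open>*\<^sub>C\<close> 75)
    and cinner :: "'a \<Rightarrow> 'a \<Rightarrow> complex"
  assumes scaleC_add_right: "c *\<^sub>C (x + y) = c *\<^sub>C x + c *\<^sub>C y"
    and scaleC_add_left: "(c + d) *\<^sub>C x = c *\<^sub>C x + d *\<^sub>C x"
    and scaleC_scaleC: "c *\<^sub>C (d *\<^sub>C x) = (c * d) *\<^sub>C x"
    and scaleC_of_real: "complex_of_real r *\<^sub>C x = r *\<^sub>R x"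
    and cinner_commute: "cinner x y = cnj (cinner y x)"
    and cinner_add_left: "cinner (x + y) z = cinner x z + cinner y z"
    and cinner_scaleC_left: "cinner (c *\<^sub>C x) y = c * cinner x y"
    and Re_cinner: "Re (cinner x y) = inner x y"

definition bounded_clinear :: "('e::complex_hilbert_space \<Rightarrow> 'e) \<Rightarrow> bool" where
  "bounded_clinear T \<longleftrightarrow> bounded_linear T \<and> (\<forall>c x. T (c *\<^sub>C x) = c *\<^sub>C T x)"

definition positive_operator :: "('e::complex_hilbert_space \<Rightarrow> 'e) \<Rightarrow> bool" where
  "positive_operator T \<longleftrightarrow> bounded_clinear T \<and> (\<forall>x. cinner (T x) x \<in> \<real>\<^sub>\<ge>\<^sub>0)"


section \<open>Complex and semi-spectral measures on the unit circle\<close>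

abbreviation unit_disc :: "complex set" where "unit_disc \<equiv> ball 0 1"

abbreviation unit_circle :: "complex set" where "unit_circle \<equiv> sphere 0 1"

abbreviation circle_sets :: "complex set set" where
  "circle_sets \<equiv> sets (restrict_space borel unit_circle)"

definition complex_borel_measure :: "(complex set \<Rightarrow> complex) \<Rightarrow> bool" where
  "complex_borel_measure \<nu> \<longleftrightarrow>
     (\<forall>A :: nat \<Rightarrow> complex set. range A \<subseteq> circle_sets \<and> disjoint_family A \<longrightarrow>
        (\<lambda>n. \<nu> (A n)) sums \<nu> (\<Union>n. A n))"

definition total_variation :: "(complex set \<Rightarrow> complex) \<Rightarrow> complex set \<Rightarrow> ennreal" where
  "total_variation \<nu> E =
     (SUP A \<in> {A :: nat \<Rightarrow> complex set. range A \<subseteq> circle_sets \<and> disjoint_family A \<and> (\<Union>n. A n) = E}.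
        \<Sum>n. ennreal (cmod (\<nu> (A n))))"

definition regular_complex_borel_measure :: "(complex set \<Rightarrow> complex) \<Rightarrow> bool" where
  "regular_complex_borel_measure \<nu> \<longleftrightarrow> complex_borel_measure \<nu> \<and>
     (\<forall>E \<in> circle_sets.
        total_variation \<nu> E =
          (INF U \<in> {U. openin (top_of_set unit_circle) U \<and> E \<subseteq> U}. total_variation \<nu> U) \<and>
        total_variation \<nu> E =
          (SUP K \<in> {K. compact K \<and> K \<subseteq> E}. total_variation \<nu> K))"

definition semi_spectral_measure ::
    "(complex set \<Rightarrow> 'e::complex_hilbert_space \<Rightarrow> 'e) \<Rightarrow> bool" where
  "semi_spectral_measure \<mu> \<longleftrightarrow>
     (\<forall>A \<in> circle_sets. positive_operator (\<mu> A)) \<and>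
     (\<forall>A \<in> circle_sets. \<forall>B \<in> circle_sets. A \<inter> B = {} \<longrightarrow> (\<forall>x. \<mu> (A \<union> B) x = \<mu> A x + \<mu> B x)) \<and>
     (\<forall>x y. regular_complex_borel_measure (\<lambda>A. cinner (\<mu> A x) y))"

text \<open>Integration of a real function against a complex measure \<open>\<nu>\<close>: write
  \<open>\<nu> = M1 - M2 + \<i> (M3 - M4)\<close> with finite positive measures and integrate against each part.
  By additivity the value does not depend on the decomposition (for bounded Borel
  functions), so no particular one, such as the Jordan decomposition, is singled out.\<close>

definition has_complex_measure_integral ::
    "(complex set \<Rightarrow> complex) \<Rightarrow> (complex \<Rightarrow> real) \<Rightarrow> complex \<Rightarrow> bool" where
  "has_complex_measure_integral \<nu> \<phi> I \<longleftrightarrow>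
     (\<exists>M1 M2 M3 M4 :: complex measure.
        (\<forall>M \<in> {M1, M2, M3, M4}. finite_measure M \<and> sets M = circle_sets \<and> integrable M \<phi>) \<and>
        (\<forall>A \<in> circle_sets.
           \<nu> A = Complex (measure M1 A - measure M2 A) (measure M3 A - measure M4 A)) \<and>
        I = Complex ((LINT \<zeta>|M1. \<phi> \<zeta>) - (LINT \<zeta>|M2. \<phi> \<zeta>))
                    ((LINT \<zeta>|M3. \<phi> \<zeta>) - (LINT \<zeta>|M4. \<phi> \<zeta>)))"

definition poisson_kernel :: "complex \<Rightarrow> complex \<Rightarrow> real" where
  "poisson_kernel z \<zeta> = (1 - (cmod z)\<^sup>2) / (cmod (z - \<zeta>))\<^sup>2"

text \<open>The operator-valued integral defining \<open>P\<^sub>\<mu>(z)\<close> is understood weakly.\<close>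

definition poisson_integral ::
    "(complex set \<Rightarrow> 'e::complex_hilbert_space \<Rightarrow> 'e) \<Rightarrow> complex \<Rightarrow> 'e \<Rightarrow> 'e" where
  "poisson_integral \<mu> z =
     (THE P. bounded_clinear P \<and>
        (\<forall>x y. has_complex_measure_integral (\<lambda>A. cinner (\<mu> A x) y) (poisson_kernel z)
                 (cinner (P x) y)))"


section \<open>Hilbert-space-valued holomorphic functions on the disc\<close>

definition has_vderiv :: "(complex \<Rightarrow> 'e::complex_hilbert_space) \<Rightarrow> 'e \<Rightarrow> complex \<Rightarrow> bool" where
  "has_vderiv f d z \<longleftrightarrow> (f has_derivative (\<lambda>h. h *\<^sub>C d)) (at z)"

definition vderiv :: "(complex \<Rightarrow> 'e::complex_hilbert_space) \<Rightarrow> complex \<Rightarrow> 'e" where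
  "vderiv f z = (THE d. has_vderiv f d z)"

text \<open>A function on the disc is represented by its extension by \<open>0\<close> to the whole plane, so that
  equality on the disc is equality and the vector space operations are pointwise.\<close>

definition holomorphic_functions :: "(complex \<Rightarrow> 'e::complex_hilbert_space) set" where
  "holomorphic_functions =
     {f. (\<forall>z \<in> unit_disc. \<exists>d. has_vderiv f d z) \<and> (\<forall>z. z \<notin> unit_disc \<longrightarrow> f z = 0)}"

definition disc_area :: "complex measure" where
  "disc_area = uniform_measure lborel unit_disc"

definition arc_length :: "complex measure" where
  "arc_length = distr (uniform_measure lborel {0..2 * pi}) (restrict_space borel unit_circle) cis"

text \<open>\<open>D_fun \<mu> n f\<close> is \<open>D\<^bsub>\<mu>,n\<^esub>(f) \<in> [0,\<infinity>]\<close>, for \<open>n \<ge> 1\<close> only; \<open>D_zero \<mu> f\<close> is \<open>D\<^bsub>\<mu>,0\<^esub>(f)\<close>.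
  The integrands are real because \<open>P\<^sub>\<mu>(z)\<close> is positive.\<close>

definition D_fun ::
    "(complex set \<Rightarrow> 'e::complex_hilbert_space \<Rightarrow> 'e) \<Rightarrow> nat \<Rightarrow> (complex \<Rightarrow> 'e) \<Rightarrow> ennreal" where
  "D_fun \<mu> n f =
     ennreal (1 / (fact n * fact (n - 1))) *
     (\<integral>\<^sup>+ z \<in> unit_disc.
        ennreal (Re (cinner (poisson_integral \<mu> z ((vderiv ^^ n) f z)) ((vderiv ^^ n) f z))
                 * (1 - (cmod z)\<^sup>2) ^ (n - 1)) \<partial>disc_area)"

definition D_zero ::
    "(complex set \<Rightarrow> 'e::complex_hilbert_space \<Rightarrow> 'e) \<Rightarrow> (complex \<Rightarrow> 'e) \<Rightarrow> real" where
  "D_zero \<mu> f =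
     Lim (at_left 1) (\<lambda>R :: real.
       LINT \<zeta>|arc_length.
         Re (cinner (poisson_integral \<mu> (of_real R * \<zeta>) (f (of_real R * \<zeta>))) (f (of_real R * \<zeta>))))"

definition H_single ::
    "(complex set \<Rightarrow> 'e::complex_hilbert_space \<Rightarrow> 'e) \<Rightarrow> nat \<Rightarrow> (complex \<Rightarrow> 'e) set" where
  "H_single \<mu> n = {f \<in> holomorphic_functions. D_fun \<mu> n f < \<infinity>}"

definition has_power_series ::
    "(complex \<Rightarrow> 'e::complex_hilbert_space) \<Rightarrow> (nat \<Rightarrow> 'e) \<Rightarrow> bool" where
  "has_power_series f a \<longleftrightarrow> (\<forall>z \<in> unit_disc. (\<lambda>j. (z ^ j) *\<^sub>C a j) sums f z)"

definition hardy_space :: "(complex \<Rightarrow> 'e::complex_hilbert_space) set" where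
  "hardy_space =
     {f. (\<forall>z. z \<notin> unit_disc \<longrightarrow> f z = 0) \<and>
         (\<exists>a. has_power_series f a \<and> summable (\<lambda>j. (norm (a j))\<^sup>2))}"

definition hardy_norm_sq :: "(complex \<Rightarrow> 'e::complex_hilbert_space) \<Rightarrow> real" where
  "hardy_norm_sq f = (\<Sum>j. (norm ((THE a. has_power_series f a) j))\<^sup>2)"

text \<open>The tuple \<open>(\<mu>\<^sub>1,\<dots>,\<mu>\<^bsub>m-1\<^esub>)\<close> is a sequence of which only the entries \<open>1,\<dots>,m-1\<close> are used.\<close>

definition H_space ::
    "(nat \<Rightarrow> complex set \<Rightarrow> 'e::complex_hilbert_space \<Rightarrow> 'e) \<Rightarrow> nat \<Rightarrow> (complex \<Rightarrow> 'e) set" where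
  "H_space \<mu> m = (\<Inter>j \<in> {1..m - 1}. H_single (\<mu> j) j) \<inter> hardy_space"

definition H_norm_sq ::
    "(nat \<Rightarrow> complex set \<Rightarrow> 'e::complex_hilbert_space \<Rightarrow> 'e) \<Rightarrow> nat \<Rightarrow> (complex \<Rightarrow> 'e) \<Rightarrow> real" where
  "H_norm_sq \<mu> m f = hardy_norm_sq f + (\<Sum>j = 1..m - 1. enn2real (D_fun (\<mu> j) j f))"

text \<open>The inner product inducing the norm of \<open>H_norm_sq\<close>, recovered by polarization.\<close>

definition H_inner ::
    "(nat \<Rightarrow> complex set \<Rightarrow> 'e::complex_hilbert_space \<Rightarrow> 'e) \<Rightarrow> nat \<Rightarrow>
     (complex \<Rightarrow> 'e) \<Rightarrow> (complex \<Rightarrow> 'e) \<Rightarrow> complex" where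
  "H_inner \<mu> m f g =
     (\<Sum>k<4. \<i> ^ k * complex_of_real (H_norm_sq \<mu> m (\<lambda>z. f z + (\<i> ^ k) *\<^sub>C g z))) / 4"

definition mult_z :: "(complex \<Rightarrow> 'e::complex_hilbert_space) \<Rightarrow> complex \<Rightarrow> 'e" where
  "mult_z f = (\<lambda>z. z *\<^sub>C f z)"


section \<open>Operators on a Hilbert space of functions\<close>

text \<open>Here \<open>V\<close> is the underlying set of a Hilbert space of functions and \<open>ip\<close> its inner product.
  Operators are maps on functions of which only the restriction to \<open>V\<close> matters.\<close>

definition adjoint_on ::
    "(complex \<Rightarrow> 'e) set \<Rightarrow> ((complex \<Rightarrow> 'e) \<Rightarrow> (complex \<Rightarrow> 'e) \<Rightarrow> complex) \<Rightarrow>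
     ((complex \<Rightarrow> 'e) \<Rightarrow> (complex \<Rightarrow> 'e)) \<Rightarrow> (complex \<Rightarrow> 'e) \<Rightarrow> (complex \<Rightarrow> 'e)" where
  "adjoint_on V ip T g = (THE h. h \<in> V \<and> (\<forall>f \<in> V. ip (T f) g = ip f h))"

definition selfadjoint_on ::
    "(complex \<Rightarrow> 'e) set \<Rightarrow> ((complex \<Rightarrow> 'e) \<Rightarrow> (complex \<Rightarrow> 'e) \<Rightarrow> complex) \<Rightarrow>
     ((complex \<Rightarrow> 'e) \<Rightarrow> (complex \<Rightarrow> 'e)) \<Rightarrow> bool" where
  "selfadjoint_on V ip T \<longleftrightarrow>
     (\<forall>f \<in> V. T f \<in> V) \<and> (\<forall>f \<in> V. \<forall>g \<in> V. ip (T f) g = ip f (T g))"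

definition beta_on ::
    "(complex \<Rightarrow> 'e::complex_hilbert_space) set \<Rightarrow>
     ((complex \<Rightarrow> 'e) \<Rightarrow> (complex \<Rightarrow> 'e) \<Rightarrow> complex) \<Rightarrow> nat \<Rightarrow>
     ((complex \<Rightarrow> 'e) \<Rightarrow> (complex \<Rightarrow> 'e)) \<Rightarrow> (complex \<Rightarrow> 'e) \<Rightarrow> (complex \<Rightarrow> 'e)" where
  "beta_on V ip k T f =
     (\<lambda>z. \<Sum>j\<le>k. (real (k choose j) * (-1) ^ (k - j)) *\<^sub>R ((adjoint_on V ip T ^^ j) ((T ^^ j) f)) z)"

definition left_inverse_on ::
    "(complex \<Rightarrow> 'e) set \<Rightarrow> ((complex \<Rightarrow> 'e) \<Rightarrow> (complex \<Rightarrow> 'e) \<Rightarrow> complex) \<Rightarrow>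
     ((complex \<Rightarrow> 'e) \<Rightarrow> (complex \<Rightarrow> 'e)) \<Rightarrow> (complex \<Rightarrow> 'e) \<Rightarrow> (complex \<Rightarrow> 'e)" where
  "left_inverse_on V ip T =
     inv_into V (adjoint_on V ip T \<circ> T) \<circ> adjoint_on V ip T"

text \<open>The operator inequality \<open>B \<ge> (\<Sum>n\<ge>1. C n)\<close>, the series being taken weakly. Quadratic forms
  of self-adjoint operators are real, so taking real parts loses nothing.\<close>

definition ge_operator_series ::
    "(complex \<Rightarrow> 'e) set \<Rightarrow> ((complex \<Rightarrow> 'e) \<Rightarrow> (complex \<Rightarrow> 'e) \<Rightarrow> complex) \<Rightarrow>
     ((complex \<Rightarrow> 'e) \<Rightarrow> (complex \<Rightarrow> 'e)) \<Rightarrow>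
     (nat \<Rightarrow> (complex \<Rightarrow> 'e) \<Rightarrow> (complex \<Rightarrow> 'e)) \<Rightarrow> bool" where
  "ge_operator_series V ip B C \<longleftrightarrow>
     selfadjoint_on V ip B \<and> (\<forall>n\<ge>1. selfadjoint_on V ip (C n)) \<and>
     (\<forall>f \<in> V. summable (\<lambda>n. Re (ip (C (Suc n) f) f)) \<and>
               (\<Sum>n. Re (ip (C (Suc n) f) f)) \<le> Re (ip (B f) f))"

end

theory Submission
  imports Defs "HOL-Library.Function_Algebras" "HOL-Probability.Distribution_Functions"
begin

text \<open>
  Let \<open>f = \<Sum>a\<^sub>k z\<^sup>k\<close> and let \<open>c\<^sub>j\<close> be the Fourier moments of \<open>\<mu>\<close>. Integrating over circles and then
  radially, \<open>D\<^bsub>\<mu>,n\<^esub>(f)\<close> is the increasing limit as \<open>t \<rightarrow> 1\<close> of the quadratic forms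
  \<open>q\<^sub>n(t; a) = \<Sum>\<^bsub>k,l\<^esub> (min k l choose n) t\<^bsup>max k l\<^esup> \<langle>c\<^bsub>k-l\<^esub> a\<^sub>k, a\<^sub>l\<rangle>\<close>: Taylor's formula applies, because the
  \<open>n\<close>-th derivative in \<open>t\<close> is a circle mean of a nonnegative function. Pascal's rule gives
  \<open>q\<^sub>n(t; za) = t (q\<^sub>n(t; a) + q\<^bsub>n-1\<^esub>(t; a))\<close>, hence \<open>D\<^bsub>\<mu>,n\<^esub>(zf) = D\<^bsub>\<mu>,n\<^esub>(f) + D\<^bsub>\<mu>,n-1\<^esub>(f)\<close>, so that
  \<open>\<langle>\<beta>\<^sub>r f, f\<rangle> = \<Sum>\<^bsub>j\<ge>r\<^esub> D\<^bsub>\<mu>\<^sub>j,j-r\<^esub>(f)\<close>. As constants are orthogonal to \<open>zH\<close>, \<open>L f = (f - f(0)) / z\<close>, and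
  the claim reduces to \<open>D\<^bsub>\<mu>,n\<^esub>(f) = \<Sum>\<^bsub>i\<ge>1\<^esub> D\<^bsub>\<mu>,n-1\<^esub>(L\<^sup>i f)\<close>, that is, to \<open>D\<^bsub>\<mu>,n\<^esub>(L\<^sup>N f) \<rightarrow> 0\<close>. For \<open>n \<ge> 2\<close>
  this follows from monotonicity in \<open>t\<close>; for \<open>n = 1\<close> polynomials approximate \<open>f\<close> by a
  minimal-norm argument. Riesz representation in the complete space \<open>H\<close> supplies the adjoints.
\<close>

text \<open>Estimates are made at parameters t < 1, where the coefficients of any holomorphic
  function on the disc give absolutely convergent sums; t stands for a squared radius, because under
  normalized area the squared modulus of z is uniformly distributed on [0,1]. For n \<ge> 1 the
  forms increase in t, so finiteness of D_n means boundedness of q_n. The form q_0 need not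
  increase: for the unit point mass at 1 and f = 1 - z it equals 1 - t. This is the obstacle at n =
  1, since q_0(t; L^i f) cannot be bounded by D_0(L^i f). What remains is that the numbers D_0(L^i
  f) are summable, so N D_0(L^N f) \<le> 1 for arbitrarily large N, and this quantity is the excess
  of D_1(z^N L^N f) over D_1(L^N f). Hilbert space arguments are run over real scalars, on sequences
  with pointwise operations: the real part of the inner product together with multiplication by i
  determines everything, and the real adjoint of a complex linear operator is its complex
  adjoint.\<close>

instantiation "fun" :: (type, real_vector) real_vector
begin

definition scaleR_fun :: "real \<Rightarrow> ('a \<Rightarrow> 'b) \<Rightarrow> 'a \<Rightarrow> 'b" where
  "scaleR_fun c f = (\<lambda>x. c *\<^sub>R f x)"

instance
  by standard (simp_all add: scaleR_fun_def fun_eq_iff algebra_simps)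

end

lemma scaleR_fun_apply [simp]: "(c *\<^sub>R f) x = c *\<^sub>R f x"
  by (simp add: scaleR_fun_def)

section \<open>Complex inner products\<close>

lemma cinner_add_right: "cinner x (y + z) = cinner x y + cinner x z"
  for x :: "'e::complex_hilbert_space"
  by (metis cinner_add_left cinner_commute complex_cnj_add)

lemma cinner_scaleC_right: "cinner x (c *\<^sub>C y) = cnj c * cinner x y"
  for x :: "'e::complex_hilbert_space"
  by (metis cinner_commute cinner_scaleC_left complex_cnj_mult)

lemma scaleR_conv_scaleC: "r *\<^sub>R x = complex_of_real r *\<^sub>C x" for x :: "'e::complex_hilbert_space"
  by (simp add: scaleC_of_real)

lemma scaleC_one [simp]: "1 *\<^sub>C x = x" for x :: "'e::complex_hilbert_space"
  using scaleC_of_real [of 1 x] by simp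

lemma scaleC_zero_left [simp]: "0 *\<^sub>C x = 0" for x :: "'e::complex_hilbert_space"
  using scaleC_of_real [of 0 x] by simp

lemma scaleC_zero_right [simp]: "c *\<^sub>C 0 = (0 :: 'e::complex_hilbert_space)"
  using scaleC_add_right [of c 0 0] by simp

lemma scaleC_minus_left: "(- c) *\<^sub>C x = - (c *\<^sub>C x)" for x :: "'e::complex_hilbert_space"
  using scaleC_add_left [of c "- c" x] by (simp add: eq_neg_iff_add_eq_0 add.commute)

lemma scaleC_minus_right: "c *\<^sub>C (- x) = - (c *\<^sub>C x)" for x :: "'e::complex_hilbert_space"
  using scaleC_add_right [of c x "- x"] by (simp add: eq_neg_iff_add_eq_0 add.commute)

lemma scaleC_diff_right: "c *\<^sub>C (x - y) = c *\<^sub>C x - c *\<^sub>C y" for x :: "'e::complex_hilbert_space"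
  using scaleC_add_right [of c x "- y"] by (simp add: scaleC_minus_right)

lemma scaleC_scaleR: "c *\<^sub>C (r *\<^sub>R x) = r *\<^sub>R (c *\<^sub>C x)" for x :: "'e::complex_hilbert_space"
  by (simp add: scaleR_conv_scaleC scaleC_scaleC mult.commute)

lemma cinner_self: "cinner x x = complex_of_real ((norm x)\<^sup>2)" for x :: "'e::complex_hilbert_space"
proof -
  have "Im (cinner x x) = 0" using cinner_commute [of x x] by (simp add: complex_eq_iff)
  then show ?thesis by (simp add: complex_eq_iff Re_cinner power2_norm_eq_inner)
qed

lemma norm_scaleC [simp]: "norm (c *\<^sub>C x) = cmod c * norm x" for x :: "'e::complex_hilbert_space"
proof -
  have "complex_of_real ((norm (c *\<^sub>C x))\<^sup>2) = (c * cnj c) * cinner x x"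
    by (simp only: cinner_self [symmetric] cinner_scaleC_left cinner_scaleC_right ac_simps)
  also have "\<dots> = complex_of_real ((cmod c * norm x)\<^sup>2)"
    by (simp only: cinner_self power_mult_distrib complex_norm_square [symmetric] of_real_mult)
  finally have "(norm (c *\<^sub>C x))\<^sup>2 = (cmod c * norm x)\<^sup>2" by (simp only: of_real_eq_iff)
  then show ?thesis by (simp add: power2_eq_iff_nonneg)
qed

text \<open>Imaginary parts are real parts against a rotated argument, which lets real Hilbert space
  arguments recover complex statements.\<close>

lemma cinner_eq_Complex: "cinner x y = Complex (inner x y) (inner x (\<i> *\<^sub>C y))"
  for x :: "'e::complex_hilbert_space"
  by (simp add: complex_eq_iff cinner_scaleC_right flip: Re_cinner)

lemma inner_scaleC_i: "inner (\<i> *\<^sub>C x) (\<i> *\<^sub>C y) = inner x y" for x :: "'e::complex_hilbert_space"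
  by (simp flip: Re_cinner add: cinner_scaleC_left cinner_scaleC_right)

lemma cinner_ext: "(\<And>y. cinner x y = cinner x' y) \<Longrightarrow> x = x'" for x :: "'e::complex_hilbert_space"
  by (metis Re_cinner inner_commute vector_eq_rdot)

lemma norm_cinner_le: "cmod (cinner x y) \<le> norm x * norm y" for x :: "'e::complex_hilbert_space"
proof (cases "cinner x y = 0")
  case False
  define w where "w = cinner x y"
  \<comment> \<open>Rotating \<open>y\<close> by the phase of \<open>cinner x y\<close> makes the
    product real and nonnegative, so the real Cauchy-Schwarz inequality applies.\<close>
  define u where "u = w / complex_of_real (cmod w)"
  have u: "cmod u = 1" using False by (simp add: u_def w_def norm_divide)
  have "cnj u * w = (w * cnj w) / complex_of_real (cmod w)" by (simp add: u_def mult.commute)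
  also have "\<dots> = complex_of_real (cmod w)"
    using False by (simp add: w_def power2_eq_square flip: complex_norm_square)
  finally have "cmod (cinner x y) = Re (cnj u * cinner x y)" by (simp add: w_def)
  also have "\<dots> = inner x (u *\<^sub>C y)" by (simp add: cinner_scaleC_right flip: Re_cinner)
  also have "\<dots> \<le> norm x * norm (u *\<^sub>C y)" by (rule norm_cauchy_schwarz)
  finally show ?thesis using u by simp
qed simp

lemma bounded_bilinear_scaleC: "bounded_bilinear (\<lambda>c (x :: 'e::complex_hilbert_space). c *\<^sub>C x)"
proof
  show "\<exists>K. \<forall>a b. norm (a *\<^sub>C (b :: 'e)) \<le> norm a * norm b * K" by (rule exI [of _ 1]) simp
qed (simp_all add: scaleC_add_left scaleC_add_right scaleC_scaleR,
     simp add: scaleR_conv_scaleC scaleC_scaleC scaleR_conv_of_real)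

lemma scaleC_sum_right: "c *\<^sub>C (\<Sum>i\<in>I. f i) = (\<Sum>i\<in>I. c *\<^sub>C f i)"
  for f :: "_ \<Rightarrow> 'e::complex_hilbert_space"
  by (induction I rule: infinite_finite_induct) (simp_all add: scaleC_add_right)

section \<open>Riesz representation on a complete subspace\<close>

text \<open>The carrier is a set with its own form, because the space of interest consists of
  sequences and its inner product is a boundary limit rather than that of a type class. Completeness
  is phrased through the form alone, without a topology.\<close>

locale hilbert_on =
  fixes V :: "'v::real_vector set" and s :: "'v \<Rightarrow> 'v \<Rightarrow> real"
  assumes V: "subspace V"
    and s_add: "\<lbrakk>u \<in> V; v \<in> V; w \<in> V\<rbrakk> \<Longrightarrow> s (u + v) w = s u w + s v w"
    and s_scale: "\<lbrakk>u \<in> V; v \<in> V\<rbrakk> \<Longrightarrow> s (c *\<^sub>R u) v = c * s u v"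
    and s_commute: "\<lbrakk>u \<in> V; v \<in> V\<rbrakk> \<Longrightarrow> s u v = s v u"
    and s_nonneg: "u \<in> V \<Longrightarrow> s u u \<ge> 0"
    and s_definite: "u \<in> V \<Longrightarrow> s u u = 0 \<Longrightarrow> u = 0"
    and s_complete: "\<lbrakk>\<And>n. X n \<in> V; \<And>e. e > 0 \<Longrightarrow> \<exists>N::nat. \<forall>m\<ge>N. \<forall>n\<ge>N. s (X m - X n) (X m - X n) < e\<rbrakk>
        \<Longrightarrow> \<exists>x\<in>V. (\<lambda>n. s (X n - x) (X n - x)) \<longlonglongrightarrow> 0"
begin

lemmas V_mem [simp] = subspace_0 [OF V] subspace_add [OF V] subspace_scale [OF V] subspace_diff [OF V]

lemma s_add': "\<lbrakk>u \<in> V; v \<in> V; w \<in> V\<rbrakk> \<Longrightarrow> s w (u + v) = s w u + s w v"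
  using s_add [of u v w] s_commute [of w] by (simp)

lemma s_scale': "\<lbrakk>u \<in> V; v \<in> V\<rbrakk> \<Longrightarrow> s u (c *\<^sub>R v) = c * s u v"
  using s_scale [of v u c] s_commute [of u] by simp

lemma s_diff: "\<lbrakk>u \<in> V; v \<in> V; w \<in> V\<rbrakk> \<Longrightarrow> s (u - v) w = s u w - s v w"
  using s_add [of "u - v" v w] by simp

lemma s_diff': "\<lbrakk>u \<in> V; v \<in> V; w \<in> V\<rbrakk> \<Longrightarrow> s w (u - v) = s w u - s w v"
  using s_add' [of "u - v" v w] by simp

lemma s_zero [simp]: "u \<in> V \<Longrightarrow> s 0 u = 0" "u \<in> V \<Longrightarrow> s u 0 = 0"
  using s_scale [of 0 u 0] s_scale' [of u 0 0] by simp_all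

lemmas s_simps = s_add s_add' s_scale s_scale' s_diff s_diff'

lemma cauchy_schwarz:
  assumes "u \<in> V" "v \<in> V"
  shows "(s u v)\<^sup>2 \<le> s u u * s v v"
proof (cases "s v v = 0")
  case True
  then have "v = 0" using s_definite assms by blast
  then show ?thesis using assms by simp
next
  case False
  then have p: "s v v > 0" using s_nonneg [of v] assms by simp
  have "0 \<le> s (s v v *\<^sub>R u - s u v *\<^sub>R v) (s v v *\<^sub>R u - s u v *\<^sub>R v)"
    using assms by (intro s_nonneg) simp
  also have "\<dots> = s v v * (s u u * s v v - (s u v)\<^sup>2)"
    using assms s_commute [of v u] by (simp add: s_simps algebra_simps power2_eq_square)
  finally show ?thesis using p by (simp add: zero_le_mult_iff)
qed

text \<open>The representing vector minimizes \<open>J u = s u u - 2 * \<phi> u\<close>. The bound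
  on \<open>\<phi>\<close> keeps \<open>J\<close> bounded below, and the parallelogram identity
  makes a minimizing sequence Cauchy.\<close>

lemma riesz:
  assumes add: "\<And>u v. \<lbrakk>u \<in> V; v \<in> V\<rbrakk> \<Longrightarrow> \<phi> (u + v) = \<phi> u + \<phi> v"
    and scale: "\<And>c u. u \<in> V \<Longrightarrow> \<phi> (c *\<^sub>R u) = c * \<phi> u"
    and bound: "\<And>u. u \<in> V \<Longrightarrow> (\<phi> u)\<^sup>2 \<le> C * s u u"
  shows "\<exists>h\<in>V. \<forall>u\<in>V. \<phi> u = s u h"
proof -
  have C: "C * s u u \<ge> 0" if "u \<in> V" for u using bound [OF that] by (smt (verit) zero_le_power2)
  define J where "J u = s u u - 2 * \<phi> u" for u
  have phi_diff: "\<phi> (u - v) = \<phi> u - \<phi> v" if "u \<in> V" "v \<in> V" for u v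
    using add [of "u - v" v] that by simp
  have lower: "J u \<ge> - \<bar>C\<bar>" if "u \<in> V" for u
  proof -
    have "(\<phi> u)\<^sup>2 \<le> \<bar>C\<bar> * s u u"
      using bound [OF that] s_nonneg [OF that] by (smt (verit) mult_right_mono)
    also have "\<dots> \<le> ((\<bar>C\<bar> + s u u) / 2)\<^sup>2"
      using sum_squares_bound [of "\<bar>C\<bar>" "s u u"] by (simp add: power2_eq_square field_simps)
    finally have "\<phi> u \<le> (\<bar>C\<bar> + s u u) / 2"
      by (rule power2_le_imp_le) (use s_nonneg [OF that] in simp)
    then show ?thesis by (simp add: J_def)
  qed
  define d where "d = Inf (J ` V)"
  have bdd: "bdd_below (J ` V)" using lower by (force intro: bdd_belowI)
  have ne: "J ` V \<noteq> {}" using V_mem(1) by blast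
  have d: "d \<le> J u" if "u \<in> V" for u
    unfolding d_def using bdd that by (simp add: cInf_lower)
  have "\<exists>u\<in>V. J u < d + 1 / Suc n" for n
    using cInf_lessD [OF ne, of "d + 1 / Suc n"] d_def by force
  then obtain X where X: "\<And>n. X n \<in> V" "\<And>n. J (X n) < d + 1 / Suc n" by metis
  \<comment> \<open>The linear terms cancel, so the distance of \<open>u\<close> and
    \<open>v\<close> is governed by how far \<open>J\<close> at both points exceeds \<open>J\<close>
    at their midpoint.\<close>
  have par: "s (u - v) (u - v) = 2 * J u + 2 * J v - 4 * J ((1/2) *\<^sub>R (u + v))" if "u \<in> V" "v \<in> V" for u v
    using that s_commute [of u v] by (simp add: J_def s_simps scale add algebra_simps)
  have cau: "s (X m - X n) (X m - X n) < 2 / Suc m + 2 / Suc n" for m n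
  proof -
    have "d \<le> J ((1/2) *\<^sub>R (X m + X n))" using d X(1) by simp
    moreover have "2 / real (Suc k) = 2 * (1 / real (Suc k))" for k by simp
    ultimately show ?thesis using par [OF X(1) X(1), of m n] X(2) [of m] X(2) [of n] by argo
  qed
  have "\<exists>x\<in>V. (\<lambda>n. s (X n - x) (X n - x)) \<longlonglongrightarrow> 0"
  proof (rule s_complete)
    fix e :: real assume "e > 0"
    then obtain N :: nat where N: "4 / e < N" using reals_Archimedean2 by blast
    have "s (X m - X n) (X m - X n) < e" if "m \<ge> N" "n \<ge> N" for m n
    proof -
      have "2 / real (Suc k) < e / 2" if "k \<ge> N" for k
      proof -
        have "4 / e < real (Suc k)" using N that by linarith
        then show ?thesis using \<open>e > 0\<close> by (simp add: field_simps)
      qed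
      then show ?thesis using cau [of m n] that by (smt (verit) field_sum_of_halves)
    qed
    then show "\<exists>N. \<forall>m\<ge>N. \<forall>n\<ge>N. s (X m - X n) (X m - X n) < e" by blast
  qed (rule X)
  then obtain x where x: "x \<in> V" and lim: "(\<lambda>n. s (X n - x) (X n - x)) \<longlonglongrightarrow> 0" by blast
  \<comment> \<open>Expanding \<open>J\<close> at the limit of a minimising sequence: the first order term vanishes.\<close>
  have "\<phi> u = s u x" if u: "u \<in> V" for u
  proof -
    define g where "g = s x u - \<phi> u"
    have lin: "(\<lambda>n. s (X n - x) u) \<longlonglongrightarrow> 0"
    proof -
      have "(\<lambda>n. (s (X n - x) u)\<^sup>2) \<longlonglongrightarrow> 0"
      proof (rule tendsto_sandwich [of "\<lambda>_. 0" _ _ "\<lambda>n. s (X n - x) (X n - x) * s u u"])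
        show "(\<lambda>n. s (X n - x) (X n - x) * s u u) \<longlonglongrightarrow> 0"
          using tendsto_mult_left_zero [OF lim] by blast
        show "\<forall>\<^sub>F n in sequentially. (s (X n - x) u)\<^sup>2 \<le> s (X n - x) (X n - x) * s u u"
          using X(1) x u cauchy_schwarz by (intro always_eventually) simp
      qed auto
      then show ?thesis by simp
    qed
    have step: "0 \<le> 2 * c * g + c\<^sup>2 * s u u" for c
    proof -
      have inv: "(\<lambda>n. 1 / real (Suc n)) \<longlonglongrightarrow> 0"
        by (rule LIMSEQ_Suc [OF lim_inverse_n'])
      have "(\<lambda>n. 1 / real (Suc n) + 2 * c * s (X n - x) u + 2 * c * g + c\<^sup>2 * s u u)
              \<longlonglongrightarrow> 0 + 2 * c * 0 + 2 * c * g + c\<^sup>2 * s u u"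
        by (intro tendsto_add tendsto_mult_left tendsto_const inv lin)
      then have "(\<lambda>n. 1 / real (Suc n) + 2 * c * s (X n - x) u + 2 * c * g + c\<^sup>2 * s u u)
              \<longlonglongrightarrow> 2 * c * g + c\<^sup>2 * s u u" by simp
      moreover have "1 / real (Suc n) + 2 * c * s (X n - x) u + 2 * c * g + c\<^sup>2 * s u u \<ge> 0" for n
      proof -
        have "J (X n + c *\<^sub>R u) = J (X n) + 2 * c * s (X n - x) u + 2 * c * g + c\<^sup>2 * s u u"
          using X(1) u x s_commute [OF u X(1)] s_commute [OF u x] by (simp add: J_def g_def s_simps scale add algebra_simps power2_eq_square)
        then show ?thesis using d [OF V_mem(2) [OF X(1) V_mem(3) [OF u]], of n c] X(2) [of n] by linarith
      qed
      ultimately show ?thesis using LIMSEQ_le_const by blast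
    qed
    \<comment> \<open>Testing the nonnegative expression at its minimizer \<open>c\<close>, or at
      \<open>c = - g\<close> when \<open>u\<close> has zero norm, leaves a negative multiple of
      \<open>g\<^sup>2\<close>.\<close>
    have "g = 0"
    proof (cases "s u u = 0")
      case True
      then have "g\<^sup>2 \<le> 0" using step [of "- g"] by (simp add: power2_eq_square)
      then show ?thesis by simp
    next
      case False
      then have p: "s u u > 0" using s_nonneg [OF u] by simp
      have "0 \<le> (2 * (- g / s u u) * g + (- g / s u u)\<^sup>2 * s u u) * s u u"
        using step [of "- g / s u u"] p by simp
      also have "\<dots> = - g\<^sup>2" using p by (simp add: field_simps power2_eq_square)
      finally show ?thesis by simp
    qed
    then show ?thesis using s_commute [OF u x] by (simp add: g_def)
  qed
  then show ?thesis using x by blast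
qed

lemma adjoint:
  assumes T: "\<And>u. u \<in> V \<Longrightarrow> T u \<in> V"
    and add: "\<And>u v. \<lbrakk>u \<in> V; v \<in> V\<rbrakk> \<Longrightarrow> T (u + v) = T u + T v"
    and scale: "\<And>c u. u \<in> V \<Longrightarrow> T (c *\<^sub>R u) = c *\<^sub>R T u"
    and bound: "\<And>u. u \<in> V \<Longrightarrow> s (T u) (T u) \<le> C * s u u"
    and g: "g \<in> V"
  shows "\<exists>h\<in>V. \<forall>u\<in>V. s (T u) g = s u h"
proof (rule riesz)
  show "(s (T u) g)\<^sup>2 \<le> (C * s g g) * s u u" if "u \<in> V" for u
  proof -
    have "(s (T u) g)\<^sup>2 \<le> s (T u) (T u) * s g g" using T g that cauchy_schwarz by blast
    also have "\<dots> \<le> (C * s u u) * s g g" using bound [OF that] s_nonneg [OF g] by (rule mult_right_mono)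
    finally show ?thesis by (simp add: mult_ac)
  qed
qed (use T g add scale s_add s_scale in simp_all)

lemma eq_of_s_eq:
  assumes "h \<in> V" "h' \<in> V" "\<And>u. u \<in> V \<Longrightarrow> s u h = s u h'"
  shows "h = h'"
proof -
  have "s (h - h') (h - h') = 0" using assms by (simp add: s_diff')
  then have "h - h' = 0" using assms s_definite V_mem(4) by blast
  then show ?thesis by simp
qed

end

section \<open>Toeplitz forms on coefficient sequences\<close>

definition disc_seq :: "(nat \<Rightarrow> 'e::real_normed_vector) \<Rightarrow> bool" where
  "disc_seq a \<longleftrightarrow> (\<forall>r. 0 \<le> r \<and> r < 1 \<longrightarrow> summable (\<lambda>k. r ^ k * norm (a k)))"

lemma disc_seqD: "disc_seq a \<Longrightarrow> 0 \<le> r \<Longrightarrow> r < 1 \<Longrightarrow> summable (\<lambda>k. r ^ k * norm (a k))"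
  by (simp add: disc_seq_def)

lemma disc_seq_dominated:
  assumes a: "disc_seq a" and b: "\<And>k. norm (b k) \<le> C * norm (a k)"
  shows "disc_seq b"
  unfolding disc_seq_def
proof (intro allI impI, elim conjE)
  fix r :: real assume r: "0 \<le> r" "r < 1"
  show "summable (\<lambda>k. r ^ k * norm (b k))"
  proof (rule summable_comparison_test')
    show "summable (\<lambda>k. C * (r ^ k * norm (a k)))" using disc_seqD [OF a r] by (rule summable_mult)
    show "norm (r ^ k * norm (b k)) \<le> C * (r ^ k * norm (a k))" for k
      using mult_left_mono [OF b, of "r ^ k" k] r by (simp add: mult_ac)
  qed
qed

lemma disc_seq_add:
  assumes "disc_seq a" "disc_seq b"
  shows "disc_seq (a + b)"
  unfolding disc_seq_def
proof (intro allI impI, elim conjE)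
  fix r :: real assume r: "0 \<le> r" "r < 1"
  show "summable (\<lambda>k. r ^ k * norm ((a + b) k))"
  proof (rule summable_comparison_test')
    show "summable (\<lambda>k. r ^ k * norm (a k) + r ^ k * norm (b k))"
      using disc_seqD [OF assms(1) r] disc_seqD [OF assms(2) r] by (rule summable_add)
    show "norm (r ^ k * norm ((a + b) k)) \<le> r ^ k * norm (a k) + r ^ k * norm (b k)" for k
      using mult_left_mono [OF norm_triangle_ineq, of "r ^ k" "a k" "b k"] r by (simp add: distrib_left)
  qed
qed

lemma disc_seq_scaleR: "disc_seq a \<Longrightarrow> disc_seq (c *\<^sub>R a)"
  by (erule disc_seq_dominated [where C = "\<bar>c\<bar>"]) simp

lemma disc_seq_scaleC: "disc_seq a \<Longrightarrow> disc_seq (\<lambda>k. w *\<^sub>C a k)"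
  for a :: "nat \<Rightarrow> 'e::complex_hilbert_space"
  by (erule disc_seq_dominated [where C = "cmod w"]) simp

lemma disc_seq_diff: "disc_seq a \<Longrightarrow> disc_seq b \<Longrightarrow> disc_seq (a - b)"
  using disc_seq_add [of a "(-1) *\<^sub>R b"] disc_seq_scaleR [of b "-1"] by simp

text \<open>A slightly larger radius \<open>r'\<close> absorbs the index, because
  \<open>k * (r / r') ^ k\<close> tends to zero and so is bounded.\<close>

lemma disc_seq_mult_index:
  assumes a: "disc_seq a"
  shows "disc_seq (\<lambda>k. real k *\<^sub>R a k)"
  unfolding disc_seq_def
proof (intro allI impI, elim conjE)
  fix r :: real assume r: "0 \<le> r" "r < 1"
  define r' where "r' = (1 + r) / 2"
  have r': "0 < r'" "r < r'" "r' < 1" using r by (auto simp: r'_def)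
  have "(\<lambda>k. real k * (r / r') ^ k) \<longlonglongrightarrow> 0"
    using r r' by (intro powser_times_n_limit_0) simp
  then have "Bseq (\<lambda>k. real k * (r / r') ^ k)" using convergentI convergent_imp_Bseq by blast
  then obtain B where B: "\<And>k. \<bar>real k * (r / r') ^ k\<bar> \<le> B" by (auto simp: Bseq_def)
  show "summable (\<lambda>k. r ^ k * norm (real k *\<^sub>R a k))"
  proof (rule summable_comparison_test')
    show "summable (\<lambda>k. B * (r' ^ k * norm (a k)))"
      by (rule summable_mult [OF disc_seqD [OF a]]) (use r' in auto)
    show "norm (r ^ k * norm (real k *\<^sub>R a k)) \<le> B * (r' ^ k * norm (a k))" for k
    proof -
      have "r ^ k * norm (real k *\<^sub>R a k) = (real k * (r / r') ^ k) * (r' ^ k * norm (a k))"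
        using r' by (simp add: power_divide)
      also have "\<dots> \<le> B * (r' ^ k * norm (a k))"
        using B [of k] r' by (intro mult_right_mono) auto
      finally show ?thesis using r by simp
    qed
  qed
qed

lemma disc_seq_choose:
  assumes a: "disc_seq a"
  shows "disc_seq (\<lambda>k. real (k choose n) *\<^sub>R a k)"
proof -
  have "disc_seq (\<lambda>k. real (k ^ n) *\<^sub>R a k)"
  proof (induction n)
    case (Suc n)
    then show ?case using disc_seq_mult_index [OF Suc] by simp
  qed (use a in simp)
  then show ?thesis
  proof (rule disc_seq_dominated [where C = 1])
    fix k
    have "k choose n \<le> k ^ n"
      by (cases "n \<le> k") (simp_all add: binomial_le_pow binomial_eq_0)
    then have "real (k choose n) \<le> real (k ^ n)" by (simp only: of_nat_le_iff)
    then show "norm (real (k choose n) *\<^sub>R a k) \<le> 1 * norm (real (k ^ n) *\<^sub>R a k)"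
      by (simp add: mult_right_mono)
  qed
qed

text \<open>Multiplication by \<open>z\<close> on coefficients; \<open>shift_down\<close> will turn
  out to be the left inverse \<open>L\<close>.\<close>

definition shift_up :: "(nat \<Rightarrow> 'e::zero) \<Rightarrow> nat \<Rightarrow> 'e" where
  "shift_up a k = (case k of 0 \<Rightarrow> 0 | Suc j \<Rightarrow> a j)"

definition shift_down :: "(nat \<Rightarrow> 'e) \<Rightarrow> nat \<Rightarrow> 'e" where
  "shift_down a k = a (Suc k)"

lemma shift_up_simps [simp]: "shift_up a 0 = 0" "shift_up a (Suc k) = a k"
  by (simp_all add: shift_up_def)

lemma shift_down_up [simp]: "shift_down (shift_up a) = a"
  by (simp add: fun_eq_iff shift_down_def)

lemma funpow_shift_down: "(shift_down ^^ n) a k = a (k + n)"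
  by (induction n arbitrary: k) (simp_all add: shift_down_def)

lemma funpow_shift_up: "(shift_up ^^ n) a k = (if k < n then 0 else a (k - n))"
proof (induction n arbitrary: k)
  case (Suc n)
  then show ?case by (cases k) simp_all
qed simp

lemma disc_seq_shift_down:
  assumes "disc_seq a"
  shows "disc_seq (shift_down a)"
  unfolding disc_seq_def
proof (intro allI impI, elim conjE)
  fix r :: real assume r: "0 \<le> r" "r < 1"
  \<comment> \<open>The estimate divides by the radius, and \<open>r\<close> may be 0.\<close>
  define r' where "r' = (1 + r) / 2"
  have r': "0 < r'" "r \<le> r'" "r' < 1" using r by (auto simp: r'_def)
  show "summable (\<lambda>k. r ^ k * norm (shift_down a k))"
  proof (rule summable_comparison_test')
    have "summable (\<lambda>k. r' ^ Suc k * norm (a (Suc k)))"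
      using disc_seqD [OF assms, of r'] r' by (subst summable_Suc_iff) auto
    then show "summable (\<lambda>k. inverse r' * (r' ^ Suc k * norm (a (Suc k))))" by (rule summable_mult)
    show "norm (r ^ k * norm (shift_down a k)) \<le> inverse r' * (r' ^ Suc k * norm (a (Suc k)))" for k
    proof -
      have "r ^ k * norm (a (Suc k)) \<le> r' ^ k * norm (a (Suc k))"
        using r r' by (simp add: power_mono mult_right_mono)
      also have "\<dots> = inverse r' * (r' ^ Suc k * norm (a (Suc k)))" using r' by simp
      finally show ?thesis using r by (simp add: shift_down_def)
    qed
  qed
qed

lemma disc_seq_shift_up:
  assumes "disc_seq a"
  shows "disc_seq (shift_up a)"
  unfolding disc_seq_def
proof (intro allI impI, elim conjE)
  fix r :: real assume r: "0 \<le> r" "r < 1"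
  have "summable (\<lambda>k. r * (r ^ k * norm (a k)))" using disc_seqD [OF assms r] by (rule summable_mult)
  then have "summable (\<lambda>k. r ^ Suc k * norm (shift_up a (Suc k)))" by (simp add: mult_ac)
  then show "summable (\<lambda>k. r ^ k * norm (shift_up a k))" by (subst (asm) summable_Suc_iff)
qed

lemma disc_seq_const: "disc_seq (\<lambda>_. x)"
  unfolding disc_seq_def by (auto intro!: summable_mult2 summable_geometric)

lemma disc_seq_bounded: "(\<And>k. norm (a k) \<le> S) \<Longrightarrow> disc_seq a"
  by (rule disc_seq_dominated [OF disc_seq_const [of "S::real"], where C = 1]) (smt (verit) real_norm_def mult_1)

\<comment> \<open>The coefficients of the \<open>n\<close>-th derivative of \<open>\<Sum>k. a k * z ^ k\<close>.\<close>
definition deriv_seq :: "nat \<Rightarrow> (nat \<Rightarrow> 'e::real_vector) \<Rightarrow> nat \<Rightarrow> 'e" where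
  "deriv_seq n a k = (fact (k + n) / fact k) *\<^sub>R a (k + n)"

lemma fact_quotient: "(fact (k + n) / fact k :: real) = fact n * real ((k + n) choose n)"
  by (simp add: binomial_fact)

lemma disc_seq_deriv_seq:
  assumes "disc_seq a"
  shows "disc_seq (deriv_seq n a)"
proof -
  have "disc_seq (shift_down b)" if "disc_seq b" for b :: "nat \<Rightarrow> 'a" using that by (rule disc_seq_shift_down)
  then have "disc_seq ((shift_down ^^ i) b)" if "disc_seq b" for i and b :: "nat \<Rightarrow> 'a"
    using that by (induction i) simp_all
  then have "disc_seq ((shift_down ^^ n) (\<lambda>k. real (k choose n) *\<^sub>R a k))"
    using disc_seq_choose [OF assms] by blast
  then have "disc_seq (fact n *\<^sub>R (shift_down ^^ n) (\<lambda>k. real (k choose n) *\<^sub>R a k))"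
    by (rule disc_seq_scaleR)
  then show ?thesis
    by (rule disc_seq_dominated [where C = 1])
       (simp add: deriv_seq_def funpow_shift_down fact_quotient del: of_nat_fact)
qed

text \<open>Split \<open>t ^ M\<close> into two factors \<open>sqrt t ^ M\<close>. One is absorbed
  by the partial sum of \<open>u\<close>, since \<open>sqrt t ^ M \<le> sqrt t ^ k\<close> for
  \<open>k \<le> M\<close>; the other makes the series of \<open>v\<close> converge.\<close>

lemma summable_partial_sum_product:
  fixes u v :: "nat \<Rightarrow> real"
  assumes u: "disc_seq u" and v: "disc_seq v" and t: "0 \<le> t" "t < 1"
  shows "summable (\<lambda>M. t ^ M * ((\<Sum>k\<le>M. \<bar>u k\<bar>) * \<bar>v M\<bar>))"
proof (rule summable_comparison_test')
  define r where "r = sqrt t"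
  have r: "0 \<le> r" "r < 1" "r * r = t" using t by (auto simp: r_def)
  show "summable (\<lambda>M. (\<Sum>k. r ^ k * norm (u k)) * (r ^ M * norm (v M)))"
    by (rule summable_mult [OF disc_seqD [OF v r(1,2)]])
  fix M
  have "r ^ M * (\<Sum>k\<le>M. \<bar>u k\<bar>) \<le> (\<Sum>k\<le>M. r ^ k * norm (u k))"
    unfolding sum_distrib_left using r by (intro sum_mono) (simp add: mult_right_mono power_decreasing)
  also have "\<dots> \<le> (\<Sum>k. r ^ k * norm (u k))"
    by (rule sum_le_suminf [OF disc_seqD [OF u r(1,2)]]) (use r in auto)
  finally have "(r ^ M * (\<Sum>k\<le>M. \<bar>u k\<bar>)) * (r ^ M * \<bar>v M\<bar>) \<le> (\<Sum>k. r ^ k * norm (u k)) * (r ^ M * norm (v M))"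
    using r by (simp only: real_norm_def) (intro mult_right_mono, auto)
  moreover have "t ^ M = r ^ M * r ^ M" using r by (simp flip: power_mult_distrib)
  ultimately show "norm (t ^ M * ((\<Sum>k\<le>M. \<bar>u k\<bar>) * \<bar>v M\<bar>)) \<le> (\<Sum>k. r ^ k * norm (u k)) * (r ^ M * norm (v M))"
    using t r(1) by (subst real_norm_def, subst abs_of_nonneg) (simp_all add: mult_ac sum_nonneg)
qed

section \<open>Regularized Toeplitz forms and their behaviour under the shifts\<close>

locale toeplitz =
  fixes c :: "int \<Rightarrow> 'e::complex_hilbert_space \<Rightarrow> 'e \<Rightarrow> complex" and K :: real
  assumes c_add_left: "c j (x + x') y = c j x y + c j x' y"
    and c_add_right: "c j x (y + y') = c j x y + c j x y'"
    and c_scaleC_left: "c j (w *\<^sub>C x) y = w * c j x y"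
    and c_scaleC_right: "c j x (w *\<^sub>C y) = cnj w * c j x y"
    and c_bound: "cmod (c j x y) \<le> K * (norm x * norm y)"
    and K_nonneg: "0 \<le> K"
begin

lemma c_scaleR_left: "c j (r *\<^sub>R x) y = r * c j x y"
  by (simp add: scaleR_conv_scaleC c_scaleC_left)

lemma c_scaleR_right: "c j x (r *\<^sub>R y) = r * c j x y"
  by (simp add: scaleR_conv_scaleC c_scaleC_right)

lemma c_zero [simp]: "c j 0 y = 0" "c j x 0 = 0"
  using c_scaleR_left [of j 0 0 y] c_scaleR_right [of j x 0 0] by simp_all

text \<open>\<open>W n a b M\<close> collects the terms with \<open>max k l = M\<close> of
  \<open>\<Sum>k l. (min k l choose n) * c (k - l) (a k) (b l)\<close>.\<close>

definition W :: "nat \<Rightarrow> (nat \<Rightarrow> 'e) \<Rightarrow> (nat \<Rightarrow> 'e) \<Rightarrow> nat \<Rightarrow> real" where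
  "W n a b M = Re ((\<Sum>k\<le>M. (k choose n) * c (int k - int M) (a k) (b M)) +
                   (\<Sum>l<M. (l choose n) * c (int M - int l) (a M) (b l)))"

text \<open>Grouping the double sum by \<open>max k l\<close> makes the form an ordinary power
  series in \<open>t\<close>, to which termwise differentiation and Taylor's formula apply.\<close>

definition q :: "nat \<Rightarrow> real \<Rightarrow> (nat \<Rightarrow> 'e) \<Rightarrow> (nat \<Rightarrow> 'e) \<Rightarrow> real" where
  "q n t a b = (\<Sum>M. t ^ M * W n a b M)"

lemma abs_W_le:
  "\<bar>W n a b M\<bar> \<le> K * ((\<Sum>k\<le>M. \<bar>(k choose n) * norm (a k)\<bar>) * \<bar>norm (b M)\<bar>) +
      K * ((\<Sum>l\<le>M. \<bar>(l choose n) * norm (b l)\<bar>) * \<bar>norm (a M)\<bar>)"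
proof -
  have "\<bar>W n a b M\<bar> \<le> cmod (\<Sum>k\<le>M. (k choose n) * c (int k - int M) (a k) (b M)) +
                   cmod (\<Sum>l<M. (l choose n) * c (int M - int l) (a M) (b l))"
    unfolding W_def by (meson abs_Re_le_cmod norm_triangle_ineq order_trans)
  also have "\<dots> \<le> (\<Sum>k\<le>M. K * (\<bar>(k choose n) * norm (a k)\<bar> * \<bar>norm (b M)\<bar>)) +
                   (\<Sum>l<M. K * (\<bar>(l choose n) * norm (b l)\<bar> * \<bar>norm (a M)\<bar>))"
  proof (intro add_mono order_trans [OF norm_sum] sum_mono)
    show "cmod (of_nat (k choose n) * c (int k - int M) (a k) (b M)) \<le> K * (\<bar>(k choose n) * norm (a k)\<bar> * \<bar>norm (b M)\<bar>)" for k
      using mult_left_mono [OF c_bound, of "real (k choose n)"] by (simp add: norm_mult mult_ac)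
    show "cmod (of_nat (l choose n) * c (int M - int l) (a M) (b l)) \<le> K * (\<bar>(l choose n) * norm (b l)\<bar> * \<bar>norm (a M)\<bar>)" for l
      using mult_left_mono [OF c_bound, of "real (l choose n)"] by (simp add: norm_mult mult_ac)
  qed
  also have "(\<Sum>l<M. K * (\<bar>(l choose n) * norm (b l)\<bar> * \<bar>norm (a M)\<bar>))
      \<le> (\<Sum>l\<le>M. K * (\<bar>(l choose n) * norm (b l)\<bar> * \<bar>norm (a M)\<bar>))"
    by (rule sum_mono2) (auto simp: K_nonneg)
  finally show ?thesis by (simp add: sum_distrib_left sum_distrib_right)
qed

lemma summable_W:
  assumes a: "disc_seq a" and b: "disc_seq b" and t: "0 \<le> t" "t < 1"
  shows "summable (\<lambda>M. t ^ M * W n a b M)"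
proof (rule summable_comparison_test')
  have *: "disc_seq (\<lambda>k. norm (x k))" "disc_seq (\<lambda>k. (k choose n) * norm (x k))"
    if "disc_seq x" for x :: "nat \<Rightarrow> 'e"
    using disc_seq_dominated [OF that, of "\<lambda>k. norm (x k)" 1]
      disc_seq_dominated [OF disc_seq_choose [OF that], of "\<lambda>k. (k choose n) * norm (x k)" 1 n] by simp_all
  let ?d = "\<lambda>x y M. K * (t ^ M * ((\<Sum>k\<le>M. \<bar>(k choose n) * norm (x k)\<bar>) * \<bar>norm (y M)\<bar>))"
  show "summable (\<lambda>M. ?d a b M + ?d b a M)"
    by (intro summable_add summable_mult summable_partial_sum_product * a b t)
  show "norm (t ^ M * W n a b M) \<le> ?d a b M + ?d b a M" for M
    using mult_left_mono [OF abs_W_le, of "t ^ M" n a b M] t by (simp add: abs_mult distrib_left mult_ac)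
qed

lemma W_add_left: "W n (a + a') b M = W n a b M + W n a' b M"
  by (simp add: W_def c_add_left distrib_left sum.distrib)

lemma W_add_right: "W n a (b + b') M = W n a b M + W n a b' M"
  by (simp add: W_def c_add_right distrib_left sum.distrib)

lemma W_scaleR_left: "W n (r *\<^sub>R a) b M = r * W n a b M"
proof -
  have "W n (r *\<^sub>R a) b M = Re (r * ((\<Sum>k\<le>M. (k choose n) * c (int k - int M) (a k) (b M)) +
                   (\<Sum>l<M. (l choose n) * c (int M - int l) (a M) (b l))))"
    by (simp add: W_def c_scaleR_left distrib_left sum_distrib_left mult_ac)
  then show ?thesis by (simp add: W_def)
qed

lemma W_scaleR_right: "W n a (r *\<^sub>R b) M = r * W n a b M"
proof -
  have "W n a (r *\<^sub>R b) M = Re (r * ((\<Sum>k\<le>M. (k choose n) * c (int k - int M) (a k) (b M)) +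
                   (\<Sum>l<M. (l choose n) * c (int M - int l) (a M) (b l))))"
    by (simp add: W_def c_scaleR_right distrib_left sum_distrib_left mult_ac)
  then show ?thesis by (simp add: W_def)
qed

lemma W_rotate: "W n (\<lambda>k. \<i> *\<^sub>C a k) (\<lambda>k. \<i> *\<^sub>C b k) M = W n a b M"
  by (simp add: W_def c_scaleC_left c_scaleC_right flip: mult.assoc)

lemma W_shift_up_Suc:
  "W (Suc n) (shift_up a) (shift_up b) (Suc M) = W (Suc n) a b M + W n a b M"
  by (simp only: W_def sum.atMost_Suc_shift sum.lessThan_Suc_shift)
     (simp add: sum.distrib distrib_right)

lemma W_shift_up_0: "W 0 (shift_up a) (shift_up b) (Suc M) = W 0 a b M"
  by (simp only: W_def sum.atMost_Suc_shift sum.lessThan_Suc_shift) simp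

lemma W_index_0 [simp]: "W (Suc n) a b 0 = 0" "W n (shift_up a) (shift_up b) 0 = 0"
  by (simp_all add: W_def)

text \<open>A pair of indices whose minimum is 0 has weight \<open>0 choose Suc n = 0\<close>. Forms
  of positive order therefore do not see the constant coefficient, and Pascal's rule applies to all
  remaining pairs.\<close>

lemma W_shift_down:
  "W (Suc n) a b (Suc M) = W (Suc n) (shift_down a) (shift_down b) M + W n (shift_down a) (shift_down b) M"
  by (simp only: W_def sum.atMost_Suc_shift sum.lessThan_Suc_shift)
     (simp add: sum.distrib distrib_right shift_down_def)

lemma q_add_left: "\<lbrakk>disc_seq a; disc_seq a'; disc_seq b; 0 \<le> t; t < 1\<rbrakk> \<Longrightarrow> q n t (a + a') b = q n t a b + q n t a' b"
  by (simp add: q_def W_add_left distrib_left suminf_add summable_W)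

lemma q_add_right: "\<lbrakk>disc_seq a; disc_seq b; disc_seq b'; 0 \<le> t; t < 1\<rbrakk> \<Longrightarrow> q n t a (b + b') = q n t a b + q n t a b'"
  by (simp add: q_def W_add_right distrib_left suminf_add summable_W)

lemma q_scaleR_left: "\<lbrakk>disc_seq a; disc_seq b; 0 \<le> t; t < 1\<rbrakk> \<Longrightarrow> q n t (r *\<^sub>R a) b = r * q n t a b"
  unfolding q_def W_scaleR_left mult.left_commute [of _ r] by (rule suminf_mult [OF summable_W])

lemma q_scaleR_right: "\<lbrakk>disc_seq a; disc_seq b; 0 \<le> t; t < 1\<rbrakk> \<Longrightarrow> q n t a (r *\<^sub>R b) = r * q n t a b"
  unfolding q_def W_scaleR_right mult.left_commute [of _ r] by (rule suminf_mult [OF summable_W])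

lemma q_rotate: "q n t (\<lambda>k. \<i> *\<^sub>C a k) (\<lambda>k. \<i> *\<^sub>C b k) = q n t a b"
  by (simp add: q_def W_rotate)

lemma q_split_index_0:
  assumes "disc_seq a" "disc_seq b" "0 \<le> t" "t < 1"
  shows "q n t a b = W n a b 0 + t * (\<Sum>M. t ^ M * W n a b (Suc M))"
proof -
  have s: "summable (\<lambda>M. t ^ Suc M * W n a b (Suc M))"
    using summable_W [OF assms] by (subst summable_Suc_iff)
  have "q n t a b = W n a b 0 + (\<Sum>M. t ^ Suc M * W n a b (Suc M))"
    unfolding q_def using suminf_split_head [OF summable_W [OF assms]] by simp
  also have "(\<Sum>M. t ^ Suc M * W n a b (Suc M)) = t * (\<Sum>M. t ^ M * W n a b (Suc M))"
  proof (cases "t = 0")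
    case False
    then have "summable (\<lambda>M. t ^ M * W n a b (Suc M))"
      using summable_mult [OF s, of "inverse t"] by (simp only: power_Suc mult.assoc [symmetric] left_inverse [OF False] mult_1)
    then show ?thesis by (simp add: suminf_mult mult.assoc)
  qed simp
  finally show ?thesis .
qed

lemma q_shift_up_Suc:
  assumes "disc_seq a" "disc_seq b" "0 \<le> t" "t < 1"
  shows "q (Suc n) t (shift_up a) (shift_up b) = t * (q (Suc n) t a b + q n t a b)"
  using assms q_split_index_0 [of "shift_up a" "shift_up b" t "Suc n"]
  by (simp add: disc_seq_shift_up W_shift_up_Suc distrib_left suminf_add summable_W q_def)

lemma q_shift_up_0:
  assumes "disc_seq a" "disc_seq b" "0 \<le> t" "t < 1"
  shows "q 0 t (shift_up a) (shift_up b) = t * q 0 t a b"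
  using assms q_split_index_0 [of "shift_up a" "shift_up b" t 0]
  by (simp add: disc_seq_shift_up W_shift_up_0 q_def)

lemma q_shift_down:
  assumes "disc_seq a" "disc_seq b" "0 \<le> t" "t < 1"
  shows "q (Suc n) t a b = t * (q (Suc n) t (shift_down a) (shift_down b) + q n t (shift_down a) (shift_down b))"
  using assms q_split_index_0 [of a b t "Suc n"]
  by (simp add: disc_seq_shift_down W_shift_down distrib_left suminf_add summable_W q_def)

text \<open>Two factorial quotients meet in each term. The one at the smaller index is
  \<open>fact n\<close> times the binomial weight of \<open>W n\<close>; the one at the larger index
  \<open>M\<close> factors out. The right side is thus \<open>fact n\<close> times a coefficient of
  the \<open>n\<close>-th derivative of \<open>q n\<close> in \<open>t\<close>.\<close>

lemma W_deriv_seq: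
  "W 0 (deriv_seq n a) (deriv_seq n a) M = fact n * ((fact (M + n) / fact M) * W n a a (M + n))"
proof -
  let ?F = "fact n * (fact (M + n) / fact M) :: real"
  have f: "complex_of_real (fact (k + n) / fact k) = of_real (fact n) * of_nat ((k + n) choose n)" for k
    unfolding fact_quotient by simp
  have 1: "(\<Sum>k\<le>M + n. (k choose n) * c (int k - int (M + n)) (a k) (a (M + n)))
     = (\<Sum>k\<le>M. ((k + n) choose n) * c (int k - int M) (a (k + n)) (a (M + n)))"
  proof -
    have "(\<Sum>k\<le>M + n. (k choose n) * c (int k - int (M + n)) (a k) (a (M + n)))
       = (\<Sum>k\<in>{n..M + n}. (k choose n) * c (int k - int (M + n)) (a k) (a (M + n)))"
      by (rule sum.mono_neutral_right) (auto simp: binomial_eq_0)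
    also have "\<dots> = (\<Sum>k\<in>{0..M}. ((k + n) choose n) * c (int (k + n) - int (M + n)) (a (k + n)) (a (M + n)))"
      using sum.shift_bounds_cl_nat_ivl [of "\<lambda>k. (k choose n) * c (int k - int (M + n)) (a k) (a (M + n))" 0 n M]
      by (simp only: add_0)
    finally show ?thesis by (simp add: atLeast0AtMost)
  qed
  have 2: "(\<Sum>l<M + n. (l choose n) * c (int (M + n) - int l) (a (M + n)) (a l))
     = (\<Sum>l<M. ((l + n) choose n) * c (int M - int l) (a (M + n)) (a (l + n)))"
  proof -
    have "(\<Sum>l<M + n. (l choose n) * c (int (M + n) - int l) (a (M + n)) (a l))
       = (\<Sum>l\<in>{n..<M + n}. (l choose n) * c (int (M + n) - int l) (a (M + n)) (a l))"
      by (rule sum.mono_neutral_right) (auto simp: binomial_eq_0)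
    also have "\<dots> = (\<Sum>l\<in>{0..<M}. ((l + n) choose n) * c (int (M + n) - int (l + n)) (a (M + n)) (a (l + n)))"
      using sum.shift_bounds_nat_ivl [of "\<lambda>l. (l choose n) * c (int (M + n) - int l) (a (M + n)) (a l)" 0 n M]
      by (simp only: add_0)
    finally show ?thesis by (simp add: atLeast0LessThan)
  qed
  have "W 0 (deriv_seq n a) (deriv_seq n a) M = Re (?F * ((\<Sum>k\<le>M + n. (k choose n) * c (int k - int (M + n)) (a k) (a (M + n))) +
         (\<Sum>l<M + n. (l choose n) * c (int (M + n) - int l) (a (M + n)) (a l))))"
    unfolding 1 2 W_def deriv_seq_def c_scaleR_left c_scaleR_right f
    by (simp add: distrib_left sum_distrib_left mult_ac fact_quotient)
  moreover have "Re (complex_of_real r * z) = r * Re z" for r z by simp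
  ultimately show ?thesis unfolding W_def by (simp only: mult.assoc)
qed

lemma W_vanish: "M < n \<Longrightarrow> W n a b M = 0"
  by (simp add: W_def binomial_eq_0)

lemma summable_diffs_W:
  assumes "disc_seq a" "\<bar>t\<bar> < 1"
  shows "summable (\<lambda>M. (diffs ^^ i) (W n a a) M * t ^ M)"
  using assms(2)
proof (induction i arbitrary: t)
  case 0
  have "summable (\<lambda>M. norm (\<bar>t\<bar> ^ M * W n a a M))"
  proof -
    obtain r where r: "\<bar>t\<bar> < r" "r < 1" using 0 dense by blast
    then have "summable (\<lambda>M. W n a a M * r ^ M)" using summable_W [OF assms(1) assms(1), of r n] by (simp add: mult.commute)
    then have "summable (\<lambda>M. norm (W n a a M * t ^ M))" using r by (intro powser_insidea) auto
    then show ?thesis by (simp add: abs_mult power_abs mult.commute)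
  qed
  then show ?case
    by (intro summable_norm_cancel [of "\<lambda>M. (diffs ^^ 0) (W n a a) M * t ^ M"])
       (simp add: abs_mult power_abs mult.commute)
next
  case (Suc i)
  show ?case using termdiff_converges [of t 1 "(diffs ^^ i) (W n a a)"] Suc by simp
qed

lemma funpow_diffs: "(diffs ^^ i) w M = (fact (M + i) / fact M) * (w (M + i) :: real)"
proof (induction i arbitrary: M)
  case (Suc i)
  have "(diffs ^^ Suc i) w M = real (Suc M) * (fact (Suc M + i) / fact (Suc M) * w (Suc M + i))"
    by (simp add: diffs_def Suc.IH)
  also have "\<dots> = real (Suc M) * (fact (Suc M + i) / (real (Suc M) * fact M) * w (Suc M + i))"
    by (simp only: fact_Suc of_nat_mult)
  also have "\<dots> = fact (Suc M + i) / fact M * w (Suc M + i)"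
    by (simp del: of_nat_Suc fact_Suc add_Suc)
  finally show ?case by simp
qed simp

text \<open>Taylor's formula at 0 with integral remainder. The coefficients \<open>W n a a M\<close>
  vanish for \<open>M < n\<close>, so no polynomial part survives. For \<open>t = 1\<close> the
  kernel and the constant would be the weight and the constant of \<open>D_fun\<close> in the
  variable \<open>s = (cmod z)\<^sup>2\<close>.\<close>

lemma q_has_integral:
  assumes a: "disc_seq a" and n: "n > 0" and t: "0 \<le> t" "t < 1"
  shows "((\<lambda>s. (t - s) ^ (n - 1) * q 0 s (deriv_seq n a) (deriv_seq n a) / (fact n * fact (n - 1)))
           has_integral q n t a a) {0..t}"
proof -
  define Df where "Df i s = (\<Sum>M. (diffs ^^ i) (W n a a) M * s ^ M)" for i s
  have D: "(Df i has_vector_derivative Df (Suc i) s) (at s within {0..t})" if "0 \<le> s" "s \<le> t" for i s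
  proof -
    have "(Df i has_real_derivative Df (Suc i) s) (at s)"
      unfolding Df_def [abs_def] funpow.simps comp_def
      by (rule termdiffs_strong' [of 1]) (use summable_diffs_W [OF a] that t in auto)
    then show ?thesis
      by (simp add: has_real_derivative_iff_has_vector_derivative has_vector_derivative_at_within)
  qed
  have "((\<lambda>s. ((t - s) ^ (n - 1) / fact (n - 1)) *\<^sub>R Df n s) has_integral
          Df 0 t - (\<Sum>i<n. ((t - 0) ^ i / fact i) *\<^sub>R Df i 0)) {0..t}"
    by (rule Taylor_has_integral [OF n refl]) (use D t in auto)
  moreover have "Df i 0 = 0" if "i < n" for i
    using that unfolding Df_def powser_zero by (simp add: funpow_diffs W_vanish)
  moreover have "Df 0 t = q n t a a" by (simp add: Df_def q_def mult.commute)
  moreover have "Df n s = q 0 s (deriv_seq n a) (deriv_seq n a) / fact n" if "s \<in> {0..t}" for s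
  proof -
    have "q 0 s (deriv_seq n a) (deriv_seq n a) = (\<Sum>M. fact n * ((diffs ^^ n) (W n a a) M * s ^ M))"
      by (simp add: q_def W_deriv_seq funpow_diffs mult_ac)
    also have "\<dots> = fact n * Df n s"
      unfolding Df_def using that t by (intro suminf_mult summable_diffs_W [OF a]) auto
    finally show ?thesis by simp
  qed
  ultimately have "((\<lambda>s. ((t - s) ^ (n - 1) / fact (n - 1)) *\<^sub>R Df n s) has_integral q n t a a) {0..t}"
    by simp
  then show ?thesis
    by (rule has_integral_eq [rotated]) (simp add: \<open>\<And>s. s \<in> {0..t} \<Longrightarrow> Df n s = _\<close>)
qed

end

section \<open>Boundary limits of the forms\<close>

lemma tendsto_at_left_mono:
  fixes f :: "real \<Rightarrow> real"
  assumes mono: "\<And>s t. \<lbrakk>0 < s; s \<le> t; t < 1\<rbrakk> \<Longrightarrow> f s \<le> f t"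
    and bound: "\<And>t. \<lbrakk>0 < t; t < 1\<rbrakk> \<Longrightarrow> f t \<le> B"
  obtains l where "(f \<longlongrightarrow> l) (at_left 1)" "l \<le> B" "\<And>t. \<lbrakk>0 < t; t < 1\<rbrakk> \<Longrightarrow> f t \<le> l"
proof
  define l where "l = (SUP t\<in>{0<..<1}. f t)"
  have bdd: "bdd_above (f ` {0<..<1})" by (rule bdd_aboveI [of _ B]) (use bound in auto)
  show up: "f t \<le> l" if "0 < t" "t < 1" for t
    unfolding l_def using that bdd by (intro cSUP_upper) auto
  show "l \<le> B" unfolding l_def by (rule cSUP_least) (use bound in auto)
  have near: "\<forall>\<^sub>F t in at_left (1::real). u < t \<and> 0 < t \<and> t < 1" if "u < 1" for u
  proof -
    have "\<forall>\<^sub>F t in at_left 1. t \<in> {max u 0<..<1}" using that by (intro eventually_at_left_real) auto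
    then show ?thesis by eventually_elim auto
  qed
  show "(f \<longlongrightarrow> l) (at_left 1)"
  proof (rule increasing_tendsto)
    show "\<forall>\<^sub>F t in at_left 1. f t \<le> l" using near [OF zero_less_one] by eventually_elim (use up in auto)
    fix y assume "y < l"
    then obtain u where u: "0 < u" "u < 1" "y < f u"
      unfolding l_def using less_cSUP_iff [OF _ bdd] by auto
    show "\<forall>\<^sub>F t in at_left 1. y < f t"
      using near [OF u(2)] by eventually_elim (use mono u in \<open>force intro: less_le_trans\<close>)
  qed
qed

lemma eventually_at_left_1: "\<forall>\<^sub>F t in at_left (1::real). 0 < t \<and> t < 1"
  using eventually_at_left_real [of 0 "1::real"] by simp

text \<open>The ambient condition for the forms: it holds for square summable sequences, gives
  convergent sums at every \<open>t < 1\<close>, and passes to uniform limits.\<close>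

definition bdd_seq :: "(nat \<Rightarrow> 'e::real_normed_vector) \<Rightarrow> bool" where
  "bdd_seq x \<longleftrightarrow> (\<exists>S. \<forall>k. norm (x k) \<le> S)"

lemma bdd_seq_add: "bdd_seq x \<Longrightarrow> bdd_seq y \<Longrightarrow> bdd_seq (x + y)"
  unfolding bdd_seq_def by (metis norm_triangle_mono plus_fun_apply)

lemma bdd_seq_scaleR: "bdd_seq x \<Longrightarrow> bdd_seq (c *\<^sub>R x)"
  unfolding bdd_seq_def by (metis abs_ge_zero mult_left_mono norm_scaleR scaleR_fun_apply)

lemma bdd_seq_zero: "bdd_seq 0"
  unfolding bdd_seq_def by auto

lemma bdd_seq_diff: "bdd_seq x \<Longrightarrow> bdd_seq y \<Longrightarrow> bdd_seq (x - y)"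
  using bdd_seq_add [of x "(-1) *\<^sub>R y"] bdd_seq_scaleR [of y "-1"] by simp

lemma bdd_seq_scaleC: "bdd_seq x \<Longrightarrow> bdd_seq (\<lambda>k. w *\<^sub>C x k)" for x :: "nat \<Rightarrow> 'e::complex_hilbert_space"
  unfolding bdd_seq_def by (metis norm_ge_zero mult_left_mono norm_scaleC)

lemma bdd_seq_disc_seq: "bdd_seq x \<Longrightarrow> disc_seq x"
  unfolding bdd_seq_def using disc_seq_bounded by blast

section \<open>Increasing limits of quadratic forms as Hilbert spaces\<close>

text \<open>A family of quadratic forms increasing to a limit as \<open>t \<rightarrow> 1\<close>, each continuous in
  the supremum norm: the vectors on which the limit is finite form a Hilbert space.\<close>

locale form_family =
  fixes b :: "real \<Rightarrow> (nat \<Rightarrow> 'e::complex_hilbert_space) \<Rightarrow> (nat \<Rightarrow> 'e) \<Rightarrow> real"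
  assumes b_add: "\<lbrakk>0 < t; t < 1; bdd_seq x; bdd_seq y; bdd_seq z\<rbrakk> \<Longrightarrow> b t (x + y) z = b t x z + b t y z"
    and b_scale: "\<lbrakk>0 < t; t < 1; bdd_seq x; bdd_seq y\<rbrakk> \<Longrightarrow> b t (r *\<^sub>R x) y = r * b t x y"
    and b_commute: "\<lbrakk>0 < t; t < 1; bdd_seq x; bdd_seq y\<rbrakk> \<Longrightarrow> b t x y = b t y x"
    and b_mono: "\<lbrakk>0 < s; s \<le> t; t < 1; bdd_seq x\<rbrakk> \<Longrightarrow> b s x x \<le> b t x x"
    and b_lower: "\<lbrakk>0 < t; t < 1; bdd_seq x\<rbrakk> \<Longrightarrow> t ^ k * (norm (x k))\<^sup>2 \<le> b t x x"
    and b_bound: "\<lbrakk>0 < t; t < 1\<rbrakk> \<Longrightarrow> \<exists>C. \<forall>x S. (\<forall>k. norm (x k) \<le> S) \<longrightarrow> b t x x \<le> C * S\<^sup>2"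
    and b_rotate: "\<lbrakk>0 < t; t < 1; bdd_seq x; bdd_seq y\<rbrakk> \<Longrightarrow> b t (\<lambda>k. \<i> *\<^sub>C x k) (\<lambda>k. \<i> *\<^sub>C y k) = b t x y"
begin

definition Dom :: "(nat \<Rightarrow> 'e) set" where
  "Dom = {x. bdd_seq x \<and> (\<exists>B. \<forall>t. 0 < t \<and> t < 1 \<longrightarrow> b t x x \<le> B)}"

definition form :: "(nat \<Rightarrow> 'e) \<Rightarrow> (nat \<Rightarrow> 'e) \<Rightarrow> real" where
  "form x y = Lim (at_left 1) (\<lambda>t. b t x y)"

lemma b_nonneg: "\<lbrakk>0 < t; t < 1; bdd_seq x\<rbrakk> \<Longrightarrow> 0 \<le> b t x x"
  using b_lower [of t x 0] order_trans [OF zero_le_power2, of "norm (x 0)"] by simp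

lemma b_add': "\<lbrakk>0 < t; t < 1; bdd_seq x; bdd_seq y; bdd_seq z\<rbrakk> \<Longrightarrow> b t z (x + y) = b t z x + b t z y"
  using b_add [of t x y z] b_commute [of t z x] b_commute [of t z y] b_commute [of t z "x + y"] by (simp add: bdd_seq_add)

lemma b_scale': "\<lbrakk>0 < t; t < 1; bdd_seq x; bdd_seq y\<rbrakk> \<Longrightarrow> b t x (r *\<^sub>R y) = r * b t x y"
  using b_scale [of t y x r] b_commute [of t x y] b_commute [of t x "r *\<^sub>R y"] by (simp add: bdd_seq_scaleR)

lemma b_diff: "\<lbrakk>0 < t; t < 1; bdd_seq x; bdd_seq y; bdd_seq z\<rbrakk> \<Longrightarrow> b t (x - y) z = b t x z - b t y z"
  using b_add [of t "x - y" y z] by (simp add: bdd_seq_diff)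

lemma b_diff': "\<lbrakk>0 < t; t < 1; bdd_seq x; bdd_seq y; bdd_seq z\<rbrakk> \<Longrightarrow> b t z (x - y) = b t z x - b t z y"
  using b_add' [of t "x - y" y z] by (simp add: bdd_seq_diff)

lemmas b_simps = b_add b_add' b_scale b_scale' b_diff b_diff' bdd_seq_add bdd_seq_diff bdd_seq_scaleR

lemma b_parallelogram:
  "\<lbrakk>0 < t; t < 1; bdd_seq x; bdd_seq y\<rbrakk> \<Longrightarrow> b t (x + y) (x + y) + b t (x - y) (x - y) = 2 * b t x x + 2 * b t y y"
  by (simp add: b_simps)

lemma b_polar:
  "\<lbrakk>0 < t; t < 1; bdd_seq x; bdd_seq y\<rbrakk> \<Longrightarrow> b t x y = (b t (x + y) (x + y) - b t (x - y) (x - y)) / 4"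
  using b_commute [of t y x] by (simp add: b_simps)

lemma b_add_le:
  "\<lbrakk>0 < t; t < 1; bdd_seq x; bdd_seq y\<rbrakk> \<Longrightarrow> b t (x + y) (x + y) \<le> 2 * b t x x + 2 * b t y y"
  using b_parallelogram [of t x y] b_nonneg [of t "x - y"] by (simp add: bdd_seq_diff)

lemma DomI: "bdd_seq x \<Longrightarrow> (\<And>t. \<lbrakk>0 < t; t < 1\<rbrakk> \<Longrightarrow> b t x x \<le> B) \<Longrightarrow> x \<in> Dom"
  unfolding Dom_def by blast

lemma Dom_bdd: "x \<in> Dom \<Longrightarrow> bdd_seq x"
  by (simp add: Dom_def)

lemma subspace_Dom: "subspace Dom"
proof (rule subspaceI)
  show "0 \<in> Dom"
    by (rule DomI [of _ 0]) (use b_scale [of _ 0 0 0] in \<open>auto simp: bdd_seq_zero\<close>)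
next
  fix x y assume xy: "x \<in> Dom" "y \<in> Dom"
  then obtain B C where BC: "\<And>t. \<lbrakk>0 < t; t < 1\<rbrakk> \<Longrightarrow> b t x x \<le> B" "\<And>t. \<lbrakk>0 < t; t < 1\<rbrakk> \<Longrightarrow> b t y y \<le> C"
    unfolding Dom_def by blast
  show "x + y \<in> Dom"
  proof (rule DomI)
    show "b t (x + y) (x + y) \<le> 2 * B + 2 * C" if "0 < t" "t < 1" for t
      using b_add_le [OF that] xy [THEN Dom_bdd] BC [OF that] by fastforce
  qed (use xy Dom_bdd bdd_seq_add in blast)
next
  fix x r assume x: "x \<in> Dom"
  then obtain B where B: "\<And>t. \<lbrakk>0 < t; t < 1\<rbrakk> \<Longrightarrow> b t x x \<le> B" unfolding Dom_def by blast
  show "r *\<^sub>R x \<in> Dom"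
  proof (rule DomI)
    show "b t (r *\<^sub>R x) (r *\<^sub>R x) \<le> r\<^sup>2 * B" if "0 < t" "t < 1" for t
      using mult_left_mono [OF B [OF that], of "r\<^sup>2"] x [THEN Dom_bdd] that
      by (simp add: b_simps power2_eq_square mult.assoc)
  qed (use x Dom_bdd bdd_seq_scaleR in blast)
qed

lemmas Dom_mem = subspace_0 [OF subspace_Dom] subspace_add [OF subspace_Dom]
  subspace_scale [OF subspace_Dom] subspace_diff [OF subspace_Dom]

lemma
  assumes "x \<in> Dom"
  shows tendsto_form_diag: "((\<lambda>t. b t x x) \<longlongrightarrow> form x x) (at_left 1)"
    and b_le_form: "\<lbrakk>0 < t; t < 1\<rbrakk> \<Longrightarrow> b t x x \<le> form x x"
    and form_le: "(\<And>t. \<lbrakk>0 < t; t < 1\<rbrakk> \<Longrightarrow> b t x x \<le> B) \<Longrightarrow> form x x \<le> B"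
proof -
  obtain C where C: "\<And>t. \<lbrakk>0 < t; t < 1\<rbrakk> \<Longrightarrow> b t x x \<le> C" using assms unfolding Dom_def by blast
  then obtain l where l: "((\<lambda>t. b t x x) \<longlongrightarrow> l) (at_left 1)" "\<And>t. \<lbrakk>0 < t; t < 1\<rbrakk> \<Longrightarrow> b t x x \<le> l"
    using tendsto_at_left_mono [of "\<lambda>t. b t x x" C] b_mono assms [THEN Dom_bdd] by metis
  have "form x x = l" unfolding form_def using l(1) by (simp add: tendsto_Lim)
  with l show lim: "((\<lambda>t. b t x x) \<longlongrightarrow> form x x) (at_left 1)"
    and "\<lbrakk>0 < t; t < 1\<rbrakk> \<Longrightarrow> b t x x \<le> form x x" by simp_all
  show "form x x \<le> B" if "\<And>t. \<lbrakk>0 < t; t < 1\<rbrakk> \<Longrightarrow> b t x x \<le> B"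
  proof (rule tendsto_upperbound [OF lim])
    show "\<forall>\<^sub>F t in at_left 1. b t x x \<le> B"
      using eventually_at_left_1 by eventually_elim (use that in auto)
  qed simp
qed

text \<open>Only diagonal values are monotone in \<open>t\<close>; mixed limits come from
  polarization.\<close>

lemma tendsto_form:
  assumes "x \<in> Dom" "y \<in> Dom"
  shows "((\<lambda>t. b t x y) \<longlongrightarrow> form x y) (at_left 1)"
proof -
  let ?l = "(form (x + y) (x + y) - form (x - y) (x - y)) / 4"
  have "((\<lambda>t. (b t (x + y) (x + y) - b t (x - y) (x - y)) / 4) \<longlongrightarrow> ?l) (at_left 1)"
    using assms Dom_mem by (intro tendsto_intros tendsto_form_diag) auto
  moreover have "\<forall>\<^sub>F t in at_left 1. (b t (x + y) (x + y) - b t (x - y) (x - y)) / 4 = b t x y"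
    using eventually_at_left_1 by eventually_elim (use b_polar assms Dom_bdd in auto)
  ultimately have *: "((\<lambda>t. b t x y) \<longlongrightarrow> ?l) (at_left 1)" by (rule Lim_transform_eventually)
  then have "form x y = ?l" unfolding form_def by (intro tendsto_Lim) simp_all
  with * show ?thesis by (simp only:)
qed

lemma form_eqI:
  assumes "x \<in> Dom" "y \<in> Dom" "(g \<longlongrightarrow> l) (at_left 1)" "\<And>t. \<lbrakk>0 < t; t < 1\<rbrakk> \<Longrightarrow> b t x y = g t"
  shows "form x y = l"
proof (rule tendsto_unique [OF _ tendsto_form [OF assms(1,2)]])
  show "((\<lambda>t. b t x y) \<longlongrightarrow> l) (at_left 1)"
    by (rule Lim_transform_eventually [OF assms(3)])
       (use eventually_at_left_1 in eventually_elim, use assms(4) in auto)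
qed simp

text \<open>Continuity of the coordinates. It yields definiteness of \<open>form\<close> and turns
  Cauchy sequences for \<open>form\<close> into uniformly Cauchy ones.\<close>

lemma norm_index_le_form:
  assumes "x \<in> Dom"
  shows "(norm (x k))\<^sup>2 \<le> form x x"
proof (rule tendsto_upperbound)
  have "((\<lambda>t::real. t ^ k * (norm (x k))\<^sup>2) \<longlongrightarrow> 1 ^ k * (norm (x k))\<^sup>2) (at_left 1)"
    by (intro tendsto_intros)
  then show "((\<lambda>t::real. t ^ k * (norm (x k))\<^sup>2) \<longlongrightarrow> (norm (x k))\<^sup>2) (at_left 1)" by simp
  show "\<forall>\<^sub>F t in at_left 1. t ^ k * (norm (x k))\<^sup>2 \<le> form x x"
    using eventually_at_left_1
    by eventually_elim (use b_lower b_le_form assms Dom_bdd order_trans in blast)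
qed simp

lemma form_add: "\<lbrakk>x \<in> Dom; y \<in> Dom; z \<in> Dom\<rbrakk> \<Longrightarrow> form (x + y) z = form x z + form y z"
  by (rule form_eqI [OF _ _ tendsto_add [OF tendsto_form tendsto_form]]) (auto simp: Dom_mem b_add Dom_bdd)

lemma form_scale: "\<lbrakk>x \<in> Dom; y \<in> Dom\<rbrakk> \<Longrightarrow> form (r *\<^sub>R x) y = r * form x y"
  by (rule form_eqI [OF _ _ tendsto_mult_left [OF tendsto_form]]) (auto simp: Dom_mem b_scale Dom_bdd)

lemma form_commute: "\<lbrakk>x \<in> Dom; y \<in> Dom\<rbrakk> \<Longrightarrow> form x y = form y x"
  by (rule form_eqI [OF _ _ tendsto_form]) (auto simp: Dom_bdd intro!: b_commute)

lemma Dom_rotate: "x \<in> Dom \<Longrightarrow> (\<lambda>k. \<i> *\<^sub>C x k) \<in> Dom"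
  unfolding Dom_def by (auto simp: bdd_seq_scaleC b_rotate)

lemma form_rotate: "\<lbrakk>x \<in> Dom; y \<in> Dom\<rbrakk> \<Longrightarrow> form (\<lambda>k. \<i> *\<^sub>C x k) (\<lambda>k. \<i> *\<^sub>C y k) = form x y"
  by (rule form_eqI [OF _ _ tendsto_form]) (auto simp: Dom_bdd b_rotate Dom_rotate)

text \<open>A Fatou type argument. The sequence converges uniformly in the index to some
  \<open>x\<close>. At fixed \<open>t\<close> the form is continuous in the supremum norm, so
  \<open>X m\<close> can be replaced by \<open>x\<close> in the Cauchy estimates at the cost of a
  factor 2, and the resulting bound is uniform in \<open>t\<close>.\<close>

lemma form_complete:
  assumes X: "\<And>n. X n \<in> Dom"
    and cau: "\<And>e. e > 0 \<Longrightarrow> \<exists>N::nat. \<forall>m\<ge>N. \<forall>n\<ge>N. form (X m - X n) (X m - X n) < e"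
  shows "\<exists>x\<in>Dom. (\<lambda>n. form (X n - x) (X n - x)) \<longlonglongrightarrow> 0"
proof -
  have sup: "norm (X m k - X n k) < e" if "e > 0" "form (X m - X n) (X m - X n) < e\<^sup>2" for m n k e
  proof -
    have "(norm (X m k - X n k))\<^sup>2 \<le> form (X m - X n) (X m - X n)"
      using norm_index_le_form [of "X m - X n" k] X Dom_mem by simp
    then show ?thesis using that by (meson le_less_trans power_less_imp_less_base less_imp_le)
  qed
  have "Cauchy (\<lambda>n. X n k)" for k
  proof (rule metric_CauchyI)
    fix e :: real assume "e > 0"
    then obtain N where N: "\<forall>m\<ge>N. \<forall>n\<ge>N. form (X m - X n) (X m - X n) < e\<^sup>2" using cau [of "e\<^sup>2"] by auto
    have "dist (X m k) (X n k) < e" if "m \<ge> N" "n \<ge> N" for m n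
      unfolding dist_norm by (rule sup [OF \<open>e > 0\<close> N [rule_format, OF that]])
    then show "\<exists>M. \<forall>m\<ge>M. \<forall>n\<ge>M. dist (X m k) (X n k) < e"
      by (intro exI [of _ N] allI impI)
  qed
  then have "\<forall>k. \<exists>l. (\<lambda>n. X n k) \<longlonglongrightarrow> l" by (simp add: Cauchy_convergent_iff convergent_def)
  then obtain x where x: "\<And>k. (\<lambda>n. X n k) \<longlonglongrightarrow> x k" by metis
  have unif: "\<exists>N. \<forall>n\<ge>N. \<forall>k. norm ((X n - x) k) \<le> e" if "e > 0" for e
  proof -
    obtain N where N: "\<forall>m\<ge>N. \<forall>n\<ge>N. form (X m - X n) (X m - X n) < e\<^sup>2"
      using cau [of "e\<^sup>2"] zero_less_power [OF \<open>e > 0\<close>] by blast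
    have "norm ((X n - x) k) \<le> e" if "n \<ge> N" for n k
    proof (rule tendsto_upperbound)
      show "(\<lambda>m. norm (X n k - X m k)) \<longlonglongrightarrow> norm ((X n - x) k)"
        by (auto intro!: tendsto_intros x)
      show "\<forall>\<^sub>F m in sequentially. norm (X n k - X m k) \<le> e"
        using eventually_ge_at_top [of N] by eventually_elim (use sup [OF \<open>e > 0\<close>] N that in \<open>auto intro: less_imp_le\<close>)
    qed simp
    then show ?thesis by blast
  qed
  obtain N1 where N1: "\<And>k. norm ((X N1 - x) k) \<le> 1" using unif [of 1] by auto
  have bdd_diff: "bdd_seq (X N1 - x)" using N1 by (auto simp: bdd_seq_def)
  have bdd_x: "bdd_seq x" using bdd_seq_diff [OF Dom_bdd [OF X [of N1]] bdd_diff] by simp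
  have close: "b t (X n - x) (X n - x) \<le> 2 * e"
    if "0 < t" "t < 1" "\<forall>m\<ge>N. form (X n - X m) (X n - X m) \<le> e" for t n e and N :: nat
  proof -
    obtain C where C: "\<And>y S. (\<And>k. norm (y k) \<le> S) \<Longrightarrow> b t y y \<le> C * S\<^sup>2" using b_bound [OF \<open>0 < t\<close> \<open>t < 1\<close>] by blast
    have "b t (X n - x) (X n - x) \<le> 2 * e + d" if "d > 0" for d
    proof -
      \<comment> \<open>Chosen so that the replacement error is at most \<open>d / 2\<close>;
        \<open>\<bar>C\<bar> + 1\<close> is a positive bound for \<open>C\<close>, whatever its
        sign.\<close>
      define S where "S = sqrt (d / (2 * (\<bar>C\<bar> + 1)))"
      have S: "S > 0" using \<open>d > 0\<close> by (simp add: S_def)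
      obtain M where M: "\<And>m k. m \<ge> M \<Longrightarrow> norm ((X m - x) k) \<le> S" using unif [OF S] by blast
      define m where "m = max M N"
      have "b t ((X n - X m) + (X m - x)) ((X n - X m) + (X m - x))
              \<le> 2 * b t (X n - X m) (X n - X m) + 2 * b t (X m - x) (X m - x)"
        by (rule b_add_le) (use \<open>0 < t\<close> \<open>t < 1\<close> X bdd_x in \<open>auto intro: bdd_seq_diff Dom_bdd\<close>)
      moreover have "b t ((X n - X m) + (X m - x)) ((X n - X m) + (X m - x)) = b t (X n - x) (X n - x)"
        by (intro arg_cong2 [of _ _ _ _ "b t"]) (simp_all add: fun_eq_iff)
      moreover have "b t (X n - X m) (X n - X m) \<le> form (X n - X m) (X n - X m)"
        using X \<open>0 < t\<close> \<open>t < 1\<close> by (intro b_le_form Dom_mem) auto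
      moreover have "form (X n - X m) (X n - X m) \<le> e" using that \<open>\<forall>m\<ge>N. _\<close> by (simp add: m_def)
      moreover have "b t (X m - x) (X m - x) \<le> d / 2"
      proof -
        have "b t (X m - x) (X m - x) \<le> C * S\<^sup>2" using M by (intro C) (simp add: m_def)
        also have "C * S\<^sup>2 \<le> (\<bar>C\<bar> + 1) * S\<^sup>2" by (intro mult_right_mono) auto
        also have "\<dots> = d / 2" using \<open>d > 0\<close> by (simp add: S_def field_simps)
        finally show ?thesis .
      qed
      ultimately show ?thesis by argo
    qed
    then show ?thesis by (meson field_le_epsilon)
  qed
  have form_x: "X n - x \<in> Dom \<and> form (X n - x) (X n - x) \<le> 2 * e"
    if "\<forall>m\<ge>N. form (X n - X m) (X n - X m) \<le> e" for n e and N :: nat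
  proof -
    have "X n - x \<in> Dom" using close [OF _ _ that] X bdd_x by (intro DomI) (auto intro: bdd_seq_diff Dom_bdd)
    then show ?thesis using form_le close [OF _ _ that] by blast
  qed
  have x_Dom: "x \<in> Dom"
  proof -
    obtain N where "\<forall>m\<ge>N. \<forall>n\<ge>N. form (X m - X n) (X m - X n) < 1" using cau [of 1] by auto
    then have "X N - x \<in> Dom" using form_x [where n = N and e = 1 and N = N] by fastforce
    then have "X N - (X N - x) \<in> Dom" using X Dom_mem(4) by blast
    then show ?thesis by simp
  qed
  have "(\<lambda>n. form (X n - x) (X n - x)) \<longlonglongrightarrow> 0"
  proof (rule LIMSEQ_I)
    fix e :: real assume "e > 0"
    \<comment> \<open>A factor 2 is lost in \<open>form_x\<close>, so a third of \<open>e\<close>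
      still ends strictly below \<open>e\<close>.\<close>
    then obtain N where N: "\<forall>m\<ge>N. \<forall>n\<ge>N. form (X m - X n) (X m - X n) < e / 3" using cau [of "e / 3"] by auto
    have "norm (form (X n - x) (X n - x) - 0) < e" if "n \<ge> N" for n
    proof -
      have "\<forall>m\<ge>N. form (X n - X m) (X n - X m) \<le> e / 3" using N that by (simp add: less_imp_le)
      then have "form (X n - x) (X n - x) \<le> 2 * (e / 3)" using form_x by blast
      moreover have "0 \<le> form (X n - x) (X n - x)"
        using norm_index_le_form [of "X n - x" 0] X x_Dom Dom_mem by (smt (verit) zero_le_power2)
      ultimately show ?thesis using \<open>e > 0\<close> by simp
    qed
    then show "\<exists>no. \<forall>n\<ge>no. norm (form (X n - x) (X n - x) - 0) < e" by blast
  qed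
  then show ?thesis using x_Dom by blast
qed

sublocale hilbert_on Dom form
proof
  show "subspace Dom" by (rule subspace_Dom)
  show "0 \<le> form x x" if "x \<in> Dom" for x
    using norm_index_le_form [OF that, of 0] by (smt (verit) zero_le_power2)
  show "x = 0" if "x \<in> Dom" "form x x = 0" for x
    using norm_index_le_form [OF that(1)] that(2) by (simp add: fun_eq_iff)
  show "\<exists>x\<in>Dom. (\<lambda>n. form (X n - x) (X n - x)) \<longlonglongrightarrow> 0"
    if "\<And>n. X n \<in> Dom" "\<And>e. e > 0 \<Longrightarrow> \<exists>N::nat. \<forall>m\<ge>N. \<forall>n\<ge>N. form (X m - X n) (X m - X n) < e" for X
    using form_complete that by blast
qed (simp_all add: form_add form_scale form_commute)

end

section \<open>Consequences of positivity at order zero\<close>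

locale toeplitz_pos = toeplitz +
  assumes q0_nonneg: "\<lbrakk>disc_seq a; 0 \<le> t; t < 1\<rbrakk> \<Longrightarrow> 0 \<le> q 0 t a a"
begin

lemma q_nonneg:
  assumes a: "disc_seq a" and t: "0 \<le> t" "t < 1"
  shows "0 \<le> q n t a a"
proof (cases "n = 0")
  case False
  show ?thesis
    by (rule has_integral_nonneg [OF q_has_integral [OF a _ t]])
       (use False t in \<open>auto intro!: divide_nonneg_nonneg mult_nonneg_nonneg q0_nonneg disc_seq_deriv_seq a\<close>)
qed (use assms q0_nonneg in simp)

text \<open>In Taylor's formula raising the parameter enlarges both the kernel and the interval of
  integration. At order zero there is no such formula, and monotonicity can fail.\<close>

lemma q_mono:
  assumes a: "disc_seq a" and n: "n > 0" and st: "0 \<le> s" "s \<le> t" "t < 1"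
  shows "q n s a a \<le> q n t a a"
proof -
  let ?G = "\<lambda>t u. (t - u) ^ (n - 1) * q 0 u (deriv_seq n a) (deriv_seq n a) / (fact n * fact (n - 1))"
  have G: "0 \<le> q 0 u (deriv_seq n a) (deriv_seq n a)" if "u \<in> {0..t}" for u
    using that st by (intro q0_nonneg disc_seq_deriv_seq a) auto
  have 1: "(?G s has_integral q n s a a) {0..s}" and 2: "(?G t has_integral q n t a a) {0..t}"
    using q_has_integral [OF a n] st by simp_all
  have i: "?G t integrable_on {0..s}"
    by (rule integrable_on_subinterval [OF has_integral_integrable [OF 2]]) (use st in auto)
  have "q n s a a \<le> integral {0..s} (?G t)"
    by (rule has_integral_le [OF 1 integrable_integral [OF i]])
       (use st in \<open>auto intro!: divide_right_mono mult_right_mono power_mono G\<close>)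
  also have "\<dots> \<le> integral {0..t} (?G t)"
    by (rule integral_subset_le) (use st i 2 in \<open>auto intro!: divide_nonneg_nonneg mult_nonneg_nonneg G\<close>)
  finally show ?thesis by (simp only: integral_unique [OF 2])
qed

lemma q_add_le:
  assumes "disc_seq a" "disc_seq b" "0 \<le> t" "t < 1"
  shows "q n t (a + b) (a + b) \<le> 2 * q n t a a + 2 * q n t b b"
proof -
  have 1: "q n t (a + b) (a + b) = q n t a a + q n t a b + q n t b a + q n t b b"
    using assms by (simp add: q_add_left q_add_right disc_seq_add)
  have "q n t ((a - b) + b) ((a - b) + b) = q n t (a - b) (a - b) + q n t (a - b) b + q n t b (a - b) + q n t b b"
    using assms by (simp only: q_add_left q_add_right disc_seq_add disc_seq_diff)
  moreover have "q n t ((a - b) + b) b = q n t (a - b) b + q n t b b" "q n t b ((a - b) + b) = q n t b (a - b) + q n t b b"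
    using assms by (simp_all only: q_add_left q_add_right disc_seq_add disc_seq_diff)
  moreover have "0 \<le> q n t (a - b) (a - b)" using assms by (intro q_nonneg disc_seq_diff)
  ultimately show ?thesis using 1 by simp
qed

text \<open>The constant sequence 1 gives a convergent majorant series \<open>?h\<close>, and the
  form is quadratic, hence the factor \<open>S\<^sup>2\<close>. This is the continuity in the
  supremum norm required by \<open>form_family\<close>.\<close>

lemma q_sup_bound:
  assumes "0 \<le> t" "t < 1"
  shows "\<exists>C. \<forall>a S. (\<forall>k. norm (a k) \<le> S) \<longrightarrow> q n t a a \<le> C * S\<^sup>2"
proof -
  let ?h = "\<lambda>M. t ^ M * ((\<Sum>k\<le>M. \<bar>(real (k choose n) *\<^sub>R 1) :: real\<bar>) * \<bar>1::real\<bar>)"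
  have h: "summable ?h"
    by (rule summable_partial_sum_product [OF disc_seq_choose [OF disc_seq_const] disc_seq_const assms])
  have "q n t a a \<le> (2 * K * (\<Sum>M. ?h M)) * S\<^sup>2" if S: "\<And>k. norm (a k) \<le> S" for a S
  proof -
    have S0: "0 \<le> S" using S [of 0] norm_ge_zero order_trans by blast
    have W: "t ^ M * W n a a M \<le> 2 * K * S\<^sup>2 * ?h M" for M
    proof -
      have "(\<Sum>k\<le>M. \<bar>(k choose n) * norm (a k)\<bar>) * \<bar>norm (a M)\<bar> \<le> (\<Sum>k\<le>M. (k choose n) * S) * S"
        by (intro mult_mono sum_mono sum_nonneg) (auto simp: S S0 intro!: mult_left_mono)
      then have "W n a a M \<le> K * ((\<Sum>k\<le>M. (k choose n) * S) * S) + K * ((\<Sum>k\<le>M. (k choose n) * S) * S)"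
        using abs_W_le [of n a a M] K_nonneg
        by (smt (verit) mult_left_mono)
      also have "\<dots> = 2 * K * S\<^sup>2 * (\<Sum>k\<le>M. real (k choose n))"
        by (simp add: sum_distrib_right power2_eq_square flip: sum_distrib_right)
      finally have "t ^ M * W n a a M \<le> t ^ M * (2 * K * S\<^sup>2 * (\<Sum>k\<le>M. real (k choose n)))"
        by (rule mult_left_mono) (use assms in simp)
      then show ?thesis by (simp add: mult_ac)
    qed
    have "q n t a a \<le> (\<Sum>M. 2 * K * S\<^sup>2 * ?h M)"
      unfolding q_def by (rule suminf_le [OF W summable_W summable_mult [OF h]])
        (use assms disc_seq_bounded [OF S] in auto)
    also have "\<dots> = 2 * K * S\<^sup>2 * (\<Sum>M. ?h M)" by (rule suminf_mult [OF h])
    finally show ?thesis by (simp add: mult_ac)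
  qed
  then show ?thesis by blast
qed

text \<open>Order \<open>n + 1\<close> ignores coefficients of index at most \<open>n\<close>, hence
  the extra sum. At \<open>n = 0\<close> the constant term is split off; what is left has form
  \<open>t * q 0 t\<close> of the shifted sequence, a summand of \<open>q 1 t a a\<close>. The two
  halves of the sum cost a factor 2, which gives \<open>2 * K + 2\<close>. In the induction step
  \<open>q_shift_down\<close> unrolls both orders and the hypothesis is applied to the shifted
  sequence.\<close>

lemma q_le_q_Suc:
  "\<exists>C\<ge>0. \<forall>t a. 0 \<le> t \<and> t < 1 \<and> disc_seq a \<longrightarrow> q n t a a \<le> C * ((\<Sum>i\<le>n. (norm (a i))\<^sup>2) + q (Suc n) t a a)"
proof (induction n)
  case 0
  have "q 0 t a a \<le> (2 * K + 2) * ((\<Sum>i\<le>0. (norm (a i))\<^sup>2) + q 1 t a a)"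
    if t: "0 \<le> t" "t < 1" and a: "disc_seq a" for t a
  proof -
    define e where "e = (\<lambda>k::nat. if k = 0 then a 0 else 0)"
    have e: "disc_seq e" by (rule disc_seq_bounded [of _ "norm (a 0)"]) (simp add: e_def)
    have split: "a = e + shift_up (shift_down a)"
      by (auto simp: fun_eq_iff e_def shift_up_def shift_down_def split: nat.split)
    have b: "disc_seq (shift_down a)" by (rule disc_seq_shift_down [OF a])
    have "W 0 e e M = (if M = 0 then Re (c 0 (a 0) (a 0)) else 0)" for M
      by (auto simp: W_def e_def)
    then have "q 0 t e e = (\<Sum>M. if M = 0 then Re (c 0 (a 0) (a 0)) else 0)"
      unfolding q_def by (intro suminf_cong) simp
    also have "\<dots> = Re (c 0 (a 0) (a 0))"
      using sums_single [of 0 "\<lambda>_. Re (c 0 (a 0) (a 0))"] by (simp add: sums_iff)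
    also have "\<dots> \<le> K * (norm (a 0))\<^sup>2"
      using c_bound [of 0 "a 0" "a 0"] complex_Re_le_cmod order_trans by (fastforce simp: power2_eq_square)
    finally have e_le: "q 0 t e e \<le> K * (norm (a 0))\<^sup>2" .
    have q1: "q 1 t a a = t * (q 1 t (shift_down a) (shift_down a) + q 0 t (shift_down a) (shift_down a))"
      using q_shift_down [OF a a t, of 0] by simp
    have q1n: "0 \<le> t * q 1 t (shift_down a) (shift_down a)" using q_nonneg [OF b t] t by simp
    have "q 0 t (e + shift_up (shift_down a)) (e + shift_up (shift_down a))
            \<le> 2 * q 0 t e e + 2 * q 0 t (shift_up (shift_down a)) (shift_up (shift_down a))"
      by (rule q_add_le [OF e disc_seq_shift_up [OF b] t])
    then have "q 0 t a a \<le> 2 * q 0 t e e + 2 * (t * q 0 t (shift_down a) (shift_down a))"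
      by (simp only: split [symmetric] q_shift_up_0 [OF b b t])
    also have "\<dots> \<le> 2 * (K * (norm (a 0))\<^sup>2) + 2 * q 1 t a a" using e_le q1 q1n by (simp add: distrib_left)
    also have "\<dots> \<le> (2 * K + 2) * ((norm (a 0))\<^sup>2 + q 1 t a a)"
      using K_nonneg q_nonneg [OF a t, of 1] by (simp add: algebra_simps)
    finally show ?thesis by simp
  qed
  then show ?case using K_nonneg by (intro exI [of _ "2 * K + 2"]) auto
next
  case (Suc n)
  then obtain C where C: "C \<ge> 0" "\<And>t a. \<lbrakk>0 \<le> t; t < 1; disc_seq a\<rbrakk> \<Longrightarrow> q n t a a \<le> C * ((\<Sum>i\<le>n. (norm (a i))\<^sup>2) + q (Suc n) t a a)"
    by blast
  have "q (Suc n) t a a \<le> (1 + C) * ((\<Sum>i\<le>Suc n. (norm (a i))\<^sup>2) + q (Suc (Suc n)) t a a)"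
    if t: "0 \<le> t" "t < 1" and a: "disc_seq a" for t a
  proof -
    have b: "disc_seq (shift_down a)" by (rule disc_seq_shift_down [OF a])
    let ?Q = "\<lambda>n. t * q n t (shift_down a) (shift_down a)"
    define S where "S = (\<Sum>i\<le>n. (norm (a (Suc i)))\<^sup>2)"
    define S' where "S' = (\<Sum>i\<le>Suc n. (norm (a i))\<^sup>2)"
    have S: "0 \<le> S" "S \<le> S'" unfolding S_def S'_def sum.atMost_Suc_shift by (simp_all add: sum_nonneg)
    have nn: "0 \<le> ?Q i" for i using q_nonneg [OF b t] t by simp
    have q2: "q (Suc (Suc n)) t a a = ?Q (Suc (Suc n)) + ?Q (Suc n)"
      using q_shift_down [OF a a t, of "Suc n"] by (simp add: distrib_left)
    have "?Q n \<le> t * (C * (S + q (Suc n) t (shift_down a) (shift_down a)))"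
      using mult_left_mono [OF C(2) [OF t b]] t by (simp add: S_def shift_down_def)
    also have "\<dots> = C * (t * S + ?Q (Suc n))" by (simp add: algebra_simps)
    also have "\<dots> \<le> C * (S' + ?Q (Suc n))"
      using S t mult_left_le_one_le [of S t] C(1) by (intro mult_left_mono) auto
    also have "\<dots> \<le> C * (S' + q (Suc (Suc n)) t a a)"
      using q2 nn C(1) by (intro mult_left_mono) auto
    finally have "q (Suc n) t a a \<le> ?Q (Suc n) + C * (S' + q (Suc (Suc n)) t a a)"
      using q_shift_down [OF a a t, of n] by (simp add: distrib_left)
    also have "\<dots> \<le> (S' + q (Suc (Suc n)) t a a) + C * (S' + q (Suc (Suc n)) t a a)"
      using q2 nn S by (smt (verit))
    finally show ?thesis by (simp add: S'_def distrib_right)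
  qed
  then show ?case using C(1) by (intro exI [of _ "1 + C"]) auto
qed

end

section \<open>Boundary values of the forms\<close>

context toeplitz_pos
begin

definition fin :: "nat \<Rightarrow> (nat \<Rightarrow> 'a) \<Rightarrow> bool" where
  "fin n a \<longleftrightarrow> disc_seq a \<and> (\<exists>B. \<forall>t. 0 < t \<and> t < 1 \<longrightarrow> q n t a a \<le> B)"

text \<open>For positive order the limit is a supremum as soon as \<open>fin n a\<close> holds. At
  order zero its existence is derived from \<open>fin 1 a\<close> in
  \<open>tendsto_D\<close>.\<close>

definition D :: "nat \<Rightarrow> (nat \<Rightarrow> 'a) \<Rightarrow> real" where
  "D n a = Lim (at_left 1) (\<lambda>t. q n t a a)"

lemma finI: "disc_seq a \<Longrightarrow> (\<And>t. \<lbrakk>0 < t; t < 1\<rbrakk> \<Longrightarrow> q n t a a \<le> B) \<Longrightarrow> fin n a"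
  unfolding fin_def by blast

lemma fin_disc_seq: "fin n a \<Longrightarrow> disc_seq a"
  by (simp add: fin_def)

lemma D_eqI:
  assumes "(g \<longlongrightarrow> l) (at_left 1)" "\<And>t. \<lbrakk>0 < t; t < 1\<rbrakk> \<Longrightarrow> q n t a a = g t"
  shows "((\<lambda>t. q n t a a) \<longlongrightarrow> l) (at_left 1)" "D n a = l"
proof -
  show lim: "((\<lambda>t. q n t a a) \<longlongrightarrow> l) (at_left 1)"
    by (rule Lim_transform_eventually [OF assms(1)])
       (use eventually_at_left_1 in eventually_elim, use assms(2) in auto)
  show "D n a = l" unfolding D_def by (rule tendsto_Lim [OF _ lim]) simp
qed

lemma
  assumes "fin (Suc n) a"
  shows tendsto_D_Suc: "((\<lambda>t. q (Suc n) t a a) \<longlongrightarrow> D (Suc n) a) (at_left 1)"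
    and q_le_D: "\<lbrakk>0 < t; t < 1\<rbrakk> \<Longrightarrow> q (Suc n) t a a \<le> D (Suc n) a"
    and D_Suc_le: "(\<And>t. \<lbrakk>0 < t; t < 1\<rbrakk> \<Longrightarrow> q (Suc n) t a a \<le> B) \<Longrightarrow> D (Suc n) a \<le> B"
proof -
  obtain C where C: "\<And>t. \<lbrakk>0 < t; t < 1\<rbrakk> \<Longrightarrow> q (Suc n) t a a \<le> C" using assms unfolding fin_def by blast
  have mono: "q (Suc n) s a a \<le> q (Suc n) t a a" if "0 < s" "s \<le> t" "t < 1" for s t
    by (rule q_mono [OF fin_disc_seq [OF assms]]) (use that in auto)
  obtain l where l: "((\<lambda>t. q (Suc n) t a a) \<longlongrightarrow> l) (at_left 1)" "\<And>t. \<lbrakk>0 < t; t < 1\<rbrakk> \<Longrightarrow> q (Suc n) t a a \<le> l"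
    by (rule tendsto_at_left_mono [of "\<lambda>t. q (Suc n) t a a" C]) (use mono C in auto)
  have D: "D (Suc n) a = l" unfolding D_def by (rule tendsto_Lim [OF _ l(1)]) simp
  show lim: "((\<lambda>t. q (Suc n) t a a) \<longlongrightarrow> D (Suc n) a) (at_left 1)" using l(1) D by (simp only:)
  show "\<lbrakk>0 < t; t < 1\<rbrakk> \<Longrightarrow> q (Suc n) t a a \<le> D (Suc n) a" using l(2) D by (simp only:)
  show "D (Suc n) a \<le> B" if "\<And>t. \<lbrakk>0 < t; t < 1\<rbrakk> \<Longrightarrow> q (Suc n) t a a \<le> B"
  proof (rule tendsto_upperbound [OF lim])
    show "\<forall>\<^sub>F t in at_left 1. q (Suc n) t a a \<le> B"
      using eventually_at_left_1 by eventually_elim (use that in auto)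
  qed simp
qed

lemma fin_pred:
  assumes "fin (Suc n) a"
  shows "fin n a"
proof -
  obtain C where C: "C \<ge> 0" "\<And>t a. \<lbrakk>0 \<le> t; t < 1; disc_seq a\<rbrakk> \<Longrightarrow> q n t a a \<le> C * ((\<Sum>i\<le>n. (norm (a i))\<^sup>2) + q (Suc n) t a a)"
    using q_le_q_Suc by blast
  show ?thesis
  proof (rule finI)
    fix t :: real assume t: "0 < t" "t < 1"
    have "q n t a a \<le> C * ((\<Sum>i\<le>n. (norm (a i))\<^sup>2) + q (Suc n) t a a)"
      using C(2) t fin_disc_seq [OF assms] by simp
    also have "\<dots> \<le> C * ((\<Sum>i\<le>n. (norm (a i))\<^sup>2) + D (Suc n) a)"
      using q_le_D [OF assms t] C(1) by (intro mult_left_mono) auto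
    finally show "q n t a a \<le> C * ((\<Sum>i\<le>n. (norm (a i))\<^sup>2) + D (Suc n) a)" .
  qed (use assms fin_disc_seq in blast)
qed

lemma fin_shift_up:
  assumes "fin (Suc n) a"
  shows "fin (Suc n) (shift_up a)"
proof -
  obtain B where B: "\<And>t. \<lbrakk>0 < t; t < 1\<rbrakk> \<Longrightarrow> q n t a a \<le> B" using fin_pred [OF assms] unfolding fin_def by blast
  note a = fin_disc_seq [OF assms]
  show ?thesis
  proof (rule finI)
    fix t :: real assume t: "0 < t" "t < 1"
    have "q (Suc n) t (shift_up a) (shift_up a) = t * (q (Suc n) t a a + q n t a a)"
      using q_shift_up_Suc [OF a a] t by simp
    also have "\<dots> \<le> q (Suc n) t a a + q n t a a"
      using t q_nonneg [OF a, of t n] q_nonneg [OF a, of t "Suc n"] by (simp add: mult_left_le_one_le)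
    also have "\<dots> \<le> D (Suc n) a + B" using q_le_D [OF assms t] B [OF t] by simp
    finally show "q (Suc n) t (shift_up a) (shift_up a) \<le> D (Suc n) a + B" .
  qed (rule disc_seq_shift_up [OF a])
qed

lemma fin_shift_down:
  assumes "fin (Suc n) a"
  shows "fin (Suc n) (shift_down a)"
proof (rule finI)
  note a = fin_disc_seq [OF assms]
  show b: "disc_seq (shift_down a)" by (rule disc_seq_shift_down [OF a])
  fix t :: real assume t: "0 < t" "t < 1"
  \<comment> \<open>The bound from \<open>q_shift_down\<close> divides by the parameter, so it is
    first raised to at least 1/2, as monotonicity permits; this is the factor 2 in the
    result.\<close>
  define s where "s = max t (1 / 2)"
  have s: "1 / 2 \<le> s" "t \<le> s" "0 < s" "s < 1" using t by (auto simp: s_def)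
  have "q (Suc n) t (shift_down a) (shift_down a) \<le> q (Suc n) s (shift_down a) (shift_down a)"
    using s t by (intro q_mono b) auto
  also have "\<dots> \<le> 2 * (s * q (Suc n) s (shift_down a) (shift_down a))"
    using mult_right_mono [of 1 "2 * s" "q (Suc n) s (shift_down a) (shift_down a)"] s q_nonneg [OF b, of s "Suc n"] by simp
  also have "s * q (Suc n) s (shift_down a) (shift_down a) \<le> q (Suc n) s a a"
    using q_shift_down [OF a a, of s n] q_nonneg [OF b, of s n] s by (simp add: distrib_left)
  also have "\<dots> \<le> D (Suc n) a" using q_le_D [OF assms] s by simp
  finally show "q (Suc n) t (shift_down a) (shift_down a) \<le> 2 * D (Suc n) a" by simp
qed

text \<open>The form of order \<open>n\<close> is
  \<open>q (Suc n) t (shift_up a) (shift_up a) / t - q (Suc n) t a a\<close>, a difference of two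
  expressions with monotone forms. So its limit exists even at order zero, where the form itself
  need not be monotone.\<close>

lemma
  assumes "fin (Suc n) a"
  shows tendsto_D: "((\<lambda>t. q n t a a) \<longlongrightarrow> D n a) (at_left 1)"
    and D_shift_up: "D (Suc n) (shift_up a) = D (Suc n) a + D n a"
proof -
  note a = fin_disc_seq [OF assms]
  have "((\<lambda>t. q (Suc n) t (shift_up a) (shift_up a) / t - q (Suc n) t a a) \<longlongrightarrow>
           D (Suc n) (shift_up a) / 1 - D (Suc n) a) (at_left 1)"
    by (intro tendsto_intros tendsto_D_Suc fin_shift_up assms) simp
  moreover have "q n t a a = q (Suc n) t (shift_up a) (shift_up a) / t - q (Suc n) t a a" if "0 < t" "t < 1" for t
    using q_shift_up_Suc [OF a a, of t n] that by simp
  ultimately have "((\<lambda>t. q n t a a) \<longlongrightarrow> D (Suc n) (shift_up a) / 1 - D (Suc n) a) (at_left 1)"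
    and "D n a = D (Suc n) (shift_up a) / 1 - D (Suc n) a"
    using D_eqI by blast+
  then show "((\<lambda>t. q n t a a) \<longlongrightarrow> D n a) (at_left 1)" "D (Suc n) (shift_up a) = D (Suc n) a + D n a"
    by simp_all
qed

lemma D_shift_down:
  assumes "fin (Suc n) a"
  shows "D (Suc n) a = D (Suc n) (shift_down a) + D n (shift_down a)"
proof -
  note a = fin_disc_seq [OF assms]
  have "((\<lambda>t. t * (q (Suc n) t (shift_down a) (shift_down a) + q n t (shift_down a) (shift_down a))) \<longlongrightarrow>
         1 * (D (Suc n) (shift_down a) + D n (shift_down a))) (at_left 1)"
    by (intro tendsto_intros tendsto_D fin_shift_down assms tendsto_D_Suc)
  then have "D (Suc n) a = 1 * (D (Suc n) (shift_down a) + D n (shift_down a))"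
    by (rule D_eqI(2)) (use q_shift_down [OF a a] in simp)
  then show ?thesis by simp
qed

lemma D_0_shift_up:
  assumes "fin 1 a"
  shows "D 0 (shift_up a) = D 0 a"
proof -
  note a = fin_disc_seq [OF assms]
  have "((\<lambda>t. t * q 0 t a a) \<longlongrightarrow> 1 * D 0 a) (at_left 1)"
    using assms by (intro tendsto_intros tendsto_D) simp
  then have "D 0 (shift_up a) = 1 * D 0 a"
    by (rule D_eqI(2)) (use q_shift_up_0 [OF a a] in simp)
  then show ?thesis by simp
qed

lemma D_nonneg:
  assumes "fin n a" "n > 0 \<or> fin (Suc n) a"
  shows "0 \<le> D n a"
proof (rule tendsto_lowerbound)
  show "((\<lambda>t. q n t a a) \<longlongrightarrow> D n a) (at_left 1)"
    using assms tendsto_D tendsto_D_Suc by (cases n) auto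
  show "\<forall>\<^sub>F t in at_left 1. 0 \<le> q n t a a"
    using eventually_at_left_1 by eventually_elim (use q_nonneg fin_disc_seq assms in auto)
qed simp

text \<open>The uniform constant is what later makes multiplication by \<open>z\<close>
  bounded.\<close>

lemma D_le_D_Suc:
  "\<exists>C\<ge>0. \<forall>a. fin (Suc n) a \<longrightarrow> D n a \<le> C * ((\<Sum>i\<le>n. (norm (a i))\<^sup>2) + D (Suc n) a)"
proof -
  obtain C where C: "C \<ge> 0" "\<And>t a. \<lbrakk>0 \<le> t; t < 1; disc_seq a\<rbrakk> \<Longrightarrow> q n t a a \<le> C * ((\<Sum>i\<le>n. (norm (a i))\<^sup>2) + q (Suc n) t a a)"
    using q_le_q_Suc by blast
  have "D n a \<le> C * ((\<Sum>i\<le>n. (norm (a i))\<^sup>2) + D (Suc n) a)" if "fin (Suc n) a" for a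
  proof (rule tendsto_le [OF _ _ tendsto_D [OF that]])
    show "((\<lambda>t. C * ((\<Sum>i\<le>n. (norm (a i))\<^sup>2) + q (Suc n) t a a)) \<longlongrightarrow>
        C * ((\<Sum>i\<le>n. (norm (a i))\<^sup>2) + D (Suc n) a)) (at_left 1)"
      by (intro tendsto_intros tendsto_D_Suc that)
    show "\<forall>\<^sub>F t in at_left 1. q n t a a \<le> C * ((\<Sum>i\<le>n. (norm (a i))\<^sup>2) + q (Suc n) t a a)"
      using eventually_at_left_1 by eventually_elim (use C(2) fin_disc_seq that in auto)
  qed simp
  then show ?thesis using C(1) by blast
qed

lemma fin_funpow_shift_down: "fin (Suc n) a \<Longrightarrow> fin (Suc n) ((shift_down ^^ N) a)"
  by (induction N) (simp_all add: fin_shift_down)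

lemma fin_funpow_shift_up: "fin (Suc n) a \<Longrightarrow> fin (Suc n) ((shift_up ^^ N) a)"
  by (induction N) (simp_all add: fin_shift_up)

lemma D_funpow_shift_down:
  assumes "fin (Suc n) a"
  shows "D (Suc n) a = D (Suc n) ((shift_down ^^ N) a) + (\<Sum>i<N. D n ((shift_down ^^ Suc i) a))"
proof (induction N)
  case (Suc N)
  then show ?case using D_shift_down [OF fin_funpow_shift_down [OF assms, of N]] by simp
qed simp

lemma D_funpow_shift_down_nonneg: "fin (Suc n) a \<Longrightarrow> 0 \<le> D n ((shift_down ^^ i) a)"
  using fin_funpow_shift_down fin_pred D_nonneg by blast

lemma D_funpow_shift_down_le: "fin (Suc n) a \<Longrightarrow> D (Suc n) ((shift_down ^^ N) a) \<le> D (Suc n) a"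
  using D_funpow_shift_down [of n a N] D_funpow_shift_down_nonneg [of n a]
  by (simp add: sum_nonneg del: funpow.simps)

lemma summable_D_shift_down:
  assumes "fin (Suc n) a"
  shows "summable (\<lambda>i. D n ((shift_down ^^ Suc i) a))"
proof (rule summableI_nonneg_bounded)
  show "0 \<le> D n ((shift_down ^^ Suc i) a)" for i
    using assms by (rule D_funpow_shift_down_nonneg)
  have "0 \<le> D (Suc n) ((shift_down ^^ N) a)" for N
    by (rule D_nonneg [OF fin_funpow_shift_down [OF assms]]) simp
  then show "(\<Sum>i<N. D n ((shift_down ^^ Suc i) a)) \<le> D (Suc n) a" for N
    unfolding D_funpow_shift_down [OF assms, of N] by (simp del: funpow.simps)
qed

text \<open>At fixed \<open>t < 1\<close>, iterating \<open>q_shift_down\<close> leaves a remainder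
  of size at most \<open>t ^ N * D (Suc (Suc n)) a\<close>, which vanishes as \<open>N\<close>
  grows. Each collected term of order \<open>Suc n\<close> is at most its boundary value by
  monotonicity, so the form at \<open>t\<close> is at most the sum of the series; then
  \<open>t\<close> tends to 1. The reverse inequality is telescoping.\<close>

lemma D_sums_Suc:
  assumes fin: "fin (Suc (Suc n)) a"
  shows "(\<lambda>i. D (Suc n) ((shift_down ^^ Suc i) a)) sums D (Suc (Suc n)) a"
proof -
  let ?S = "\<Sum>i. D (Suc n) ((shift_down ^^ Suc i) a)"
  note a = fin_disc_seq [OF fin]
  note fin' = fin_funpow_shift_down [OF fin]
  note sm = summable_D_shift_down [OF fin]
  have q_le: "q (Suc (Suc n)) t a a \<le> ?S" if t: "0 < t" "t < 1" for t
  proof -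
    have step: "q (Suc (Suc n)) t a a \<le> t ^ N * q (Suc (Suc n)) t ((shift_down ^^ N) a) ((shift_down ^^ N) a)
             + (\<Sum>i<N. D (Suc n) ((shift_down ^^ Suc i) a))" for N
    proof (induction N)
      case (Suc N)
      let ?a = "(shift_down ^^ N) a" and ?b = "(shift_down ^^ Suc N) a"
      have "t ^ N * q (Suc (Suc n)) t ?a ?a = t ^ Suc N * q (Suc (Suc n)) t ?b ?b + t ^ Suc N * q (Suc n) t ?b ?b"
        using q_shift_down [of ?a ?a t "Suc n"] fin_disc_seq [OF fin'] t by (simp add: algebra_simps)
      moreover have "t ^ Suc N * q (Suc n) t ?b ?b \<le> 1 * q (Suc n) t ?b ?b"
        using t power_le_one [of t "Suc N"] q_nonneg [OF fin_disc_seq [OF fin']]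
        by (intro mult_right_mono) (auto simp del: funpow.simps)
      moreover have "q (Suc n) t ?b ?b \<le> D (Suc n) ?b"
        by (rule q_le_D [OF fin_pred [OF fin'] t])
      ultimately show ?case using Suc by (simp del: funpow.simps power_Suc)
    qed simp
    have "q (Suc (Suc n)) t a a \<le> t ^ N * D (Suc (Suc n)) a + ?S" for N
    proof -
      have "q (Suc (Suc n)) t ((shift_down ^^ N) a) ((shift_down ^^ N) a) \<le> D (Suc (Suc n)) a"
        using q_le_D [OF fin' t] D_funpow_shift_down_le [OF fin] order_trans by blast
      then have "t ^ N * q (Suc (Suc n)) t ((shift_down ^^ N) a) ((shift_down ^^ N) a) \<le> t ^ N * D (Suc (Suc n)) a"
        using t by (intro mult_left_mono) auto
      moreover have "(\<Sum>i<N. D (Suc n) ((shift_down ^^ Suc i) a)) \<le> ?S"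
        by (rule sum_le_suminf [OF sm]) (use D_funpow_shift_down_nonneg [OF fin] in blast)+
      ultimately show ?thesis using step [of N] by linarith
    qed
    moreover have "(\<lambda>N. t ^ N * D (Suc (Suc n)) a + ?S) \<longlonglongrightarrow> 0 * D (Suc (Suc n)) a + ?S"
      using t by (intro tendsto_intros LIMSEQ_power_zero) simp
    ultimately show ?thesis by (intro LIMSEQ_le_const [where a = "q (Suc (Suc n)) t a a"]) (auto)
  qed
  have "D (Suc (Suc n)) a \<le> ?S" by (rule D_Suc_le [OF fin q_le])
  moreover have "?S \<le> D (Suc (Suc n)) a"
  proof (rule suminf_le_const [OF sm])
    have "0 \<le> D (Suc (Suc n)) ((shift_down ^^ N) a)" for N by (rule D_nonneg [OF fin']) simp
    then show "(\<Sum>i<N. D (Suc n) ((shift_down ^^ Suc i) a)) \<le> D (Suc (Suc n)) a" for N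
      unfolding D_funpow_shift_down [OF fin, of N] by (simp del: funpow.simps)
  qed
  ultimately show ?thesis using summable_sums [OF sm] by simp
qed

end

section \<open>The Hilbert space of coefficient sequences\<close>

text \<open>An arbitrary finite index set lets the same construction be run with the single order 1,
  as the first order argument requires. Order 0 is excluded because monotonicity in \<open>t\<close>
  can fail there.\<close>

locale toeplitz_tuple =
  fixes c :: "nat \<Rightarrow> int \<Rightarrow> 'e::complex_hilbert_space \<Rightarrow> 'e \<Rightarrow> complex" and K :: "nat \<Rightarrow> real" and J :: "nat set"
  assumes finite_J: "finite J" and J_pos: "0 \<notin> J"
    and toeplitz_pos_component: "j \<in> J \<Longrightarrow> toeplitz_pos (c j) (K j)"
begin

abbreviation Q :: "nat \<Rightarrow> nat \<Rightarrow> real \<Rightarrow> (nat \<Rightarrow> 'e) \<Rightarrow> (nat \<Rightarrow> 'e) \<Rightarrow> real" where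
  "Q j \<equiv> toeplitz.q (c j)"

abbreviation fin :: "nat \<Rightarrow> nat \<Rightarrow> (nat \<Rightarrow> 'e) \<Rightarrow> bool" where
  "fin j \<equiv> toeplitz_pos.fin (c j)"

abbreviation D :: "nat \<Rightarrow> nat \<Rightarrow> (nat \<Rightarrow> 'e) \<Rightarrow> real" where
  "D j \<equiv> toeplitz_pos.D (c j)"

lemma toeplitz_component: "j \<in> J \<Longrightarrow> toeplitz (c j) (K j)"
  using toeplitz_pos_component toeplitz_pos.axioms(1) by blast

definition hardy :: "real \<Rightarrow> (nat \<Rightarrow> 'e) \<Rightarrow> (nat \<Rightarrow> 'e) \<Rightarrow> real" where
  "hardy t x y = (\<Sum>k. t ^ k * inner (x k) (y k))"

text \<open>Symmetrized, because the moments are not assumed Hermitian in \<open>toeplitz\<close>;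
  diagonal values are unaffected.\<close>

definition tuple_form :: "real \<Rightarrow> (nat \<Rightarrow> 'e) \<Rightarrow> (nat \<Rightarrow> 'e) \<Rightarrow> real" where
  "tuple_form t x y = hardy t x y + (\<Sum>j\<in>J. (Q j j t x y + Q j j t y x) / 2)"

lemma summable_hardy:
  assumes "0 < t" "t < 1" "bdd_seq x" "bdd_seq y"
  shows "summable (\<lambda>k. t ^ k * inner (x k) (y k))"
proof -
  obtain S T where ST: "\<And>k. norm (x k) \<le> S" "\<And>k. norm (y k) \<le> T" using assms unfolding bdd_seq_def by blast
  show ?thesis
  proof (rule summable_comparison_test')
    show "summable (\<lambda>k. t ^ k * (S * T))" using assms by (intro summable_mult2 summable_geometric) simp
    show "norm (t ^ k * inner (x k) (y k)) \<le> t ^ k * (S * T)" for k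
    proof -
      have "\<bar>inner (x k) (y k)\<bar> \<le> norm (x k) * norm (y k)" by (rule Cauchy_Schwarz_ineq2)
      also have "\<dots> \<le> S * T" by (intro mult_mono ST order_trans [OF norm_ge_zero ST(1)]) simp
      finally show ?thesis using assms by (simp add: abs_mult mult_left_mono)
    qed
  qed
qed

lemma hardy_nonneg_le:
  assumes "0 < t" "t < 1" "bdd_seq x"
  shows "t ^ k * (norm (x k))\<^sup>2 \<le> hardy t x x"
proof -
  have "(\<Sum>i\<in>{k}. t ^ i * inner (x i) (x i)) \<le> hardy t x x"
    unfolding hardy_def by (rule sum_le_suminf [OF summable_hardy]) (use assms in auto)
  then show ?thesis by (simp add: power2_norm_eq_inner)
qed

lemma Q_nonneg: "\<lbrakk>j \<in> J; disc_seq x; 0 \<le> t; t < 1\<rbrakk> \<Longrightarrow> 0 \<le> Q j n t x x"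
  using toeplitz_pos.q_nonneg [OF toeplitz_pos_component] by blast

sublocale form_family tuple_form
proof
  fix x y z :: "nat \<Rightarrow> 'e" and s t r :: real and k :: nat
  show "tuple_form t (x + y) z = tuple_form t x z + tuple_form t y z"
    if *: "0 < t" "t < 1" "bdd_seq x" "bdd_seq y" "bdd_seq z"
  proof -
    have h: "hardy t (x + y) z = hardy t x z + hardy t y z"
      unfolding hardy_def using * by (simp add: inner_add_left distrib_left suminf_add summable_hardy)
    have "(Q j j t (x + y) z + Q j j t z (x + y)) / 2 = (Q j j t x z + Q j j t z x) / 2 + (Q j j t y z + Q j j t z y) / 2"
      if "j \<in> J" for j
      using toeplitz.q_add_left [OF toeplitz_component [OF that]] toeplitz.q_add_right [OF toeplitz_component [OF that]] *
      by (simp add: bdd_seq_disc_seq add_divide_distrib)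
    then have "(\<Sum>j\<in>J. (Q j j t (x + y) z + Q j j t z (x + y)) / 2) =
       (\<Sum>j\<in>J. (Q j j t x z + Q j j t z x) / 2) + (\<Sum>j\<in>J. (Q j j t y z + Q j j t z y) / 2)"
      unfolding sum.distrib [symmetric] by (rule sum.cong [OF refl])
    with h show ?thesis by (simp only: tuple_form_def)
  qed
  show "tuple_form t (r *\<^sub>R x) y = r * tuple_form t x y" if *: "0 < t" "t < 1" "bdd_seq x" "bdd_seq y"
  proof -
    have "hardy t (r *\<^sub>R x) y = r * hardy t x y"
      unfolding hardy_def suminf_mult [OF summable_hardy [OF *], symmetric] by (simp add: mult_ac)
    moreover have "(Q j j t (r *\<^sub>R x) y + Q j j t y (r *\<^sub>R x)) / 2 = r * ((Q j j t x y + Q j j t y x) / 2)"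
      if "j \<in> J" for j
      using toeplitz.q_scaleR_left [OF toeplitz_component [OF that]] toeplitz.q_scaleR_right [OF toeplitz_component [OF that]] *
      by (simp add: bdd_seq_disc_seq distrib_left)
    ultimately show ?thesis
      unfolding tuple_form_def distrib_left sum_distrib_left by (intro arg_cong2 [of _ _ _ _ "(+)"] sum.cong) simp_all
  qed
  show "tuple_form t x y = tuple_form t y x" by (simp add: tuple_form_def hardy_def inner_commute add.commute)
  show "tuple_form s x x \<le> tuple_form t x x" if *: "0 < s" "s \<le> t" "t < 1" "bdd_seq x"
  proof -
    have "hardy s x x \<le> hardy t x x"
      unfolding hardy_def using * by (intro suminf_le summable_hardy mult_right_mono power_mono) auto
    moreover have "Q j j s x x \<le> Q j j t x x" if "j \<in> J" for j
      using toeplitz_pos.q_mono [OF toeplitz_pos_component [OF that]] that J_pos * bdd_seq_disc_seq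
      by (metis gr0I less_imp_le)
    ultimately show ?thesis by (simp add: tuple_form_def add_mono sum_mono)
  qed
  show "t ^ k * (norm (x k))\<^sup>2 \<le> tuple_form t x x" if *: "0 < t" "t < 1" "bdd_seq x"
  proof -
    have "0 \<le> (\<Sum>j\<in>J. (Q j j t x x + Q j j t x x) / 2)"
      using * by (intro sum_nonneg) (simp add: Q_nonneg bdd_seq_disc_seq)
    then show ?thesis using hardy_nonneg_le [OF *, of k] unfolding tuple_form_def by linarith
  qed
  show "\<exists>C. \<forall>x S. (\<forall>k. norm (x k) \<le> S) \<longrightarrow> tuple_form t x x \<le> C * S\<^sup>2" if *: "0 < t" "t < 1"
  proof -
    have "\<forall>j\<in>J. \<exists>C. \<forall>a S. (\<forall>k. norm (a k) \<le> S) \<longrightarrow> Q j j t a a \<le> C * S\<^sup>2"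
      using toeplitz_pos.q_sup_bound [OF toeplitz_pos_component] * by (meson less_imp_le)
    then obtain C where C: "\<And>j a S. \<lbrakk>j \<in> J; \<And>k. norm (a k) \<le> S\<rbrakk> \<Longrightarrow> Q j j t a a \<le> C j * S\<^sup>2" by metis
    have "tuple_form t x x \<le> ((\<Sum>k. t ^ k) + (\<Sum>j\<in>J. C j)) * S\<^sup>2" if S: "\<And>k. norm (x k) \<le> S" for x S
    proof -
      have geo: "summable (\<lambda>k. t ^ k)" using * by (intro summable_geometric) simp
      have "hardy t x x \<le> (\<Sum>k. t ^ k * S\<^sup>2)"
        unfolding hardy_def
      proof (rule suminf_le [OF _ summable_hardy [OF *] summable_mult2 [OF geo]])
        show "t ^ k * inner (x k) (x k) \<le> t ^ k * S\<^sup>2" for k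
          using power_mono [OF S, of k 2] * by (simp add: power2_norm_eq_inner)
      qed (use S in \<open>auto simp: bdd_seq_def\<close>)
      also have "\<dots> = (\<Sum>k. t ^ k) * S\<^sup>2" by (rule suminf_mult2 [OF geo, symmetric])
      finally have "hardy t x x \<le> (\<Sum>k. t ^ k) * S\<^sup>2" .
      moreover have "(\<Sum>j\<in>J. (Q j j t x x + Q j j t x x) / 2) \<le> (\<Sum>j\<in>J. C j * S\<^sup>2)"
        using C [OF _ S] by (intro sum_mono) simp
      ultimately show ?thesis by (simp add: tuple_form_def distrib_right sum_distrib_right)
    qed
    then show ?thesis by blast
  qed
  show "tuple_form t (\<lambda>k. \<i> *\<^sub>C x k) (\<lambda>k. \<i> *\<^sub>C y k) = tuple_form t x y"
    using toeplitz.q_rotate [OF toeplitz_component] by (simp add: tuple_form_def hardy_def inner_scaleC_i)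
qed

text \<open>Terms are nonnegative, so every partial sum passes to the limit
  \<open>t \<rightarrow> 1\<close>, and conversely the factors \<open>t ^ k\<close> only decrease
  the sum.\<close>

lemma hardy_diag:
  assumes "bdd_seq x"
  shows "(\<forall>t. 0 < t \<and> t < 1 \<longrightarrow> hardy t x x \<le> B) \<longleftrightarrow> summable (\<lambda>k. (norm (x k))\<^sup>2) \<and> (\<Sum>k. (norm (x k))\<^sup>2) \<le> B"
    (is "?L \<longleftrightarrow> ?R")
proof
  assume L: ?L
  have partial: "(\<Sum>k<n. (norm (x k))\<^sup>2) \<le> B" for n
  proof (rule tendsto_upperbound)
    have "((\<lambda>t::real. \<Sum>k<n. t ^ k * (norm (x k))\<^sup>2) \<longlongrightarrow> (\<Sum>k<n. 1 ^ k * (norm (x k))\<^sup>2)) (at_left 1)"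
      by (intro tendsto_intros)
    then show "((\<lambda>t::real. \<Sum>k<n. t ^ k * (norm (x k))\<^sup>2) \<longlongrightarrow> (\<Sum>k<n. (norm (x k))\<^sup>2)) (at_left 1)" by simp
    have "(\<Sum>k<n. t ^ k * (norm (x k))\<^sup>2) \<le> B" if "0 < t" "t < 1" for t
    proof -
      have "(\<Sum>k<n. t ^ k * inner (x k) (x k)) \<le> hardy t x x"
        unfolding hardy_def by (rule sum_le_suminf [OF summable_hardy]) (use assms that in auto)
      then show ?thesis using L that by (fastforce simp: power2_norm_eq_inner)
    qed
    then show "\<forall>\<^sub>F t in at_left 1. (\<Sum>k<n. t ^ k * (norm (x k))\<^sup>2) \<le> B"
      using eventually_at_left_1 by (rule eventually_mono [rotated]) auto
  qed simp
  then have s: "summable (\<lambda>k. (norm (x k))\<^sup>2)" by (intro summableI_nonneg_bounded) auto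
  then show ?R using suminf_le_const [OF s partial] by simp
next
  assume R: ?R
  have "hardy t x x \<le> B" if "0 < t" "t < 1" for t
  proof -
    have "hardy t x x \<le> (\<Sum>k. (norm (x k))\<^sup>2)"
      unfolding hardy_def
    proof (rule suminf_le [OF _ summable_hardy])
      show "t ^ k * inner (x k) (x k) \<le> (norm (x k))\<^sup>2" for k
        using that by (simp add: power2_norm_eq_inner mult_left_le_one_le power_le_one)
    qed (use R assms that in auto)
    then show ?thesis using R by simp
  qed
  then show ?L by blast
qed

lemma square_summable_bdd_seq:
  fixes x :: "nat \<Rightarrow> 'e"
  assumes "summable (\<lambda>k. (norm (x k))\<^sup>2)"
  shows "bdd_seq x"
proof -
  have "norm (x k) \<le> sqrt (\<Sum>k. (norm (x k))\<^sup>2)" for k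
  proof (rule real_le_rsqrt)
    show "(norm (x k))\<^sup>2 \<le> (\<Sum>k. (norm (x k))\<^sup>2)"
      using sum_le_suminf [OF assms, of "{k}"] by simp
  qed
  then show ?thesis unfolding bdd_seq_def by blast
qed

lemma tendsto_hardy:
  assumes s: "summable (\<lambda>k. (norm (x k))\<^sup>2)"
  shows "((\<lambda>t. hardy t x x) \<longlongrightarrow> (\<Sum>k. (norm (x k))\<^sup>2)) (at_left 1)"
proof -
  note b = square_summable_bdd_seq [OF s]
  have B: "hardy t x x \<le> (\<Sum>k. (norm (x k))\<^sup>2)" if "0 < t" "t < 1" for t
    using hardy_diag [OF b, of "\<Sum>k. (norm (x k))\<^sup>2"] s that by blast
  have mono: "hardy s x x \<le> hardy t x x" if "0 < s" "s \<le> t" "t < 1" for s t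
    unfolding hardy_def using that b by (intro suminf_le summable_hardy mult_right_mono power_mono) auto
  obtain l where l: "((\<lambda>t. hardy t x x) \<longlongrightarrow> l) (at_left 1)" "l \<le> (\<Sum>k. (norm (x k))\<^sup>2)"
     "\<And>t. \<lbrakk>0 < t; t < 1\<rbrakk> \<Longrightarrow> hardy t x x \<le> l"
    by (rule tendsto_at_left_mono [of "\<lambda>t. hardy t x x" "\<Sum>k. (norm (x k))\<^sup>2"]) (use mono B in auto)
  have "(\<Sum>k. (norm (x k))\<^sup>2) \<le> l" using hardy_diag [OF b, of l] l(3) by blast
  with l show ?thesis by simp
qed

text \<open>All summands of \<open>tuple_form\<close> are nonnegative on the diagonal, so a bound on
  the total bounds each of them.\<close>

lemma Dom_iff: "x \<in> Dom \<longleftrightarrow> summable (\<lambda>k. (norm (x k))\<^sup>2) \<and> (\<forall>j\<in>J. fin j j x)"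
proof
  assume x: "x \<in> Dom"
  have b: "bdd_seq x" and d: "disc_seq x" using Dom_bdd [OF x] bdd_seq_disc_seq by auto
  have nn: "0 \<le> Q j j t x x" if "j \<in> J" "0 < t" "t < 1" for j t using Q_nonneg d that by simp
  have qj: "Q j j t x x \<le> form x x" if "0 < t" "t < 1" "j \<in> J" for t j
  proof -
    have "Q j j t x x \<le> (\<Sum>j\<in>J. Q j j t x x)"
      using finite_J that nn by (intro member_le_sum) auto
    moreover have "0 \<le> hardy t x x" using hardy_nonneg_le [OF that(1,2) b, of 0] by (simp add: order_trans [OF zero_le_power2])
    ultimately show "Q j j t x x \<le> form x x"
      using b_le_form [OF x that(1,2)] unfolding tuple_form_def by simp
  qed
  have "hardy t x x \<le> form x x" if "0 < t" "t < 1" for t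
  proof -
    have "0 \<le> (\<Sum>j\<in>J. (Q j j t x x + Q j j t x x) / 2)" using nn that by (intro sum_nonneg) simp
    then show ?thesis using b_le_form [OF x that] unfolding tuple_form_def by linarith
  qed
  then have "summable (\<lambda>k. (norm (x k))\<^sup>2)" using hardy_diag [OF b, of "form x x"] by blast
  moreover have "fin j j x" if "j \<in> J" for j
    by (rule toeplitz_pos.finI [OF toeplitz_pos_component [OF that] d]) (use qj that in blast)
  ultimately show "summable (\<lambda>k. (norm (x k))\<^sup>2) \<and> (\<forall>j\<in>J. fin j j x)" by blast
next
  assume R: "summable (\<lambda>k. (norm (x k))\<^sup>2) \<and> (\<forall>j\<in>J. fin j j x)"
  then have b: "bdd_seq x" using square_summable_bdd_seq by blast
  have "\<forall>j\<in>J. \<exists>B. \<forall>t. 0 < t \<and> t < 1 \<longrightarrow> Q j j t x x \<le> B"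
    using R toeplitz_pos_component toeplitz_pos.fin_def by blast
  then obtain B where B: "\<And>j t. \<lbrakk>j \<in> J; 0 < t; t < 1\<rbrakk> \<Longrightarrow> Q j j t x x \<le> B j" by metis
  show "x \<in> Dom"
  proof (rule DomI [OF b])
    show "tuple_form t x x \<le> (\<Sum>k. (norm (x k))\<^sup>2) + (\<Sum>j\<in>J. B j)" if "0 < t" "t < 1" for t
      unfolding tuple_form_def using hardy_diag [OF b, of "\<Sum>k. (norm (x k))\<^sup>2"] R that B
      by (intro add_mono sum_mono) auto
  qed
qed

lemma form_diag:
  assumes x: "x \<in> Dom"
  shows "form x x = (\<Sum>k. (norm (x k))\<^sup>2) + (\<Sum>j\<in>J. D j j x)"
proof -
  have lim: "((\<lambda>t. Q j j t x x) \<longlongrightarrow> D j j x) (at_left 1)" if "j \<in> J" for j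
    using toeplitz_pos.tendsto_D_Suc [OF toeplitz_pos_component [OF that], of "j - 1" x] x that J_pos Dom_iff
    by (cases j) auto
  have "((\<lambda>t. hardy t x x + (\<Sum>j\<in>J. Q j j t x x)) \<longlongrightarrow> (\<Sum>k. (norm (x k))\<^sup>2) + (\<Sum>j\<in>J. D j j x)) (at_left 1)"
    using x Dom_iff by (intro tendsto_intros tendsto_hardy lim) auto
  then show ?thesis by (rule form_eqI [OF x x]) (simp add: tuple_form_def)
qed

end

section \<open>The two shifts on the Hilbert space\<close>

context toeplitz_tuple
begin

lemma norm_sq_shift_up:
  assumes "summable (\<lambda>k. (norm (x k))\<^sup>2)"
  shows "summable (\<lambda>k. (norm (shift_up x k))\<^sup>2)" "(\<Sum>k. (norm (shift_up x k))\<^sup>2) = (\<Sum>k. (norm (x k))\<^sup>2)"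
proof -
  show s: "summable (\<lambda>k. (norm (shift_up x k))\<^sup>2)"
    using assms by (subst summable_Suc_iff [symmetric]) simp
  show "(\<Sum>k. (norm (shift_up x k))\<^sup>2) = (\<Sum>k. (norm (x k))\<^sup>2)"
    using suminf_split_head [OF s] by simp
qed

lemma norm_sq_shift_down:
  assumes "summable (\<lambda>k. (norm (x k))\<^sup>2)"
  shows "summable (\<lambda>k. (norm (shift_down x k))\<^sup>2)" "(\<Sum>k. (norm (shift_down x k))\<^sup>2) \<le> (\<Sum>k. (norm (x k))\<^sup>2)"
proof -
  show "summable (\<lambda>k. (norm (shift_down x k))\<^sup>2)"
    using assms summable_Suc_iff [of "\<lambda>k. (norm (x k))\<^sup>2"] by (simp add: shift_down_def)
  show "(\<Sum>k. (norm (shift_down x k))\<^sup>2) \<le> (\<Sum>k. (norm (x k))\<^sup>2)"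
    using suminf_split_head [OF assms] by (simp add: shift_down_def)
qed

lemma fin_pos:
  assumes "x \<in> Dom" "j \<in> J"
  obtains n where "j = Suc n" "fin j (Suc n) x"
  using assms Dom_iff J_pos by (metis not0_implies_Suc)

lemma Dom_shift_up: "x \<in> Dom \<Longrightarrow> shift_up x \<in> Dom"
  unfolding Dom_iff using norm_sq_shift_up(1) toeplitz_pos.fin_shift_up [OF toeplitz_pos_component] J_pos
  by (metis not0_implies_Suc)

lemma Dom_shift_down: "x \<in> Dom \<Longrightarrow> shift_down x \<in> Dom"
  unfolding Dom_iff using norm_sq_shift_down(1) toeplitz_pos.fin_shift_down [OF toeplitz_pos_component] J_pos
  by (metis not0_implies_Suc)

lemma Dom_funpow_shift_up: "x \<in> Dom \<Longrightarrow> (shift_up ^^ n) x \<in> Dom"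
  by (induction n) (simp_all add: Dom_shift_up)

lemma Dom_funpow_shift_down: "x \<in> Dom \<Longrightarrow> (shift_down ^^ n) x \<in> Dom"
  by (induction n) (simp_all add: Dom_shift_down)

lemma D_diag_nonneg: "x \<in> Dom \<Longrightarrow> j \<in> J \<Longrightarrow> 0 \<le> D j j x"
  using toeplitz_pos.D_nonneg [OF toeplitz_pos_component] J_pos Dom_iff by (metis gr0I)

lemma D_le_form: 
  assumes "x \<in> Dom" "j \<in> J"
  shows "D j j x \<le> form x x"
proof -
  have "D j j x \<le> (\<Sum>j\<in>J. D j j x)"
    using finite_J assms D_diag_nonneg by (intro member_le_sum) auto
  moreover have "0 \<le> (\<Sum>k. (norm (x k))\<^sup>2)" using assms Dom_iff by (intro suminf_nonneg) auto
  ultimately show ?thesis using form_diag [OF assms(1)] by simp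
qed

lemma form_shift_down_le:
  assumes x: "x \<in> Dom"
  shows "form (shift_down x) (shift_down x) \<le> form x x"
proof -
  have "D j j (shift_down x) \<le> D j j x" if j: "j \<in> J" for j
  proof -
    obtain n where n: "j = Suc n" "fin j (Suc n) x" using fin_pos [OF x j] .
    show ?thesis
      using toeplitz_pos.D_funpow_shift_down_le [OF toeplitz_pos_component [OF j] n(2), of 1] n by simp
  qed
  then show ?thesis
    unfolding form_diag [OF x] form_diag [OF Dom_shift_down [OF x]]
    using norm_sq_shift_down(2) [of x] x Dom_iff by (intro add_mono sum_mono) auto
qed

text \<open>By \<open>D_shift_up\<close> the new contribution has order one less.
  \<open>D_le_D_Suc\<close> controls it by the old order and finitely many coefficients, and each of
  these two parts is at most \<open>form x x\<close>, hence \<open>1 + 2 * C\<close>.\<close>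

lemma form_shift_up_le:
  "\<exists>C. \<forall>x\<in>Dom. form (shift_up x) (shift_up x) \<le> C * form x x"
proof -
  have "\<exists>C. \<forall>x\<in>Dom. D j j (shift_up x) \<le> C * form x x" if j: "j \<in> J" for j
  proof -
    interpret t: toeplitz_pos "c j" "K j" by (rule toeplitz_pos_component [OF j])
    obtain n where n: "j = Suc n" using j J_pos by (metis not0_implies_Suc)
    obtain C where C: "C \<ge> 0" "\<And>a. t.fin (Suc n) a \<Longrightarrow> t.D n a \<le> C * ((\<Sum>i\<le>n. (norm (a i))\<^sup>2) + t.D (Suc n) a)"
      using t.D_le_D_Suc by blast
    have "D j j (shift_up x) \<le> (1 + 2 * C) * form x x" if x: "x \<in> Dom" for x
    proof -
      have f: "t.fin (Suc n) x" using x j n Dom_iff by blast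
      have "(\<Sum>i\<le>n. (norm (x i))\<^sup>2) \<le> (\<Sum>k. (norm (x k))\<^sup>2)"
        by (rule sum_le_suminf) (use x Dom_iff in auto)
      also have "\<dots> \<le> form x x"
        using form_diag [OF x] D_diag_nonneg [OF x] by (simp add: sum_nonneg)
      finally have "t.D n x \<le> C * (form x x + form x x)"
        using C(2) [OF f] D_le_form [OF x j] n C(1)
        by (smt (verit) mult_left_mono)
      then show ?thesis
        using t.D_shift_up [OF f] D_le_form [OF x j] n by (simp add: algebra_simps)
    qed
    then show ?thesis by blast
  qed
  then obtain C where C: "\<And>j x. \<lbrakk>j \<in> J; x \<in> Dom\<rbrakk> \<Longrightarrow> D j j (shift_up x) \<le> C j * form x x" by metis
  have "form (shift_up x) (shift_up x) \<le> (1 + (\<Sum>j\<in>J. C j)) * form x x" if x: "x \<in> Dom" for x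
  proof -
    have "(\<Sum>k. (norm (shift_up x k))\<^sup>2) \<le> form x x"
      using norm_sq_shift_up(2) [of x] x Dom_iff form_diag [OF x] D_diag_nonneg [OF x] by (simp add: sum_nonneg)
    moreover have "(\<Sum>j\<in>J. D j j (shift_up x)) \<le> (\<Sum>j\<in>J. C j * form x x)" by (intro sum_mono C x)
    ultimately show ?thesis
      using form_diag [OF Dom_shift_up [OF x]] by (simp add: distrib_right sum_distrib_right)
  qed
  then show ?thesis by blast
qed

text \<open>\<open>shift_down\<close> is a contraction that undoes \<open>shift_up\<close>. The
  resulting lower bound makes the product of the adjoint of \<open>M_z\<close> with
  \<open>M_z\<close> injective.\<close>

lemma form_shift_up_ge:
  assumes x: "x \<in> Dom"
  shows "form x x \<le> form (shift_up x) (shift_up x)"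
  using form_shift_down_le [OF Dom_shift_up [OF x]] by simp

end

section \<open>Vanishing of the remainder at order one\<close>

context toeplitz_pos
begin

text \<open>\<open>D 0\<close> is invariant under \<open>shift_up\<close>, so every factor
  \<open>z\<close> adds the same amount.\<close>

lemma D_1_funpow_shift_up:
  assumes "fin 1 a"
  shows "D 1 ((shift_up ^^ N) a) = D 1 a + N * D 0 a"
proof -
  have f: "fin 1 ((shift_up ^^ N) a)" for N using fin_funpow_shift_up [of 0 a N] assms by simp
  have D0: "D 0 ((shift_up ^^ N) a) = D 0 a" for N
    by (induction N) (use D_0_shift_up [OF f] in simp_all)
  show ?thesis
  proof (induction N)
    case (Suc N)
    then show ?case using D_shift_up [of 0 "(shift_up ^^ N) a"] f [of N] D0 by (simp add: distrib_right)
  qed simp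
qed

text \<open>Otherwise the summable sequence of the values \<open>D 0\<close> would eventually
  dominate the harmonic series.\<close>

lemma exists_small_D_0:
  assumes fin: "fin 1 a"
  shows "\<exists>N\<ge>k. N * D 0 ((shift_down ^^ N) a) \<le> 1"
proof (rule ccontr)
  assume "\<not> ?thesis"
  then have *: "1 < N * D 0 ((shift_down ^^ N) a)" if "N \<ge> k" for N using that not_le by blast
  have "summable (\<lambda>i. D 0 ((shift_down ^^ Suc i) a))" using summable_D_shift_down [of 0 a] fin by simp
  then have "summable (\<lambda>i. inverse (real (Suc i)))"
  proof (rule summable_comparison_test' [where N = k])
    fix i assume "k \<le> i"
    then have "1 < real (Suc i) * D 0 ((shift_down ^^ Suc i) a)" by (intro *) simp
    then show "norm (inverse (real (Suc i))) \<le> D 0 ((shift_down ^^ Suc i) a)"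
      by (simp add: field_simps del: funpow.simps)
  qed
  then have "summable (\<lambda>i. inverse (real i))" by (subst (asm) summable_Suc_iff)
  then show False using not_summable_harmonic [where 'a = real] by simp
qed

text \<open>The tails \<open>z ^ N * L ^ N f\<close> have bounded norms along a subsequence, so elements of almost
  minimal norm in the convex sets of functions that vanish to order \<open>k\<close> and differ from \<open>f\<close>
  by a polynomial form a Cauchy sequence, whose limit vanishes to infinite order.\<close>

lemma D_1_shift_down_tendsto_0:
  assumes fin: "fin 1 f" and l2: "summable (\<lambda>k. (norm (f k))\<^sup>2)"
  shows "(\<lambda>N. D 1 ((shift_down ^^ N) f)) \<longlonglongrightarrow> 0"
proof -
  \<comment> \<open>The Hilbert space whose squared norm is the Hardy norm squared plus
    \<open>D 1\<close>.\<close>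
  interpret tt: toeplitz_tuple "\<lambda>_. c" "\<lambda>_. K" "{Suc 0}"
    by unfold_locales auto
  have Dom: "x \<in> tt.Dom \<longleftrightarrow> summable (\<lambda>k. (norm (x k))\<^sup>2) \<and> fin 1 x" for x
    by (simp add: tt.Dom_iff)
  have f: "f \<in> tt.Dom" using fin l2 Dom by simp
  define N where "N x = tt.form x x" for x
  define S where "S k = {h \<in> tt.Dom. (\<forall>i<k. h i = 0) \<and> (\<exists>M. \<forall>i\<ge>M. h i = f i)}" for k
  \<comment> \<open>Bounds the tail \<open>h\<close> obtained by shifting down and up
    \<open>n\<close> times: \<open>D 1\<close> of the shifted sequence is at most
    \<open>D 1 f\<close>, the factor \<open>z ^ n\<close> adds \<open>n * D 0\<close>, and the final
    1 bounds this for suitable \<open>n\<close>.\<close>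
  define B where "B = (\<Sum>k. (norm (f k))\<^sup>2) + D 1 f + 1"
  define d where "d k = Inf (N ` S k)" for k
  have N_nonneg: "0 \<le> N x" if "x \<in> tt.Dom" for x using tt.s_nonneg that by (simp add: N_def)
  have S_Dom: "x \<in> tt.Dom" if "x \<in> S k" for x k using that by (simp add: S_def)
  have bounded_elt: "\<exists>h\<in>S k. N h \<le> B" for k
  proof -
    obtain n where n: "n \<ge> k" "n * D 0 ((shift_down ^^ n) f) \<le> 1" using exists_small_D_0 [OF fin] by blast
    define g where "g = (shift_down ^^ n) f"
    define h where "h = (shift_up ^^ n) g"
    have g: "g \<in> tt.Dom" unfolding g_def by (rule tt.Dom_funpow_shift_down [OF f])
    have h: "h \<in> tt.Dom" unfolding h_def by (rule tt.Dom_funpow_shift_up [OF g])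
    have h_eq: "h i = (if i < n then 0 else f i)" for i
      by (simp add: h_def g_def funpow_shift_up funpow_shift_down)
    have "D 1 g \<le> D 1 f" using D_funpow_shift_down_le [of 0 f n] fin by (simp add: g_def)
    then have "D 1 h \<le> D 1 f + 1"
      using D_1_funpow_shift_up [of g n] g Dom n(2) by (simp add: h_def g_def)
    moreover have "(\<Sum>k. (norm (h k))\<^sup>2) \<le> (\<Sum>k. (norm (f k))\<^sup>2)"
      by (rule suminf_le) (use h Dom l2 in \<open>auto simp: h_eq\<close>)
    ultimately have "N h \<le> B" using tt.form_diag [OF h] by (simp add: N_def B_def)
    moreover have "h \<in> S k" using h n(1) unfolding S_def by (auto simp: h_eq intro!: exI [of _ n])
    ultimately show ?thesis by blast
  qed
  have bdd: "bdd_below (N ` S k)" for k by (rule bdd_belowI [of _ 0]) (use N_nonneg S_Dom in auto)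
  have ne: "N ` S k \<noteq> {}" for k using bounded_elt [of k] by blast
  have d_le: "d k \<le> N x" if "x \<in> S k" for x k
    unfolding d_def by (rule cInf_lower) (use that bdd in auto)
  have d_le_B: "d k \<le> B" for k using bounded_elt [of k] d_le order_trans by blast
  have S_mono: "S l \<subseteq> S k" if "k \<le> l" for k l using that by (auto simp: S_def)
  \<comment> \<open>The sets \<open>S k\<close> decrease, so their infima increase; \<open>B\<close>
    bounds them, so they converge.\<close>
  have "incseq d"
    unfolding d_def by (rule incseq_SucI) (intro cInf_superset_mono ne bdd image_mono S_mono, simp)
  then obtain L where L: "d \<longlonglongrightarrow> L" "\<And>k. d k \<le> L"
    using incseq_convergent [of d B] d_le_B by blast
  have "\<exists>v\<in>S k. N v < d k + 1 / Suc k" for k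
    using cInf_lessD [OF ne, of k "d k + 1 / Suc k"] d_def by force
  then obtain v where v: "\<And>k. v k \<in> S k" "\<And>k. N (v k) < d k + 1 / Suc k" by metis
  have v_Dom: "v k \<in> tt.Dom" for k using v(1) S_Dom by blast
  \<comment> \<open>The midpoint of \<open>v k\<close> and \<open>v l\<close> stays in
    \<open>S p\<close>, so its norm is at least \<open>d p\<close>; the parallelogram identity then
    turns near minimality of both into closeness.\<close>
  have close: "N (v k - v l) \<le> 4 * (L - d p) + 4 / Suc p" if "p \<le> k" "p \<le> l" for k l p
  proof -
    define w where "w = (1 / 2 :: real) *\<^sub>R (v k + v l)"
    have vS: "v k \<in> S p" "v l \<in> S p" using v(1) S_mono that by blast+
    then obtain M M' where M: "\<forall>i\<ge>M. v k i = f i" "\<forall>i\<ge>M'. v l i = f i" by (auto simp: S_def)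
    have "\<forall>i\<ge>max M M'. w i = f i"
      using M by (simp add: w_def flip: scaleR_2)
    moreover have "w \<in> tt.Dom" unfolding w_def by (intro tt.V_mem v_Dom)
    moreover have "\<forall>i<p. w i = 0" using vS by (simp add: S_def w_def)
    ultimately have "w \<in> S p" unfolding S_def by blast
    then have "d p \<le> N w" by (rule d_le)
    moreover have "N (v k - v l) = 2 * N (v k) + 2 * N (v l) - 4 * N w"
      using v_Dom tt.s_commute [of "v k" "v l"] by (simp add: N_def w_def tt.s_simps field_simps)
    moreover have "N (v k) < L + 1 / Suc p" "N (v l) < L + 1 / Suc p"
    proof -
      have "1 / real (Suc i) \<le> 1 / real (Suc p)" if "p \<le> i" for i using that by (simp add: frac_le)
      then show "N (v k) < L + 1 / Suc p" "N (v l) < L + 1 / Suc p"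
        using v(2) L(2) that by (meson add_mono less_le_trans)+
    qed
    moreover have "4 / real (Suc p) = 4 * (1 / real (Suc p))" by simp
    ultimately show ?thesis by argo
  qed
  have lim0: "(\<lambda>p. 4 * (L - d p) + 4 / Suc p) \<longlonglongrightarrow> 0"
  proof -
    have "(\<lambda>p. 4 * (L - d p) + 4 * inverse (real (Suc p))) \<longlonglongrightarrow> 4 * (L - L) + 4 * 0"
      by (intro tendsto_intros L LIMSEQ_inverse_real_of_nat)
    then show ?thesis by (simp add: divide_inverse)
  qed
  have "\<exists>x\<in>tt.Dom. (\<lambda>n. tt.form (v n - x) (v n - x)) \<longlonglongrightarrow> 0"
  proof (rule tt.s_complete [OF v_Dom])
    fix e :: real assume "e > 0"
    then have "\<forall>\<^sub>F p in sequentially. 4 * (L - d p) + 4 / Suc p < e" using order_tendstoD(2) [OF lim0] by simp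
    then obtain p where "4 * (L - d p) + 4 / Suc p < e" by (rule eventually_happens'[OF sequentially_bot, THEN exE])
    then show "\<exists>N. \<forall>m\<ge>N. \<forall>n\<ge>N. tt.form (v m - v n) (v m - v n) < e"
      using close N_def by (intro exI [of _ p]) (smt (verit))
  qed
  then obtain x where x: "x \<in> tt.Dom" and lim: "(\<lambda>n. N (v n - x)) \<longlonglongrightarrow> 0" unfolding N_def by blast
  \<comment> \<open>Coordinate \<open>i\<close> of \<open>v n\<close> vanishes as soon as
    \<open>n > i\<close>, and coordinates are continuous for the form.\<close>
  have "x i = 0" for i
  proof -
    have "(norm (x i))\<^sup>2 \<le> N (v n - x)" if "n > i" for n
    proof -
      have "(norm ((v n - x) i))\<^sup>2 \<le> N (v n - x)"
        unfolding N_def by (rule tt.norm_index_le_form) (intro tt.V_mem v_Dom x)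
      moreover have "v n i = 0" using v(1) [of n] that by (simp add: S_def)
      ultimately show ?thesis by simp
    qed
    then have "(norm (x i))\<^sup>2 \<le> 0"
      using lim by (intro tendsto_lowerbound [OF lim]) (auto intro: eventually_mono [OF eventually_gt_at_top [of i]])
    then show ?thesis by simp
  qed
  then have x0: "x = 0" by (simp add: fun_eq_iff)
  show ?thesis
  proof (rule LIMSEQ_I)
    fix e :: real assume "e > 0"
    then have "\<forall>\<^sub>F n in sequentially. N (v n) < e" using order_tendstoD(2) [OF lim] x0 by simp
    then obtain k where k: "N (v k) < e" by (rule eventually_happens'[OF sequentially_bot, THEN exE])
    obtain M where M: "\<forall>i\<ge>M. v k i = f i" using v(1) [of k] by (auto simp: S_def)
    \<comment> \<open>From index \<open>M\<close> on, \<open>f\<close> agrees with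
      \<open>v k\<close>, whose norm is small. Enough shifts erase the difference, and shifting down
      does not increase \<open>D 1\<close>.\<close>
    have "norm (D 1 ((shift_down ^^ n) f) - 0) < e" if "n \<ge> M" for n
    proof -
      have "(shift_down ^^ n) f = (shift_down ^^ n) (v k)"
        using M that by (simp add: fun_eq_iff funpow_shift_down)
      moreover have "D 1 ((shift_down ^^ n) (v k)) \<le> D 1 (v k)"
        using D_funpow_shift_down_le [of 0 "v k" n] v_Dom [of k] Dom by simp
      moreover have "D 1 (v k) \<le> N (v k)" using tt.D_le_form [OF v_Dom] by (simp add: N_def)
      moreover have "0 \<le> D 1 ((shift_down ^^ n) f)"
        by (rule D_nonneg) (use fin_funpow_shift_down [of 0 f n] fin in simp_all)
      ultimately show ?thesis using k by simp
    qed
    then show "\<exists>no. \<forall>n\<ge>no. norm (D 1 ((shift_down ^^ n) f) - 0) < e" by blast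
  qed
qed

lemma D_sums:
  assumes fin: "fin (Suc n) a" and l2: "summable (\<lambda>k. (norm (a k))\<^sup>2)"
  shows "(\<lambda>i. D n ((shift_down ^^ Suc i) a)) sums D (Suc n) a"
proof (cases n)
  case 0
  have "(\<lambda>N. D 1 a - D 1 ((shift_down ^^ N) a)) \<longlonglongrightarrow> D 1 a - 0"
    using fin 0 by (intro tendsto_diff tendsto_const D_1_shift_down_tendsto_0 l2) simp
  moreover have "D 1 a - D 1 ((shift_down ^^ N) a) = (\<Sum>i<N. D 0 ((shift_down ^^ Suc i) a))" for N
    using D_funpow_shift_down [of 0 a N] fin 0 by simp
  ultimately show ?thesis by (simp add: sums_def 0 del: funpow.simps)
next
  case (Suc k)
  then show ?thesis using D_sums_Suc fin by blast
qed

end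

section \<open>Iterated differences\<close>

text \<open>The \<open>r\<close>-th forward difference at 0. Applied to the squared norms of the
  iterates \<open>z ^ i * f\<close> it gives the quadratic form of
  \<open>\<beta>\<^sub>r\<close>.\<close>

definition alt_diff :: "nat \<Rightarrow> (nat \<Rightarrow> real) \<Rightarrow> real" where
  "alt_diff r u = (\<Sum>i\<le>r. (real (r choose i) * (-1) ^ (r - i)) * u i)"

lemma alt_diff_0 [simp]: "alt_diff 0 u = u 0"
  by (simp add: alt_diff_def)

lemma alt_diff_Suc: "alt_diff (Suc r) u = alt_diff r (\<lambda>i. u (Suc i)) - alt_diff r u"
proof -
  have "alt_diff (Suc r) u = (-1) ^ Suc r * u 0 + (\<Sum>i\<le>r. (real (Suc r choose Suc i) * (-1) ^ (r - i)) * u (Suc i))"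
    unfolding alt_diff_def sum.atMost_Suc_shift by simp
  also have "(\<Sum>i\<le>r. (real (Suc r choose Suc i) * (-1) ^ (r - i)) * u (Suc i)) =
      alt_diff r (\<lambda>i. u (Suc i)) + (\<Sum>i\<le>r. (real (r choose Suc i) * (-1) ^ (r - i)) * u (Suc i))"
    by (simp add: alt_diff_def distrib_right sum.distrib)
  also have "(\<Sum>i\<le>r. (real (r choose Suc i) * (-1) ^ (r - i)) * u (Suc i)) =
      (\<Sum>i<r. (real (r choose Suc i) * (-1) ^ (r - i)) * u (Suc i))"
    by (simp add: lessThan_Suc_atMost [symmetric])
  also have "\<dots> = - (\<Sum>i<r. (real (r choose Suc i) * (-1) ^ (r - Suc i)) * u (Suc i))"
    unfolding sum_negf [symmetric] by (intro sum.cong refl) (auto simp: Suc_diff_Suc [symmetric])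
  finally have "alt_diff (Suc r) u = alt_diff r (\<lambda>i. u (Suc i)) -
      ((-1) ^ r * u 0 + (\<Sum>i<r. (real (r choose Suc i) * (-1) ^ (r - Suc i)) * u (Suc i)))" by simp
  also have "(-1) ^ r * u 0 + (\<Sum>i<r. (real (r choose Suc i) * (-1) ^ (r - Suc i)) * u (Suc i)) = alt_diff r u"
  proof (cases r)
    case (Suc p)
    then show ?thesis unfolding alt_diff_def Suc sum.atMost_Suc_shift by (simp add: lessThan_Suc_atMost)
  qed simp
  finally show ?thesis .
qed

lemma alt_diff_add: "alt_diff r (\<lambda>i. u i + v i) = alt_diff r u + alt_diff r v"
  by (simp add: alt_diff_def distrib_left sum.distrib)

lemma alt_diff_sum: "alt_diff r (\<lambda>i. \<Sum>j\<in>A. u j i) = (\<Sum>j\<in>A. alt_diff r (u j))"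
  by (simp add: alt_diff_def sum_distrib_left) (rule sum.swap)

lemma alt_diff_const: "alt_diff (Suc r) (\<lambda>_. x) = 0"
  by (simp add: alt_diff_Suc)

text \<open>Each difference lowers the order by one by \<open>D_shift_up\<close>. At order zero the
  values are constant along the iterates, so one more difference annihilates them.\<close>

lemma (in toeplitz_pos) alt_diff_D:
  assumes "fin (Suc n) a"
  shows "alt_diff r (\<lambda>i. D (Suc n) ((shift_up ^^ i) a)) = (if r \<le> Suc n then D (Suc n - r) a else 0)"
  using assms
proof (induction r arbitrary: a)
  case (Suc r)
  have fin_le: "fin m a" if "m \<le> Suc n" "fin (Suc n) a" for m a
    using that by (induction rule: inc_induct) (auto intro: fin_pred)
  have "alt_diff r (\<lambda>i. D (Suc n) ((shift_up ^^ Suc i) a)) = (if r \<le> Suc n then D (Suc n - r) (shift_up a) else 0)"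
    using Suc.IH [OF fin_shift_up [OF Suc.prems]] by (simp only: funpow_Suc_right comp_def)
  moreover have "alt_diff r (\<lambda>i. D (Suc n) ((shift_up ^^ i) a)) = (if r \<le> Suc n then D (Suc n - r) a else 0)"
    by (rule Suc.IH [OF Suc.prems])
  moreover have "D (Suc n - r) (shift_up a) = D (Suc n - r) a + D (n - r) a" if "r \<le> n"
    using D_shift_up [of "n - r" a] fin_le [of "Suc (n - r)" a] that Suc.prems by (simp add: Suc_diff_le)
  moreover have "D 0 (shift_up a) = D 0 a"
    using D_0_shift_up fin_le [of 1 a] Suc.prems by simp
  ultimately show ?case
    by (cases "r \<le> n"; cases "r = Suc n") (auto simp: alt_diff_Suc simp del: funpow.simps)
qed simp

context toeplitz_tuple
begin

text \<open>The Hardy part is invariant under \<open>shift_up\<close> and is killed by the first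
  difference, which is why the order of the difference is \<open>Suc r\<close>.\<close>

lemma alt_diff_form:
  assumes x: "x \<in> Dom"
  shows "alt_diff (Suc r) (\<lambda>i. form ((shift_up ^^ i) x) ((shift_up ^^ i) x)) =
     (\<Sum>j\<in>{j\<in>J. Suc r \<le> j}. D j (j - Suc r) x)"
proof -
  have h: "(\<Sum>k. (norm ((shift_up ^^ i) x k))\<^sup>2) = (\<Sum>k. (norm (x k))\<^sup>2)" for i
  proof (induction i)
    case (Suc i)
    then show ?case using norm_sq_shift_up(2) [of "(shift_up ^^ i) x"] Dom_funpow_shift_up [OF x] Dom_iff by simp
  qed simp
  have "alt_diff (Suc r) (\<lambda>i. form ((shift_up ^^ i) x) ((shift_up ^^ i) x)) =
     (\<Sum>j\<in>J. alt_diff (Suc r) (\<lambda>i. D j j ((shift_up ^^ i) x)))"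
    by (simp only: form_diag [OF Dom_funpow_shift_up [OF x]] h alt_diff_add alt_diff_sum alt_diff_const add_0)
  also have "\<dots> = (\<Sum>j\<in>J. if Suc r \<le> j then D j (j - Suc r) x else 0)"
  proof (rule sum.cong [OF refl])
    fix j assume j: "j \<in> J"
    obtain n where n: "j = Suc n" "fin j (Suc n) x" using fin_pos [OF x j] .
    show "alt_diff (Suc r) (\<lambda>i. D j j ((shift_up ^^ i) x)) = (if Suc r \<le> j then D j (j - Suc r) x else 0)"
      using toeplitz_pos.alt_diff_D [OF toeplitz_pos_component [OF j] n(2)] n(1) by simp
  qed
  also have "\<dots> = (\<Sum>j\<in>{j\<in>J. Suc r \<le> j}. D j (j - Suc r) x)"
    by (rule sum.inter_filter [OF finite_J, symmetric])
  finally show ?thesis .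
qed

text \<open>Summation along the shifts raises the order of each component by one, from
  \<open>j - Suc r\<close> to \<open>j - r\<close>. Compared with the difference of order
  \<open>r\<close>, only the component \<open>j = r\<close>, of order zero, is missing: this is the
  term \<open>D_zero\<close> of the theorem.\<close>

lemma alt_diff_form_sums:
  assumes x: "x \<in> Dom"
  shows "(\<lambda>n. alt_diff (Suc r) (\<lambda>i. form ((shift_up ^^ i) ((shift_down ^^ Suc n) x)) ((shift_up ^^ i) ((shift_down ^^ Suc n) x))))
     sums (\<Sum>j\<in>{j\<in>J. Suc r \<le> j}. D j (j - r) x)"
  unfolding alt_diff_form [OF Dom_funpow_shift_down [OF x]]
proof (rule sums_sum)
  fix j assume j: "j \<in> {j \<in> J. Suc r \<le> j}"
  then interpret t: toeplitz_pos "c j" "K j" using toeplitz_pos_component by simp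
  obtain n where n: "j = Suc n" "t.fin (Suc n) x" using fin_pos [OF x, of j] j by blast
  have le: "m \<le> Suc n \<Longrightarrow> t.fin m x" for m
    by (induction rule: inc_induct) (auto intro: n(2) t.fin_pred)
  have "t.fin (Suc (j - Suc r)) x" using le [of "Suc (j - Suc r)"] n(1) j by simp
  then have "(\<lambda>i. t.D (j - Suc r) ((shift_down ^^ Suc i) x)) sums t.D (Suc (j - Suc r)) x"
    by (rule t.D_sums) (use x Dom_iff in blast)
  then show "(\<lambda>i. t.D (j - Suc r) ((shift_down ^^ Suc i) x)) sums t.D (j - r) x"
    using j by (simp add: Suc_diff_Suc del: funpow.simps)
qed

end

section \<open>Integration against a semi-spectral measure\<close>

lemma sum_list_sum:
  fixes g :: "'a \<Rightarrow> 'b \<Rightarrow> 'c::comm_monoid_add"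
  shows "(\<Sum>p\<leftarrow>xs. \<Sum>y\<in>Y. g y p) = (\<Sum>y\<in>Y. \<Sum>p\<leftarrow>xs. g y p)"
  by (induction xs) (simp_all add: sum.distrib)

lemma tendsto_sum_list:
  fixes g :: "'a \<Rightarrow> 'b \<Rightarrow> 'c::real_normed_vector"
  assumes "\<And>p. p \<in> set xs \<Longrightarrow> ((\<lambda>n. g n p) \<longlongrightarrow> l p) F"
  shows "((\<lambda>n. \<Sum>p\<leftarrow>xs. g n p) \<longlongrightarrow> (\<Sum>p\<leftarrow>xs. l p)) F"
  using assms by (induction xs) (auto intro!: tendsto_add)

lemma integrable_bounded:
  fixes \<phi> :: "'a \<Rightarrow> 'b::{banach, second_countable_topology}"
  assumes "finite_measure M" "\<phi> \<in> borel_measurable M" "\<And>x. x \<in> space M \<Longrightarrow> norm (\<phi> x) \<le> B"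
  shows "integrable M \<phi>"
proof -
  interpret finite_measure M by fact
  show ?thesis by (rule integrable_const_bound [of \<phi> B]) (use assms in auto)
qed

text \<open>Simple functions dominated by a multiple of \<open>\<phi>\<close> reduce the claim to
  sets. It gives both the sesquilinearity of the polarized integral and the independence of an
  integral from the decomposition of the complex measure.\<close>

lemma signed_integral_eq_0:
  fixes \<phi> :: "'a \<Rightarrow> complex" and xs :: "(complex \<times> 'a measure) list"
  assumes fin: "\<And>w M. (w, M) \<in> set xs \<Longrightarrow> finite_measure M \<and> sets M = sets N"
    and meas: "\<phi> \<in> borel_measurable N" and bound: "\<And>x. x \<in> space N \<Longrightarrow> cmod (\<phi> x) \<le> B"
    and zero: "\<And>A. A \<in> sets N \<Longrightarrow> (\<Sum>(w, M)\<leftarrow>xs. w * measure M A) = 0"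
  shows "(\<Sum>(w, M)\<leftarrow>xs. w * (LINT x|M. \<phi> x)) = 0"
proof -
  obtain F where F: "\<And>i. simple_function N (F i)" "\<And>x. x \<in> space N \<Longrightarrow> (\<lambda>i. F i x) \<longlonglongrightarrow> \<phi> x"
     "\<And>i x. x \<in> space N \<Longrightarrow> dist (F i x) 0 \<le> 2 * dist (\<phi> x) 0"
    using borel_measurable_implies_sequence_metric [OF meas, of 0] by blast
  have sp: "space M = space N" if "(w, M) \<in> set xs" for w M using fin [OF that] sets_eq_imp_space_eq by blast
  have simple: "simple_function M (F i)" if "(w, M) \<in> set xs" for w M i
    using F(1) [of i] fin [OF that] sp [OF that] by (simp add: simple_function_def)
  have int: "(LINT x|M. F i x) = (\<Sum>y\<in>F i ` space N. measure M {x \<in> space N. F i x = y} *\<^sub>R y)" if "(w, M) \<in> set xs" for w M i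
  proof -
    interpret finite_measure M using fin [OF that] by blast
    have "Bochner_Integration.simple_bochner_integrable M (F i)"
      using simple [OF that, of i] by (intro simple_bochner_integrable.intros) simp_all
    then show ?thesis
      by (simp flip: simple_bochner_integrable_eq_integral add: simple_bochner_integral_def sp [OF that])
  qed
  have "(\<Sum>(w, M)\<leftarrow>xs. w * (LINT x|M. F i x)) = 0" for i
  proof -
    have "(\<Sum>(w, M)\<leftarrow>xs. w * (LINT x|M. F i x)) =
          (\<Sum>p\<leftarrow>xs. \<Sum>y\<in>F i ` space N. y * (fst p * measure (snd p) {x \<in> space N. F i x = y}))"
      by (rule arg_cong [of _ _ sum_list], rule map_cong [OF refl])
         (auto simp: int sum_distrib_left scaleR_conv_of_real mult_ac)
    also have "\<dots> = (\<Sum>y\<in>F i ` space N. y * (\<Sum>(w, M)\<leftarrow>xs. w * measure M {x \<in> space N. F i x = y}))"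
      by (simp add: sum_list_sum sum_list_const_mult case_prod_unfold)
    also have "\<dots> = 0"
    proof (rule sum.neutral, rule ballI)
      fix y
      have "{x \<in> space N. F i x = y} = F i -` {y} \<inter> space N" by auto
      then have "{x \<in> space N. F i x = y} \<in> sets N"
        using simple_functionD(2) [OF F(1), of i "{y}"] by simp
      then show "y * (\<Sum>(w, M)\<leftarrow>xs. w * measure M {x \<in> space N. F i x = y}) = 0" using zero by simp
    qed
    finally show ?thesis .
  qed
  moreover have "(\<lambda>i. \<Sum>(w, M)\<leftarrow>xs. w * (LINT x|M. F i x)) \<longlonglongrightarrow> (\<Sum>(w, M)\<leftarrow>xs. w * (LINT x|M. \<phi> x))"
  proof (rule tendsto_sum_list, clarify, rule tendsto_mult_left)
    fix w M assume wM: "(w, M) \<in> set xs"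
    interpret finite_measure M using fin [OF wM] by blast
    show "(\<lambda>i. LINT x|M. F i x) \<longlonglongrightarrow> (LINT x|M. \<phi> x)"
    proof (rule integral_dominated_convergence [where w = "\<lambda>_. 2 * B"])
      show "\<phi> \<in> borel_measurable M" using meas measurable_cong_sets fin [OF wM] by blast
      show "F i \<in> borel_measurable M" for i using borel_measurable_simple_function simple [OF wM] by blast
      show "AE x in M. (\<lambda>i. F i x) \<longlonglongrightarrow> \<phi> x" by (intro AE_I2) (simp add: F(2) sp [OF wM])
      \<comment> \<open>The approximating simple functions are bounded by twice the modulus of
        \<open>\<phi>\<close>.\<close>
      show "AE x in M. norm (F i x) \<le> 2 * B" for i
      proof (rule AE_I2)
        fix x assume "x \<in> space M"
        then have x: "x \<in> space N" using sp [OF wM] by simp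
        show "norm (F i x) \<le> 2 * B" using F(3) [OF x, of i] bound [OF x] by simp
      qed
    qed simp
  qed
  ultimately show ?thesis using LIMSEQ_unique tendsto_const by (metis (no_types, lifting) ext)
qed

lemma hilbert_on_UNIV: "hilbert_on UNIV (inner :: 'e::complex_hilbert_space \<Rightarrow> 'e \<Rightarrow> real)"
proof
  fix X :: "nat \<Rightarrow> 'e"
  assume cau: "\<And>e. e > 0 \<Longrightarrow> \<exists>N. \<forall>m\<ge>N. \<forall>n\<ge>N. inner (X m - X n) (X m - X n) < e"
  have "Cauchy X"
  proof (rule metric_CauchyI)
    fix e :: real assume "e > 0"
    then obtain N where N: "\<forall>m\<ge>N. \<forall>n\<ge>N. inner (X m - X n) (X m - X n) < e\<^sup>2" using cau [of "e\<^sup>2"] by auto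
    have "dist (X m) (X n) < e" if "m \<ge> N" "n \<ge> N" for m n
      using N that \<open>e > 0\<close> by (metis dist_norm power2_norm_eq_inner power_less_imp_less_base less_imp_le)
    then show "\<exists>M. \<forall>m\<ge>M. \<forall>n\<ge>M. dist (X m) (X n) < e" by blast
  qed
  then obtain x where "X \<longlonglongrightarrow> x" using Cauchy_convergent convergent_def by blast
  then have "(\<lambda>n. inner (X n - x) (X n - x)) \<longlonglongrightarrow> inner (x - x) (x - x)" by (intro tendsto_intros)
  then show "\<exists>x\<in>UNIV. (\<lambda>n. inner (X n - x) (X n - x)) \<longlonglongrightarrow> 0" by auto
qed (simp_all add: inner_add_left inner_add_right inner_commute)

section \<open>Fourier expansion of the Poisson kernel\<close>

text \<open>\<open>e_pow z j\<close> is the harmonic function with boundary values \<open>\<zeta> ^ j\<close> for \<open>j \<in> \<int>\<close>.\<close>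

definition e_pow :: "complex \<Rightarrow> int \<Rightarrow> complex" where
  "e_pow z j = (if 0 \<le> j then z ^ nat j else cnj z ^ nat (- j))"

lemma norm_e_pow: "cmod (e_pow z j) = cmod z ^ nat \<bar>j\<bar>"
  by (simp add: e_pow_def norm_power)

lemma e_pow_0 [simp]: "e_pow z 0 = 1"
  by (simp add: e_pow_def)

lemma e_pow_int [simp]: "e_pow z (int n) = z ^ n" "e_pow z (- int n) = cnj z ^ n"
  by (simp_all add: e_pow_def)

lemma e_pow_mult: "e_pow (z * w) j = e_pow z j * e_pow w j"
  by (simp add: e_pow_def power_mult_distrib)

lemma cnj_e_pow: "cnj (e_pow z j) = e_pow z (- j)"
  by (simp add: e_pow_def)

lemma continuous_on_e_pow [continuous_intros]:
  "continuous_on A f \<Longrightarrow> continuous_on A (\<lambda>x. e_pow (f x) j)"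
  unfolding e_pow_def by (cases "0 \<le> j") (auto intro!: continuous_intros)

lemma borel_measurable_e_pow [measurable]: "(\<lambda>z. e_pow z j) \<in> borel_measurable borel"
  by (intro borel_measurable_continuous_onI continuous_intros)

lemma e_pow_unit:
  assumes "cmod z = 1"
  shows "e_pow z j = z powi j"
  using assms by (auto simp: e_pow_def power_int_def divide_conv_cnj inverse_eq_divide)

lemma e_pow_add_unit: "cmod z = 1 \<Longrightarrow> e_pow z (j + k) = e_pow z j * e_pow z k"
  by (cases "z = 0") (auto simp: e_pow_unit power_int_add)

lemma sum_int_symmetric:
  fixes g :: "int \<Rightarrow> 'a::ab_group_add"
  shows "(\<Sum>i\<in>{- int N..int N}. g i) = (\<Sum>i\<le>N. g (int i)) + (\<Sum>i\<le>N. g (- int i)) - g 0"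
proof (induction N)
  case (Suc N)
  have "{- int (Suc N)..int (Suc N)} = insert (int (Suc N)) (insert (- int (Suc N)) {- int N..int N})" by auto
  then show ?case using Suc by (simp add: algebra_simps)
qed simp

definition poisson_partial :: "nat \<Rightarrow> complex \<Rightarrow> complex \<Rightarrow> complex" where
  "poisson_partial N z \<zeta> = (\<Sum>i\<in>{- int N..int N}. e_pow z i * e_pow \<zeta> (- i))"

lemma sum_power_nat_abs_le:
  fixes r :: real
  assumes "0 \<le> r" "r < 1"
  shows "(\<Sum>i\<in>{- int N..int N}. r ^ nat \<bar>i\<bar>) \<le> 2 / (1 - r)"
proof -
  have "(\<Sum>i\<le>N. r ^ i) \<le> (\<Sum>i. r ^ i)"
    by (rule sum_le_suminf [OF summable_geometric]) (use assms in auto)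
  also have "\<dots> = 1 / (1 - r)" by (rule suminf_geometric) (use assms in auto)
  finally show ?thesis unfolding sum_int_symmetric by simp
qed

lemma norm_poisson_partial_le:
  assumes "cmod z < 1" "cmod \<zeta> = 1"
  shows "cmod (poisson_partial N z \<zeta>) \<le> 2 / (1 - cmod z)"
proof -
  have "cmod (poisson_partial N z \<zeta>) \<le> (\<Sum>i\<in>{- int N..int N}. cmod z ^ nat \<bar>i\<bar>)"
    unfolding poisson_partial_def by (rule sum_norm_le) (simp add: norm_mult norm_e_pow assms)
  then show ?thesis using sum_power_nat_abs_le [of "cmod z" N] assms by simp
qed

text \<open>With \<open>w = z * cnj \<zeta>\<close> the symmetric sums are two geometric series
  sharing the term 1, with limit \<open>1 / (1 - w) + 1 / (1 - cnj w) - 1\<close>. This is the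
  kernel because \<open>cmod (z - \<zeta>) = cmod (1 - w)\<close> on the circle.\<close>

lemma poisson_partial_tendsto:
  assumes z: "cmod z < 1" and \<zeta>: "cmod \<zeta> = 1"
  shows "(\<lambda>N. poisson_partial N z \<zeta>) \<longlonglongrightarrow> complex_of_real (poisson_kernel z \<zeta>)"
proof -
  define w where "w = z * cnj \<zeta>"
  have w: "cmod w < 1" using z \<zeta> by (simp add: w_def norm_mult)
  have term_eq: "e_pow z i * e_pow \<zeta> (- i) = e_pow w i" for i
    by (simp add: w_def e_pow_mult cnj_e_pow [symmetric]) (simp add: e_pow_def)
  have lim: "(\<lambda>N. \<Sum>i\<le>N. u ^ i) \<longlonglongrightarrow> 1 / (1 - u)" if "cmod u < 1" for u
    using geometric_sums [OF that] by (simp add: sums_def_le)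
  have "(\<lambda>N. (\<Sum>i\<le>N. w ^ i) + (\<Sum>i\<le>N. cnj w ^ i) - 1) \<longlonglongrightarrow> 1 / (1 - w) + 1 / (1 - cnj w) - 1"
    using w by (intro tendsto_intros lim) auto
  moreover have "poisson_partial N z \<zeta> = (\<Sum>i\<le>N. w ^ i) + (\<Sum>i\<le>N. cnj w ^ i) - 1" for N
    unfolding poisson_partial_def term_eq sum_int_symmetric by simp
  moreover have "1 / (1 - w) + 1 / (1 - cnj w) - 1 = complex_of_real (poisson_kernel z \<zeta>)"
  proof -
    have ne: "1 - w \<noteq> 0" "1 - cnj w \<noteq> 0" using w by auto
    have "z - \<zeta> = - (\<zeta> * (1 - w))"
      using \<zeta> by (simp add: w_def algebra_simps flip: complex_norm_square)
    then have d: "cmod (z - \<zeta>) = cmod (1 - w)" using \<zeta> by (simp add: norm_mult)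
    have "cmod z = cmod w" using \<zeta> by (simp add: w_def norm_mult)
    then have "complex_of_real (poisson_kernel z \<zeta>) = (1 - w * cnj w) / ((1 - w) * (1 - cnj w))"
      unfolding poisson_kernel_def d
      by (simp only: of_real_divide of_real_diff of_real_1 complex_norm_square complex_cnj_diff complex_cnj_one)
    also have "\<dots> = 1 / (1 - w) + 1 / (1 - cnj w) - 1"
      using ne by (simp add: divide_simps del: complex_cnj_diff) (simp add: algebra_simps)
    finally show ?thesis by simp
  qed
  ultimately show ?thesis by simp
qed

section \<open>The sesquilinear integral of a semi-spectral measure\<close>

locale semi_spectral =
  fixes \<mu> :: "complex set \<Rightarrow> 'e::complex_hilbert_space \<Rightarrow> 'e"
  assumes semi_spectral: "semi_spectral_measure \<mu>"
begin

text \<open>Positivity of the operators makes precisely the diagonal set functions positive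
  measures; the complex measures for distinct vectors are recovered by polarization.\<close>

definition diag_measure :: "'e \<Rightarrow> complex measure" where
  "diag_measure x = measure_of unit_circle circle_sets (\<lambda>A. ennreal (Re (cinner (\<mu> A x) x)))"

lemma mu_linear: "A \<in> circle_sets \<Longrightarrow> \<mu> A (x + y) = \<mu> A x + \<mu> A y"
  and mu_scaleC: "A \<in> circle_sets \<Longrightarrow> \<mu> A (w *\<^sub>C x) = w *\<^sub>C \<mu> A x"
  and mu_bounded_linear: "A \<in> circle_sets \<Longrightarrow> bounded_linear (\<mu> A)"
  and mu_pos: "A \<in> circle_sets \<Longrightarrow> cinner (\<mu> A x) x \<in> \<real>\<^sub>\<ge>\<^sub>0"
  using semi_spectral
  by (auto simp: semi_spectral_measure_def positive_operator_def bounded_clinear_def linear_add bounded_linear.linear)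

lemma space_circle: "space (restrict_space borel unit_circle) = unit_circle"
  by (simp add: space_restrict_space)

lemma space_diag_measure [simp]: "space (diag_measure x) = unit_circle"
  unfolding diag_measure_def by (rule space_measure_of) (metis sets.space_closed space_circle)

lemma sets_diag_measure [simp, measurable_cong]: "sets (diag_measure x) = circle_sets"
  unfolding diag_measure_def by (subst sets_measure_of) (metis sets.space_closed space_circle, metis sets.sigma_sets_eq space_circle)

lemma emeasure_diag_measure: "A \<in> circle_sets \<Longrightarrow> emeasure (diag_measure x) A = ennreal (Re (cinner (\<mu> A x) x))"
proof (rule emeasure_measure_of [OF diag_measure_def])
  let ?f = "\<lambda>A. ennreal (Re (cinner (\<mu> A x) x))"
  have cbm: "complex_borel_measure (\<lambda>A. cinner (\<mu> A x) x)"
    using semi_spectral by (simp add: semi_spectral_measure_def regular_complex_borel_measure_def)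
  have pos: "0 \<le> Re (cinner (\<mu> A x) x)" if "A \<in> circle_sets" for A
    using mu_pos [OF that] by (simp add: complex_nonneg_Reals_iff)
  have ca: "(\<lambda>n. Re (cinner (\<mu> (A n) x) x)) sums Re (cinner (\<mu> (\<Union>n. A n) x) x)"
    if "range A \<subseteq> circle_sets" "disjoint_family A" for A :: "nat \<Rightarrow> complex set"
    using cbm that unfolding complex_borel_measure_def by (intro sums_Re) blast
  show "positive (sets (diag_measure x)) ?f"
  proof -
    \<comment> \<open>Countable additivity for empty sets makes a constant series converge, so its
      term is zero.\<close>
    have "(\<lambda>n. Re (cinner (\<mu> {} x) x)) sums Re (cinner (\<mu> {} x) x)"
      using ca [of "\<lambda>_. {}"] by (simp add: disjoint_family_on_def)
    then have "(\<lambda>n::nat. Re (cinner (\<mu> {} x) x)) \<longlonglongrightarrow> 0" by (intro summable_LIMSEQ_zero sums_summable)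
    then show ?thesis by (simp add: positive_def LIMSEQ_const_iff)
  qed
  show "countably_additive (sets (diag_measure x)) ?f"
  proof (rule countably_additiveI)
    fix A :: "nat \<Rightarrow> complex set"
    assume A: "range A \<subseteq> sets (diag_measure x)" "disjoint_family A"
    then have s: "(\<lambda>n. Re (cinner (\<mu> (A n) x) x)) sums Re (cinner (\<mu> (\<Union>n. A n) x) x)" using ca by simp
    have "(\<Sum>i. ?f (A i)) = ennreal (\<Sum>i. Re (cinner (\<mu> (A i) x) x))"
      by (rule suminf_ennreal2) (use A pos s sums_summable in auto)
    then show "(\<Sum>i. ?f (A i)) = ?f (\<Union>i. A i)" using sums_unique [OF s] by simp
  qed
qed (auto simp: sets.space_closed [of "restrict_space borel unit_circle", unfolded space_circle] dest: sets.sets_into_space)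

lemma measure_diag_measure: "A \<in> circle_sets \<Longrightarrow> complex_of_real (measure (diag_measure x) A) = cinner (\<mu> A x) x"
  using mu_pos [of A x] emeasure_diag_measure [of A x]
  by (simp add: measure_def complex_nonneg_Reals_iff complex_eq_iff)

lemma circle_in_sets: "unit_circle \<in> circle_sets"
  using sets.top [of "restrict_space borel unit_circle"] by (simp only: space_circle)

lemma finite_diag_measure [simp]: "finite_measure (diag_measure x)"
  by (rule finite_measureI) (simp add: emeasure_diag_measure circle_in_sets)

text \<open>The integral of \<open>\<phi>\<close> against the complex measure
  \<open>cinner (\<mu> A x) y\<close>. Halving the vectors absorbs the factor 1/4 of the
  polarization formula, leaving the coefficients 1, -1, \<open>\<i>\<close> and
  \<open>- \<i>\<close> of a decomposition into four positive measures.\<close>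

definition S :: "(complex \<Rightarrow> complex) \<Rightarrow> 'e \<Rightarrow> 'e \<Rightarrow> complex" where
  "S \<phi> x y = (LINT \<zeta>|diag_measure ((1/2) *\<^sub>C (x + y)). \<phi> \<zeta>) - (LINT \<zeta>|diag_measure ((1/2) *\<^sub>C (x - y)). \<phi> \<zeta>) +
     \<i> * ((LINT \<zeta>|diag_measure ((1/2) *\<^sub>C (x + \<i> *\<^sub>C y)). \<phi> \<zeta>) - (LINT \<zeta>|diag_measure ((1/2) *\<^sub>C (x - \<i> *\<^sub>C y)). \<phi> \<zeta>))"

lemma polarization:
  assumes "A \<in> circle_sets"
  shows "cinner (\<mu> A x) y =
     complex_of_real (measure (diag_measure ((1/2) *\<^sub>C (x + y))) A) - measure (diag_measure ((1/2) *\<^sub>C (x - y))) A +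
     \<i> * (complex_of_real (measure (diag_measure ((1/2) *\<^sub>C (x + \<i> *\<^sub>C y))) A) - measure (diag_measure ((1/2) *\<^sub>C (x - \<i> *\<^sub>C y))) A)"
proof -
  have d: "x - v = x + (-1) *\<^sub>C v" for x v :: 'e by (simp add: scaleC_minus_left)
  show ?thesis
    unfolding measure_diag_measure [OF assms] d
    by (simp add: mu_linear [OF assms] mu_scaleC [OF assms] cinner_add_left cinner_add_right
        cinner_scaleC_left cinner_scaleC_right algebra_simps flip: scaleC_minus_left)
qed

definition bdd_borel :: "(complex \<Rightarrow> complex) \<Rightarrow> bool" where
  "bdd_borel \<phi> \<longleftrightarrow> \<phi> \<in> borel_measurable borel \<and> (\<exists>B. \<forall>\<zeta>\<in>unit_circle. cmod (\<phi> \<zeta>) \<le> B)"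

lemma bdd_borel_measurable: "bdd_borel \<phi> \<Longrightarrow> \<phi> \<in> borel_measurable (restrict_space borel unit_circle)"
  by (simp add: bdd_borel_def measurable_restrict_space1)

lemma bdd_borel_measurable_diag_measure: "bdd_borel \<phi> \<Longrightarrow> \<phi> \<in> borel_measurable (diag_measure x)"
  using bdd_borel_measurable measurable_cong_sets [OF sets_diag_measure refl] by blast

lemma signed_diag_measure:
  fixes xs :: "(complex \<times> 'e) list"
  assumes "bdd_borel \<phi>"
    and "\<And>A. A \<in> circle_sets \<Longrightarrow> (\<Sum>(w, v)\<leftarrow>xs. w * measure (diag_measure v) A) = 0"
  shows "(\<Sum>(w, v)\<leftarrow>xs. w * (LINT \<zeta>|diag_measure v. \<phi> \<zeta>)) = 0"
proof -
  obtain B where B: "\<And>\<zeta>. \<zeta> \<in> unit_circle \<Longrightarrow> cmod (\<phi> \<zeta>) \<le> B"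
    using assms(1) unfolding bdd_borel_def by blast
  have "(\<Sum>(w, M)\<leftarrow>map (\<lambda>(w, v). (w, diag_measure v)) xs. w * (LINT x|M. \<phi> x)) = 0"
    by (rule signed_integral_eq_0 [where N = "restrict_space borel unit_circle" and B = B])
       (use assms bdd_borel_measurable B space_circle in \<open>auto simp: case_prod_unfold comp_def\<close>)
  then show ?thesis by (simp add: case_prod_unfold comp_def)
qed

text \<open>Weighted lists allow relations between several polarized measures to be concatenated
  into one signed combination of diagonal measures.\<close>

definition polar_list :: "complex \<Rightarrow> 'e \<Rightarrow> 'e \<Rightarrow> (complex \<times> 'e) list" where
  "polar_list w x y = [(w, (1/2) *\<^sub>C (x + y)), (- w, (1/2) *\<^sub>C (x - y)),
     (w * \<i>, (1/2) *\<^sub>C (x + \<i> *\<^sub>C y)), (- w * \<i>, (1/2) *\<^sub>C (x - \<i> *\<^sub>C y))]"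

lemma polar_list_S: "(\<Sum>(w, v)\<leftarrow>polar_list w x y. w * (LINT \<zeta>|diag_measure v. \<phi> \<zeta>)) = w * S \<phi> x y"
  by (simp add: polar_list_def S_def algebra_simps)

lemma polar_list_mu: "A \<in> circle_sets \<Longrightarrow> (\<Sum>(w, v)\<leftarrow>polar_list w x y. w * measure (diag_measure v) A) = w * cinner (\<mu> A x) y"
  by (subst polarization) (simp_all add: polar_list_def algebra_simps)

text \<open>Polarization rewrites the relation in terms of diagonal measures, where vanishing on
  sets implies vanishing of integrals. Additivity and homogeneity of \<open>S\<close> in both
  arguments are instances with two or three terms.\<close>

lemma S_relation:
  assumes "bdd_borel \<phi>"
    and zero: "\<And>A. A \<in> circle_sets \<Longrightarrow> (\<Sum>(w, x, y)\<leftarrow>zs. w * cinner (\<mu> A x) y) = 0"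
  shows "(\<Sum>(w, x, y)\<leftarrow>zs. w * S \<phi> x y) = 0"
proof -
  have "(\<Sum>(w, v)\<leftarrow>concat (map (\<lambda>(w, x, y). polar_list w x y) zs). w * (LINT \<zeta>|diag_measure v. \<phi> \<zeta>)) = 0"
  proof (rule signed_diag_measure [OF assms(1)])
    fix A assume A: "A \<in> circle_sets"
    have "(\<Sum>(w, v)\<leftarrow>concat (map (\<lambda>(w, x, y). polar_list w x y) zs). w * measure (diag_measure v) A) =
      (\<Sum>(w, x, y)\<leftarrow>zs. w * cinner (\<mu> A x) y)"
      by (induction zs) (auto simp only: list.map concat.simps map_append sum_list_append polar_list_mu [OF A] prod.case sum_list.Cons sum_list.Nil)
    then show "(\<Sum>(w, v)\<leftarrow>concat (map (\<lambda>(w, x, y). polar_list w x y) zs). w * measure (diag_measure v) A) = 0" using zero [OF A] by simp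
  qed
  moreover have "(\<Sum>(w, v)\<leftarrow>concat (map (\<lambda>(w, x, y). polar_list w x y) zs). w * (LINT \<zeta>|diag_measure v. \<phi> \<zeta>)) =
      (\<Sum>(w, x, y)\<leftarrow>zs. w * S \<phi> x y)"
    by (induction zs) (auto simp only: list.map concat.simps map_append sum_list_append polar_list_S prod.case sum_list.Cons sum_list.Nil)
  ultimately show ?thesis by simp
qed

lemma S_add_left: "bdd_borel \<phi> \<Longrightarrow> S \<phi> (x + x') y = S \<phi> x y + S \<phi> x' y"
  using S_relation [of \<phi> "[(1, x + x', y), (-1, x, y), (-1, x', y)]"]
  by (simp add: mu_linear cinner_add_left algebra_simps eq_neg_iff_add_eq_0)

lemma S_add_right: "bdd_borel \<phi> \<Longrightarrow> S \<phi> x (y + y') = S \<phi> x y + S \<phi> x y'"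
  using S_relation [of \<phi> "[(1, x, y + y'), (-1, x, y), (-1, x, y')]"]
  by (simp add: cinner_add_right algebra_simps eq_neg_iff_add_eq_0)

lemma S_scaleC_left: "bdd_borel \<phi> \<Longrightarrow> S \<phi> (w *\<^sub>C x) y = w * S \<phi> x y"
  using S_relation [of \<phi> "[(1, w *\<^sub>C x, y), (- w, x, y)]"]
  by (simp add: mu_scaleC cinner_scaleC_left)

lemma S_scaleC_right: "bdd_borel \<phi> \<Longrightarrow> S \<phi> x (w *\<^sub>C y) = cnj w * S \<phi> x y"
  using S_relation [of \<phi> "[(1, x, w *\<^sub>C y), (- cnj w, x, y)]"]
  by (simp add: cinner_scaleC_right)

lemma S_diag:
  assumes "bdd_borel \<phi>"
  shows "S \<phi> x x = (LINT \<zeta>|diag_measure x. \<phi> \<zeta>)"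
proof -
  have "(\<Sum>(w, v)\<leftarrow>polar_list 1 x x @ [(-1, x)]. w * (LINT \<zeta>|diag_measure v. \<phi> \<zeta>)) = 0"
    by (rule signed_diag_measure [OF assms]) (simp only: map_append sum_list_append polar_list_mu, simp add: measure_diag_measure)
  then show ?thesis by (simp only: map_append sum_list_append polar_list_S) simp
qed

lemma diag_measure_integral_bound:
  assumes "bdd_borel \<phi>" and B: "\<And>\<zeta>. \<zeta> \<in> unit_circle \<Longrightarrow> cmod (\<phi> \<zeta>) \<le> B"
  shows "cmod (LINT \<zeta>|diag_measure x. \<phi> \<zeta>) \<le> B * onorm (\<mu> unit_circle) * (norm x)\<^sup>2"
proof -
  interpret finite_measure "diag_measure x" by simp
  have B0: "0 \<le> B" by (rule order_trans [OF norm_ge_zero B [of 1]]) simp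
  have "cmod (LINT \<zeta>|diag_measure x. \<phi> \<zeta>) \<le> (LINT \<zeta>|diag_measure x. B)"
    by (rule Bochner_Integration.integral_norm_bound_integral)
       (use integrable_bounded [OF finite_diag_measure bdd_borel_measurable_diag_measure [OF assms(1)]] B in auto)
  then have 1: "cmod (LINT \<zeta>|diag_measure x. \<phi> \<zeta>) \<le> B * measure (diag_measure x) unit_circle" by (simp add: mult.commute)
  have "measure (diag_measure x) unit_circle = Re (cinner (\<mu> unit_circle x) x)"
    using measure_diag_measure [OF circle_in_sets, of x] by (metis Re_complex_of_real)
  also have "\<dots> \<le> norm (\<mu> unit_circle x) * norm x"
    using norm_cinner_le complex_Re_le_cmod order_trans by blast
  also have "\<dots> \<le> (onorm (\<mu> unit_circle) * norm x) * norm x"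
    by (intro mult_right_mono onorm mu_bounded_linear circle_in_sets) simp
  finally have "B * measure (diag_measure x) unit_circle \<le> B * ((onorm (\<mu> unit_circle) * norm x) * norm x)"
    using B0 by (rule mult_left_mono)
  with 1 show ?thesis by (simp add: power2_eq_square mult_ac)
qed

definition K :: real where "K = 2 * onorm (\<mu> unit_circle)"

lemma K_nonneg: "0 \<le> K"
  by (simp add: K_def onorm_pos_le mu_bounded_linear circle_in_sets)

text \<open>The parallelogram law bounds the four polarized integrals by a multiple of the sum of
  the squared norms. Rescaling to unit vectors yields the product, at the price of the factor 2 in
  \<open>K\<close>.\<close>

lemma norm_S_le:
  assumes "bdd_borel \<phi>" and B: "\<And>\<zeta>. \<zeta> \<in> unit_circle \<Longrightarrow> cmod (\<phi> \<zeta>) \<le> B"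
  shows "cmod (S \<phi> x y) \<le> B * K * (norm x * norm y)"
proof -
  define k where "k = B * onorm (\<mu> unit_circle)"
  have sq: "cmod (S \<phi> x y) \<le> k * ((norm x)\<^sup>2 + (norm y)\<^sup>2)" for x y
  proof -
    have M: "cmod (LINT \<zeta>|diag_measure v. \<phi> \<zeta>) \<le> k * (norm v)\<^sup>2" for v
      unfolding k_def by (rule diag_measure_integral_bound [OF assms])
    have tri: "cmod (a - b + \<i> * (c - d)) \<le> cmod a + cmod b + (cmod c + cmod d)" for a b c d
      using norm_triangle_ineq [of "a - b" "\<i> * (c - d)"] norm_triangle_ineq4 [of a b] norm_triangle_ineq4 [of c d]
      by (simp add: norm_mult)
    have "cmod (S \<phi> x y) \<le> k * (norm ((1/2) *\<^sub>C (x + y)))\<^sup>2 + k * (norm ((1/2) *\<^sub>C (x - y)))\<^sup>2 +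
       (k * (norm ((1/2) *\<^sub>C (x + \<i> *\<^sub>C y)))\<^sup>2 + k * (norm ((1/2) *\<^sub>C (x - \<i> *\<^sub>C y)))\<^sup>2)"
      unfolding S_def by (intro order_trans [OF tri] add_mono M)
    also have "\<dots> = k / 4 * ((norm (x + y))\<^sup>2 + (norm (x - y))\<^sup>2 + ((norm (x + \<i> *\<^sub>C y))\<^sup>2 + (norm (x - \<i> *\<^sub>C y))\<^sup>2))"
      by (simp add: power_mult_distrib algebra_simps power2_eq_square)
    also have "\<dots> = k * ((norm x)\<^sup>2 + (norm y)\<^sup>2)"
    proof -
      have par: "(norm (x + y))\<^sup>2 + (norm (x - y))\<^sup>2 = 2 * (norm x)\<^sup>2 + 2 * (norm y)\<^sup>2" for y :: 'e
        by (simp add: power2_norm_eq_inner inner_add_left inner_add_right inner_diff_left inner_diff_right)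
      show ?thesis unfolding par by simp
    qed
    finally show ?thesis .
  qed
  show ?thesis
  proof (cases "x = 0 \<or> y = 0")
    case True
    then have "S \<phi> x y = 0" using S_scaleC_left [OF assms(1), of 0 0 y] S_scaleC_right [OF assms(1), of x 0 0] by auto
    moreover have "0 \<le> B" by (rule order_trans [OF norm_ge_zero B [of 1]]) simp
    ultimately show ?thesis using K_nonneg by simp
  next
    case False
    define u where "u = complex_of_real (1 / norm x) *\<^sub>C x"
    define v where "v = complex_of_real (1 / norm y) *\<^sub>C y"
    have uv: "norm u = 1" "norm v = 1" using False by (auto simp: u_def v_def norm_divide)
    have x: "x = complex_of_real (norm x) *\<^sub>C u" "y = complex_of_real (norm y) *\<^sub>C v"
      using False by (auto simp: u_def v_def scaleC_scaleC)
    have "S \<phi> x y = norm x * norm y * S \<phi> u v"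
      by (subst x, subst x(2)) (simp add: S_scaleC_left [OF assms(1)] S_scaleC_right [OF assms(1)])
    then have "cmod (S \<phi> x y) = norm x * norm y * cmod (S \<phi> u v)" by (simp add: norm_mult)
    also have "\<dots> \<le> norm x * norm y * (k * 2)" using sq [of u v] uv by (intro mult_left_mono) auto
    finally show ?thesis by (simp add: k_def K_def mult_ac)
  qed
qed

lemma bdd_borel_e_pow: "bdd_borel (\<lambda>\<zeta>. e_pow \<zeta> j)"
  unfolding bdd_borel_def by (auto intro!: exI [of _ 1] simp: norm_e_pow)

lemma bdd_borel_scale: "bdd_borel \<phi> \<Longrightarrow> bdd_borel (\<lambda>\<zeta>. w * \<phi> \<zeta>)"
  unfolding bdd_borel_def by (auto simp: norm_mult intro!: exI [of _ "cmod w * _"] mult_left_mono)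

lemma bdd_borel_sum:
  assumes "finite I" "\<And>i. i \<in> I \<Longrightarrow> bdd_borel (\<phi> i)"
  shows "bdd_borel (\<lambda>\<zeta>. \<Sum>i\<in>I. \<phi> i \<zeta>)"
proof -
  have "\<forall>i\<in>I. \<exists>B. \<forall>\<zeta>\<in>unit_circle. cmod (\<phi> i \<zeta>) \<le> B" using assms by (auto simp: bdd_borel_def)
  then obtain B where B: "\<And>i \<zeta>. \<lbrakk>i \<in> I; \<zeta> \<in> unit_circle\<rbrakk> \<Longrightarrow> cmod (\<phi> i \<zeta>) \<le> B i" by metis
  have "cmod (\<Sum>i\<in>I. \<phi> i \<zeta>) \<le> (\<Sum>i\<in>I. B i)" if "\<zeta> \<in> unit_circle" for \<zeta>
    using B that by (intro sum_norm_le) auto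
  then have "\<exists>B. \<forall>\<zeta>\<in>unit_circle. cmod (\<Sum>i\<in>I. \<phi> i \<zeta>) \<le> B" by blast
  moreover have "(\<lambda>\<zeta>. \<Sum>i\<in>I. \<phi> i \<zeta>) \<in> borel_measurable borel"
    using assms(2) by (intro borel_measurable_sum) (simp add: bdd_borel_def)
  ultimately show ?thesis by (simp add: bdd_borel_def)
qed

lemma diag_measure_integrable: "bdd_borel \<phi> \<Longrightarrow> integrable (diag_measure x) \<phi>"
  using integrable_bounded [OF finite_diag_measure bdd_borel_measurable_diag_measure] bdd_borel_def by (metis space_diag_measure)

lemma S_scale: "S (\<lambda>\<zeta>. w * \<phi> \<zeta>) x y = w * S \<phi> x y"
  by (simp add: S_def algebra_simps)

lemma S_sum:
  assumes "\<And>i. i \<in> I \<Longrightarrow> bdd_borel (\<phi> i)"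
  shows "S (\<lambda>\<zeta>. \<Sum>i\<in>I. \<phi> i \<zeta>) x y = (\<Sum>i\<in>I. S (\<phi> i) x y)"
  using assms by (simp add: S_def diag_measure_integrable sum.distrib sum_subtractf flip: sum_distrib_left)

lemma tendsto_S:
  assumes "\<And>N. bdd_borel (\<phi> N)" "bdd_borel \<psi>" "\<And>N \<zeta>. \<zeta> \<in> unit_circle \<Longrightarrow> cmod (\<phi> N \<zeta>) \<le> B"
    and "\<And>\<zeta>. \<zeta> \<in> unit_circle \<Longrightarrow> (\<lambda>N. \<phi> N \<zeta>) \<longlonglongrightarrow> \<psi> \<zeta>"
  shows "(\<lambda>N. S (\<phi> N) x y) \<longlonglongrightarrow> S \<psi> x y"
proof -
  have "(\<lambda>N. LINT \<zeta>|diag_measure v. \<phi> N \<zeta>) \<longlonglongrightarrow> (LINT \<zeta>|diag_measure v. \<psi> \<zeta>)" for v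
  proof -
    interpret finite_measure "diag_measure v" by simp
    show ?thesis
      by (rule integral_dominated_convergence [where w = "\<lambda>_. B"])
         (use assms bdd_borel_measurable_diag_measure in auto)
  qed
  then show ?thesis unfolding S_def by (intro tendsto_intros)
qed

definition moment :: "int \<Rightarrow> 'e \<Rightarrow> 'e \<Rightarrow> complex" where
  "moment j = S (\<lambda>\<zeta>. e_pow \<zeta> j)"

sublocale toeplitz moment K
  by standard
     (simp_all add: moment_def S_add_left S_add_right S_scaleC_left S_scaleC_right bdd_borel_e_pow K_nonneg
        norm_S_le [of _ 1, simplified] norm_e_pow)

lemma bdd_borel_poisson_partial: "bdd_borel (poisson_partial N z)"
  unfolding poisson_partial_def [abs_def] by (intro bdd_borel_sum bdd_borel_scale bdd_borel_e_pow) simp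

lemma S_poisson_partial: "S (poisson_partial N z) x y = (\<Sum>i\<in>{- int N..int N}. e_pow z i * moment (- i) x y)"
  unfolding poisson_partial_def [abs_def] moment_def S_scale [symmetric]
  by (rule S_sum) (intro bdd_borel_scale bdd_borel_e_pow)

lemma borel_measurable_poisson_kernel [measurable]: "poisson_kernel z \<in> borel_measurable borel"
  unfolding poisson_kernel_def [abs_def] by measurable

lemma norm_poisson_kernel_le:
  assumes "cmod z < 1" "\<zeta> \<in> unit_circle"
  shows "\<bar>poisson_kernel z \<zeta>\<bar> \<le> 2 / (1 - cmod z)"
proof -
  have "(\<lambda>N. cmod (poisson_partial N z \<zeta>)) \<longlonglongrightarrow> cmod (complex_of_real (poisson_kernel z \<zeta>))"
    using assms by (intro tendsto_norm poisson_partial_tendsto) auto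
  then show ?thesis
    using tendsto_upperbound [of "\<lambda>N. cmod (poisson_partial N z \<zeta>)" _ sequentially "2 / (1 - cmod z)"]
      norm_poisson_partial_le [of z \<zeta>] assms by auto
qed

lemma bdd_borel_poisson_kernel:
  "cmod z < 1 \<Longrightarrow> bdd_borel (\<lambda>\<zeta>. complex_of_real (poisson_kernel z \<zeta>))"
  unfolding bdd_borel_def using norm_poisson_kernel_le [of z]
  by (intro conjI exI [of _ "2 / (1 - cmod z)"]) (simp_all del: mem_sphere)

abbreviation PS :: "complex \<Rightarrow> 'e \<Rightarrow> 'e \<Rightarrow> complex" where
  "PS z \<equiv> S (\<lambda>\<zeta>. complex_of_real (poisson_kernel z \<zeta>))"

lemma tendsto_S_poisson_partial:
  assumes "cmod z < 1"
  shows "(\<lambda>N. S (poisson_partial N z) x y) \<longlonglongrightarrow> PS z x y"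
  by (rule tendsto_S [where B = "2 / (1 - cmod z)"])
     (use assms norm_poisson_partial_le poisson_partial_tendsto bdd_borel_poisson_partial bdd_borel_poisson_kernel in auto)

lemma norm_PS_le: "cmod z < 1 \<Longrightarrow> cmod (PS z x y) \<le> 2 / (1 - cmod z) * K * (norm x * norm y)"
  by (rule norm_S_le) (simp_all add: bdd_borel_poisson_kernel norm_poisson_kernel_le del: mem_sphere)

text \<open>Riesz representation over the reals is applied to the real part of
  \<open>PS z x\<close>; the imaginary part is the real part at \<open>\<i> *\<^sub>C y\<close>, so
  the same vector represents the whole form.\<close>

lemma PS_exists:
  assumes z: "cmod z < 1"
  shows "\<exists>P. bounded_clinear P \<and> (\<forall>x y. cinner (P x) y = PS z x y)"
proof -
  interpret H: hilbert_on "UNIV :: 'e set" inner by (rule hilbert_on_UNIV)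
  note b = bdd_borel_poisson_kernel [OF z]
  define C where "C = 2 / (1 - cmod z) * K"
  have C: "cmod (PS z x y) \<le> C * norm x * norm y" for x y
    using norm_PS_le [OF z, of x y] by (simp add: C_def mult.assoc)
  have "\<exists>h. \<forall>y. Re (PS z x y) = inner y h" for x
  proof -
    have "\<exists>h\<in>UNIV. \<forall>y\<in>UNIV. Re (PS z x y) = inner y h"
    proof (rule H.riesz)
      show "(Re (PS z x u))\<^sup>2 \<le> (C * norm x)\<^sup>2 * inner u u" for u
      proof -
        have "\<bar>Re (PS z x u)\<bar> \<le> C * norm x * norm u" using C abs_Re_le_cmod order_trans by blast
        then have "\<bar>Re (PS z x u)\<bar>\<^sup>2 \<le> (C * norm x * norm u)\<^sup>2" by (rule power_mono) simp
        then show ?thesis by (simp add: power_mult_distrib power2_norm_eq_inner)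
      qed
    qed (simp_all add: S_add_right [OF b] scaleR_conv_scaleC S_scaleC_right [OF b])
    then show ?thesis by blast
  qed
  then obtain P where P: "\<And>x y. Re (PS z x y) = inner y (P x)" by metis
  have eq: "cinner (P x) y = PS z x y" for x y
    using P [of x y] P [of x "\<i> *\<^sub>C y"]
    by (simp add: cinner_eq_Complex complex_eq_iff inner_commute S_scaleC_right [OF b])
  have "P (x + y) = P x + P y" for x y
    by (rule cinner_ext) (simp add: eq cinner_add_left S_add_left [OF b])
  moreover have sc: "P (w *\<^sub>C x) = w *\<^sub>C P x" for w x
    by (rule cinner_ext) (simp add: eq cinner_scaleC_left S_scaleC_left [OF b])
  moreover have "norm (P x) \<le> norm x * C" for x
  proof (cases "P x = 0")
    case True
    have "0 \<le> C" using z K_nonneg by (simp add: C_def)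
    then show ?thesis using True by simp
  next
    case False
    have "norm (P x) * norm (P x) = cmod (cinner (P x) (P x))" unfolding cinner_self norm_of_real by (simp add: power2_eq_square)
    also have "\<dots> \<le> C * norm x * norm (P x)" unfolding eq by (rule C)
    finally show ?thesis using False by (simp add: mult.commute)
  qed
  ultimately have "bounded_clinear P"
    unfolding bounded_clinear_def by (auto intro!: bounded_linear_intro [of _ C] simp: scaleR_conv_scaleC)
  then show ?thesis using eq by blast
qed

text \<open>Subtracting the polarized diagonal measures from any admissible decomposition leaves a
  combination that vanishes on every set, so the value is forced. Conversely, polarization is itself
  an admissible decomposition. This makes the description in \<open>poisson_integral\<close>
  determinate.\<close>

lemma has_complex_measure_integral_PS:
  assumes z: "cmod z < 1"
  shows "has_complex_measure_integral (\<lambda>A. cinner (\<mu> A x) y) (poisson_kernel z) I \<longleftrightarrow> I = PS z x y"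
proof -
  have int: "integrable (diag_measure v) (poisson_kernel z)" for v
    using diag_measure_integrable [OF bdd_borel_poisson_kernel [OF z]] by (simp add: complex_of_real_integrable_eq)
  have re: "(LINT \<zeta>|diag_measure v. complex_of_real (poisson_kernel z \<zeta>)) = complex_of_real (LINT \<zeta>|diag_measure v. poisson_kernel z \<zeta>)" for v
    by (rule integral_complex_of_real)
  show ?thesis
  proof
    assume "has_complex_measure_integral (\<lambda>A. cinner (\<mu> A x) y) (poisson_kernel z) I"
    then obtain M1 M2 M3 M4 where M: "\<And>M. M \<in> {M1, M2, M3, M4} \<Longrightarrow> finite_measure M \<and> sets M = circle_sets \<and> integrable M (poisson_kernel z)"
      and nu: "\<And>A. A \<in> circle_sets \<Longrightarrow> cinner (\<mu> A x) y = Complex (measure M1 A - measure M2 A) (measure M3 A - measure M4 A)"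
      and I: "I = Complex ((LINT \<zeta>|M1. poisson_kernel z \<zeta>) - (LINT \<zeta>|M2. poisson_kernel z \<zeta>))
                    ((LINT \<zeta>|M3. poisson_kernel z \<zeta>) - (LINT \<zeta>|M4. poisson_kernel z \<zeta>))"
      unfolding has_complex_measure_integral_def by blast
    let ?xs = "[(1, M1), (-1, M2), (\<i>, M3), (- \<i>, M4)] @ map (\<lambda>(w, v). (w, diag_measure v)) (polar_list (-1) x y)"
    have "(\<Sum>(w, M)\<leftarrow>?xs. w * (LINT \<zeta>|M. complex_of_real (poisson_kernel z \<zeta>))) = 0"
    proof (rule signed_integral_eq_0 [where N = "restrict_space borel unit_circle" and B = "2 / (1 - cmod z)"])
      show "finite_measure M \<and> sets M = circle_sets" if "(w, M) \<in> set ?xs" for w M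
        using that M by auto
      show "(\<Sum>(w, M)\<leftarrow>?xs. w * complex_of_real (measure M A)) = 0" if A: "A \<in> circle_sets" for A
      proof -
        have "(\<Sum>(w, M)\<leftarrow>map (\<lambda>(w, v). (w, diag_measure v)) (polar_list (-1) x y). w * complex_of_real (measure M A)) = - cinner (\<mu> A x) y"
          using polar_list_mu [OF A, of "-1" x y] by (simp add: case_prod_unfold comp_def)
        then show ?thesis using nu [OF A] by (simp only: map_append sum_list_append) (simp add: complex_eq_iff)
      qed
      show "(\<lambda>\<zeta>. complex_of_real (poisson_kernel z \<zeta>)) \<in> borel_measurable (restrict_space borel unit_circle)"
        by (rule bdd_borel_measurable [OF bdd_borel_poisson_kernel [OF z]])
      show "cmod (complex_of_real (poisson_kernel z \<zeta>)) \<le> 2 / (1 - cmod z)" if "\<zeta> \<in> space (restrict_space borel unit_circle)" for \<zeta>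
        using norm_poisson_kernel_le [OF z] that space_circle by simp
    qed
    moreover have "(\<Sum>(w, M)\<leftarrow>map (\<lambda>(w, v). (w, diag_measure v)) (polar_list (-1) x y). w * (LINT \<zeta>|M. complex_of_real (poisson_kernel z \<zeta>))) = - PS z x y"
      using polar_list_S [where w = "-1" and x = x and y = y and \<phi> = "\<lambda>\<zeta>. complex_of_real (poisson_kernel z \<zeta>)"]
      by (simp add: case_prod_unfold comp_def)
    ultimately show "I = PS z x y"
      unfolding I by (simp only: map_append sum_list_append) (simp add: complex_eq_iff)
  next
    assume I: "I = PS z x y"
    show "has_complex_measure_integral (\<lambda>A. cinner (\<mu> A x) y) (poisson_kernel z) I"
      unfolding has_complex_measure_integral_def
    proof (intro exI conjI)
      show "\<forall>M\<in>{diag_measure ((1/2) *\<^sub>C (x + y)), diag_measure ((1/2) *\<^sub>C (x - y)), diag_measure ((1/2) *\<^sub>C (x + \<i> *\<^sub>C y)), diag_measure ((1/2) *\<^sub>C (x - \<i> *\<^sub>C y))}.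
          finite_measure M \<and> sets M = circle_sets \<and> integrable M (poisson_kernel z)"
        using int by simp
    qed (simp_all add: I S_def re polarization [of _ x y] complex_eq_iff)
  qed
qed

lemma cinner_poisson_integral:
  assumes z: "cmod z < 1"
  shows "cinner (poisson_integral \<mu> z x) y = PS z x y"
proof -
  obtain P where P: "bounded_clinear P" "\<And>x y. cinner (P x) y = PS z x y" using PS_exists [OF z] by blast
  have "poisson_integral \<mu> z = P"
    unfolding poisson_integral_def has_complex_measure_integral_PS [OF z]
  proof (rule the_equality)
    show "P' = P" if "bounded_clinear P' \<and> (\<forall>x y. cinner (P' x) y = PS z x y)" for P'
      using that P(2) by (intro ext cinner_ext) simp
  qed (use P in blast)
  then show ?thesis using P by simp
qed

lemma PS_diag_nonneg:
  assumes z: "cmod z < 1"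
  shows "0 \<le> Re (PS z x x)"
proof -
  have "Re (PS z x x) = (LINT \<zeta>|diag_measure x. poisson_kernel z \<zeta>)"
    by (simp add: S_diag [OF bdd_borel_poisson_kernel [OF z]])
  also have "\<dots> \<ge> 0"
    by (rule integral_nonneg_AE) (use z in \<open>auto simp: poisson_kernel_def power_le_one intro!: AE_I2 divide_nonneg_nonneg\<close>)
  finally show ?thesis .
qed

end

section \<open>Arc length and area\<close>

lemma cis_measurable [measurable]: "cis \<in> borel \<rightarrow>\<^sub>M restrict_space borel unit_circle"
  by (intro measurable_restrict_space2 borel_measurable_continuous_onI continuous_intros) auto

lemma sets_arc_length [measurable_cong]: "sets arc_length = circle_sets"
  by (simp add: arc_length_def)

lemma space_arc_length [simp]: "space arc_length = unit_circle"
  by (simp add: arc_length_def space_restrict_space)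

lemma prob_space_arc_length: "prob_space arc_length"
proof -
  interpret prob_space "uniform_measure lborel {0..2 * pi}" by (rule prob_space_uniform_measure) simp_all
  show ?thesis unfolding arc_length_def by (rule prob_space_distr) measurable
qed

lemma measurable_arc_length: "f \<in> borel_measurable borel \<Longrightarrow> f \<in> borel_measurable arc_length"
  using measurable_restrict_space1 measurable_cong_sets [OF sets_arc_length refl] by blast

lemma integrable_arc_length:
  fixes f :: "complex \<Rightarrow> 'b::{banach, second_countable_topology}"
  assumes "f \<in> borel_measurable arc_length" "\<And>\<zeta>. cmod \<zeta> = 1 \<Longrightarrow> norm (f \<zeta>) \<le> B"
  shows "integrable arc_length f"
proof -
  interpret prob_space arc_length by (rule prob_space_arc_length)
  show ?thesis by (rule integrable_const_bound [of f B]) (use assms in auto)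
qed

lemma integral_arc_length_e_pow: "(LINT \<zeta>|arc_length. e_pow \<zeta> j) = (if j = 0 then 1 else 0)"
proof -
  have "e_pow (cis x) j = exp (x *\<^sub>R (\<i> * of_int j))" for x
  proof -
    have "e_pow (cis x) j = cis (x * of_int j)"
      by (simp add: e_pow_unit cis_power_int mult.commute)
    then show ?thesis by (simp add: cis_conv_exp scaleR_conv_of_real mult_ac)
  qed
  then have "(LINT \<zeta>|arc_length. e_pow \<zeta> j) = (LINT x|uniform_measure lborel {0..2 * pi}. exp (x *\<^sub>R (\<i> * of_int j)))"
    unfolding arc_length_def by (subst integral_distr) (auto intro: measurable_restrict_space1)
  also have "uniform_measure lborel {0..2 * pi} = density lborel (\<lambda>x. ennreal (indicator {0..2 * pi} x / (2 * pi)))"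
    unfolding uniform_measure_def
    by (rule density_cong) (auto simp: indicator_def divide_ennreal[symmetric] ennreal_1[symmetric] simp del: ennreal_1)
  also have "(LINT x|density lborel (\<lambda>x. ennreal (indicator {0..2 * pi} x / (2 * pi))). exp (x *\<^sub>R (\<i> * of_int j)))
      = (LINT x|lborel. (indicator {0..2 * pi} x / (2 * pi)) *\<^sub>R exp (x *\<^sub>R (\<i> * of_int j)))"
    by (rule integral_density) (auto intro!: borel_measurable_continuous_onI continuous_intros)
  also have "\<dots> = (LINT x|lborel. (1 / (2 * pi)) *\<^sub>R (indicator {0..2 * pi} x *\<^sub>R exp (x *\<^sub>R (\<i> * of_int j))))"
    by (rule Bochner_Integration.integral_cong) simp_all
  also have "\<dots> = (1 / (2 * pi)) *\<^sub>R (LINT x|lborel. indicator {0..2 * pi} x *\<^sub>R exp (x *\<^sub>R (\<i> * of_int j)))"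
    by (rule integral_scaleR_right)
  also have "(LINT x|lborel. indicator {0..2 * pi} x *\<^sub>R exp (x *\<^sub>R (\<i> * of_int j))) = (if j = 0 then complex_of_real (2 * pi) else 0)"
  proof (cases "j = 0")
    case True
    have "(LINT x|lborel. indicator {0..2 * pi} x *\<^sub>R (1::complex)) = complex_of_real (2 * pi) - of_real 0"
      by (rule integral_FTC_Icc) (auto intro!: derivative_eq_intros has_vector_derivative_of_real continuous_intros)
    then show ?thesis using True by simp
  next
    case False
    let ?F = "\<lambda>x. exp (x *\<^sub>R (\<i> * of_int j)) / (\<i> * of_int j)"
    have "(LINT x|lborel. indicator {0..2 * pi} x *\<^sub>R exp (x *\<^sub>R (\<i> * of_int j))) = ?F (2 * pi) - ?F 0"
    proof (rule integral_FTC_Icc)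
      show "(?F has_vector_derivative exp (x *\<^sub>R (\<i> * of_int j))) (at x within {0..2 * pi})" for x
        using has_vector_derivative_divide [OF exp_scaleR_has_vector_derivative_right [of "\<i> * of_int j" x], of "\<i> * of_int j"] False
        by simp
    qed (auto intro!: continuous_intros)
    also have "exp ((2 * pi) *\<^sub>R (\<i> * of_int j)) = 1"
      using exp_integer_2pi [of "of_int j"] by (simp add: scaleR_conv_of_real mult_ac)
    finally show ?thesis using False by simp
  qed
  finally show ?thesis by (simp add: scaleR_conv_of_real)
qed

lemma sets_unit_disc [measurable]: "unit_disc \<in> sets borel"
  by simp

lemma emeasure_unit_disc: "emeasure lborel unit_disc = ennreal pi"
  by (simp add: emeasure_ball unit_ball_vol_2)

lemma sets_disc_area [simp, measurable_cong]: "sets disc_area = sets borel"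
  by (simp add: disc_area_def)

lemma space_disc_area [simp]: "space disc_area = UNIV"
  by (simp add: disc_area_def)

lemma prob_space_disc_area: "prob_space disc_area"
  unfolding disc_area_def by (rule prob_space_uniform_measure) (simp_all add: emeasure_unit_disc)

text \<open>Under the identification \<open>T\<close> of \<open>real^2\<close> with the plane a
  rotation becomes an orthogonal map, and orthogonal maps preserve Lebesgue measure.\<close>

lemma lborel_rotate:
  fixes w :: complex
  assumes w: "cmod w = 1"
  shows "distr lborel borel ((*) w) = lborel"
proof -
  define T where "T = (\<lambda>v::real^2. Complex (v $ 1) (v $ 2))"
  have T_cont: "continuous_on UNIV T" unfolding T_def by (intro continuous_intros)
  have T_meas [measurable]: "T \<in> borel_measurable borel" using T_cont by (rule borel_measurable_continuous_onI)
  have box_T: "T -` box l u = box (vector [Re l, Im l]) (vector [Re u, Im u])" for l u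
    by (auto simp: T_def box_def inner_complex_def mem_box_cart Basis_complex_def forall_2 Basis_vec_def axis_def inner_vec_def UNIV_2)
  have T_lborel: "lborel = distr lborel borel T"
  proof (rule lborel_eqI)
    fix l u :: complex assume le: "\<And>b. b \<in> Basis \<Longrightarrow> l \<bullet> b \<le> u \<bullet> b"
    then have le': "Re l \<le> Re u" "Im l \<le> Im u" using le [of 1] le [of \<i>] by (simp_all add: Basis_complex_def)
    have "emeasure (distr lborel borel T) (box l u) = emeasure lborel (box (vector [Re l, Im l]) (vector [Re u, Im u] :: real^2))"
      by (simp add: emeasure_distr box_T)
    also have "\<dots> = ennreal ((Re u - Re l) * (Im u - Im l))"
      using le' by (subst emeasure_lborel_box)
        (auto simp: Basis_vec_def UNIV_2 inner_axis axis_eq_axis prod.insert_if inner_diff_left)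
    finally show "emeasure (distr lborel borel T) (box l u) = (\<Prod>b\<in>Basis. (u - l) \<bullet> b)"
      by (simp add: Basis_complex_def)
  qed simp
  show ?thesis
  proof (rule sym, rule lborel_eqI)
    fix l u :: complex assume le: "\<And>b. b \<in> Basis \<Longrightarrow> l \<bullet> b \<le> u \<bullet> b"
    \<comment> \<open>Multiplication by \<open>cnj w\<close>, the inverse rotation: the preimage of
      a box under multiplication by \<open>w\<close> is its image under \<open>A\<close>.\<close>
    define A where "A = (\<lambda>v::real^2. vector [Re w * v $ 1 + Im w * v $ 2, Re w * v $ 2 - Im w * v $ 1] :: real^2)"
    have TA: "T (A v) = cnj w * T v" for v by (simp add: T_def A_def complex_eq_iff algebra_simps)
    have inj: "T v = T v' \<Longrightarrow> v = v'" for v v' by (auto simp: T_def vec_eq_iff forall_2)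
    have normT: "cmod (T v) = norm v" for v
      by (simp add: T_def cmod_def norm_vec_def L2_set_def UNIV_2)
    have orth: "orthogonal_transformation A"
    proof -
      have "linear A" by (rule linearI) (auto simp: A_def vec_eq_iff forall_2 algebra_simps)
      moreover have "norm (A v) = norm v" for v using w by (simp add: normT [symmetric] TA norm_mult)
      ultimately show ?thesis by (simp add: orthogonal_transformation)
    qed
    let ?B = "box (vector [Re l, Im l]) (vector [Re u, Im u]) :: (real^2) set"
    have "emeasure (distr lborel borel ((*) w)) (box l u) = emeasure lborel ((*) w -` box l u)"
      by (simp add: emeasure_distr)
    also have "\<dots> = emeasure lborel (T -` ((*) w -` box l u))"
    proof -
      have "(*) w -` box l u \<in> sets borel"
        using measurable_sets_borel [of "(*) w" borel "box l u"] by simp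
      then show ?thesis by (subst T_lborel) (simp add: emeasure_distr)
    qed
    also have "T -` ((*) w -` box l u) = A ` ?B"
    proof -
      have cw: "cnj w * w = 1" using w by (simp add: mult.commute flip: complex_norm_square)
      have "v \<in> T -` ((*) w -` box l u) \<longleftrightarrow> v \<in> A ` ?B" for v
      proof
        assume v: "v \<in> T -` ((*) w -` box l u)"
        define v' where "v' = (vector [Re (w * T v), Im (w * T v)] :: real^2)"
        have Tv': "T v' = w * T v" unfolding v'_def by (subst T_def) (simp add: complex_eq_iff)
        have "v' \<in> ?B" using v by (simp add: box_T [symmetric] Tv')
        moreover have "A v' = v" by (rule inj) (simp add: TA Tv' cw flip: mult.assoc)
        ultimately show "v \<in> A ` ?B" by blast
      next
        assume "v \<in> A ` ?B"
        then obtain v' where v': "v = A v'" "v' \<in> ?B" by blast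
        have "w * T v = T v'" unfolding v' TA using cw by (simp add: mult.commute flip: mult.assoc)
        then show "v \<in> T -` ((*) w -` box l u)" using v'(2) by (simp add: box_T [symmetric])
      qed
      then show ?thesis by blast
    qed
    also have "emeasure lborel (A ` ?B) = emeasure lborel ?B"
    proof -
      have B: "?B \<in> lmeasurable" by simp
      have "continuous_on UNIV T \<Longrightarrow> open (T -` ((*) w -` box l u))"
        by (intro open_vimage continuous_intros) auto
      then have borel: "A ` ?B \<in> sets borel"
        using T_cont \<open>T -` ((*) w -` box l u) = A ` ?B\<close> by auto
      have "measure lebesgue (A ` ?B) = measure lebesgue ?B" "A ` ?B \<in> lmeasurable"
        using measure_orthogonal_image [OF orth B] measurable_orthogonal_image [OF orth B] by auto
      then have "emeasure lebesgue (A ` ?B) = emeasure lebesgue ?B"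
        by (simp only: emeasure_eq_measure2 B)
      then show ?thesis using borel by simp
    qed
    also have "\<dots> = emeasure lborel (T -` box l u)" by (simp add: box_T)
    also have "\<dots> = emeasure lborel (box l u)" by (subst T_lborel) (simp add: emeasure_distr)
    also have "\<dots> = (\<Prod>b\<in>Basis. (u - l) \<bullet> b)" using le by (simp add: emeasure_lborel_box)
    finally show "emeasure (distr lborel borel ((*) w)) (box l u) = (\<Prod>b\<in>Basis. (u - l) \<bullet> b)" .
  qed simp
qed

lemma nn_integral_disc_area_rotate:
  assumes f [measurable]: "f \<in> borel_measurable borel" and w: "cmod w = 1"
  shows "(\<integral>\<^sup>+z. f (w * z) \<partial>disc_area) = (\<integral>\<^sup>+z. f z \<partial>disc_area)"
proof -
  have "(\<integral>\<^sup>+z. f z * indicator unit_disc z \<partial>lborel) = (\<integral>\<^sup>+z. f z * indicator unit_disc z \<partial>distr lborel borel ((*) w))"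
    by (simp only: lborel_rotate [OF w])
  also have "\<dots> = (\<integral>\<^sup>+z. f (w * z) * indicator unit_disc (w * z) \<partial>lborel)" by (subst nn_integral_distr) auto
  also have "\<dots> = (\<integral>\<^sup>+z. f (w * z) * indicator unit_disc z \<partial>lborel)"
    by (intro nn_integral_cong) (simp add: indicator_def norm_mult w)
  finally show ?thesis unfolding disc_area_def by (subst (1 2) nn_integral_uniform_measure) auto
qed

text \<open>Rotation invariance averaged over the circle, with the order of integration exchanged.
  It replaces a change to polar coordinates.\<close>

lemma nn_integral_disc_area_average:
  assumes f [measurable]: "f \<in> borel_measurable borel"
  shows "(\<integral>\<^sup>+z. f z \<partial>disc_area) = (\<integral>\<^sup>+z. (\<integral>\<^sup>+\<zeta>. f (\<zeta> * z) \<partial>arc_length) \<partial>disc_area)"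
proof -
  interpret A: prob_space arc_length by (rule prob_space_arc_length)
  interpret B: prob_space disc_area by (rule prob_space_disc_area)
  interpret pair_sigma_finite disc_area arc_length by unfold_locales
  have [measurable]: "(\<lambda>\<zeta>. \<zeta>) \<in> arc_length \<rightarrow>\<^sub>M borel" by (rule measurable_arc_length) simp
  have "(\<integral>\<^sup>+z. f z \<partial>disc_area) = (\<integral>\<^sup>+\<zeta>. (\<integral>\<^sup>+z. f z \<partial>disc_area) \<partial>arc_length)" by (simp add: A.emeasure_space_1 del: space_arc_length)
  also have "\<dots> = (\<integral>\<^sup>+\<zeta>. (\<integral>\<^sup>+z. f (\<zeta> * z) \<partial>disc_area) \<partial>arc_length)"
    by (rule nn_integral_cong) (simp add: nn_integral_disc_area_rotate)
  also have "\<dots> = (\<integral>\<^sup>+z. (\<integral>\<^sup>+\<zeta>. f (\<zeta> * z) \<partial>arc_length) \<partial>disc_area)"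
    by (rule Fubini') measurable
  finally show ?thesis .
qed

text \<open>The disc of radius \<open>sqrt x\<close> has normalized area \<open>x\<close>, so the
  distribution functions agree. This is why \<open>(cmod z)\<^sup>2\<close> is the natural radial
  variable.\<close>

lemma distr_disc_area: "distr disc_area borel (\<lambda>z. (cmod z)\<^sup>2) = uniform_measure lborel {0..1}"
proof (rule cdf_unique)
  interpret B: prob_space disc_area by (rule prob_space_disc_area)
  have m [measurable]: "(\<lambda>z. (cmod z)\<^sup>2) \<in> disc_area \<rightarrow>\<^sub>M borel" by measurable
  interpret D: prob_space "distr disc_area borel (\<lambda>z. (cmod z)\<^sup>2)" by (rule B.prob_space_distr [OF m])
  interpret U: prob_space "uniform_measure lborel {0..1::real}" by (rule prob_space_uniform_measure) simp_all
  show "real_distribution (distr disc_area borel (\<lambda>z. (cmod z)\<^sup>2))" "real_distribution (uniform_measure lborel {0..1})"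
    by (unfold_locales; simp)+
  show "cdf (distr disc_area borel (\<lambda>z. (cmod z)\<^sup>2)) = cdf (uniform_measure lborel {0..1})"
  proof
    fix x :: real
    have "cdf (distr disc_area borel (\<lambda>z. (cmod z)\<^sup>2)) x = measure lborel (unit_disc \<inter> {z. (cmod z)\<^sup>2 \<le> x}) / pi"
    proof -
      have [measurable]: "{z. (cmod z)\<^sup>2 \<le> x} \<in> sets borel" by measurable
      have "measure disc_area {z. (cmod z)\<^sup>2 \<le> x} = measure lborel (unit_disc \<inter> {z. (cmod z)\<^sup>2 \<le> x}) / measure lborel unit_disc"
        unfolding disc_area_def by (rule measure_uniform_measure) (simp_all add: emeasure_unit_disc)
      moreover have "measure lborel unit_disc = pi" by (simp add: measure_def emeasure_unit_disc)
      ultimately show ?thesis by (simp add: cdf_def measure_distr vimage_def)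
    qed
    also have "measure lborel (unit_disc \<inter> {z. (cmod z)\<^sup>2 \<le> x}) / pi = max 0 (min 1 x)"
    proof -
      consider "x < 0" | "0 \<le> x" "x < 1" | "1 \<le> x" by linarith
      then show ?thesis
      proof cases
        case 1
        then have "unit_disc \<inter> {z. (cmod z)\<^sup>2 \<le> x} = {}"
          using le_less_trans not_less zero_le_power2 by blast
        then show ?thesis using 1 by simp
      next
        case 2
        have "unit_disc \<inter> {z. (cmod z)\<^sup>2 \<le> x} = cball 0 (sqrt x)"
        proof (intro set_eqI iffI)
          fix z :: complex assume z: "z \<in> cball 0 (sqrt x)"
          then have "cmod z \<le> sqrt x" by simp
          moreover have "cmod z < 1" by (rule le_less_trans [OF \<open>cmod z \<le> sqrt x\<close>]) (use 2 in simp)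
          moreover have "(cmod z)\<^sup>2 \<le> x" using power_mono [OF \<open>cmod z \<le> sqrt x\<close>, of 2] 2 by simp
          ultimately show "z \<in> unit_disc \<inter> {z. (cmod z)\<^sup>2 \<le> x}" by simp
        qed (auto intro: real_le_rsqrt)
        then show ?thesis using 2 by (simp add: content_cball unit_ball_vol_2)
      next
        case 3
        have "(cmod z)\<^sup>2 \<le> x" if "cmod z < 1" for z
          using power_le_one [of "cmod z" 2] that 3 by simp
        then have "unit_disc \<inter> {z. (cmod z)\<^sup>2 \<le> x} = unit_disc" by auto
        then show ?thesis using 3 by (simp add: measure_def emeasure_unit_disc)
      qed
    qed
    also have "max 0 (min 1 x) = cdf (uniform_measure lborel {0..1}) x"
    proof -
      have "{0..1} \<inter> {..x} = {0..min 1 x}" by auto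
      then show ?thesis by (simp add: cdf_def)
    qed
    finally show "cdf (distr disc_area borel (\<lambda>z. (cmod z)\<^sup>2)) x = cdf (uniform_measure lborel {0..1}) x" .
  qed
qed

lemma nn_integral_disc_area_radial:
  assumes [measurable]: "h \<in> borel_measurable borel"
  shows "(\<integral>\<^sup>+z. h ((cmod z)\<^sup>2) \<partial>disc_area) = (\<integral>\<^sup>+s. h s * indicator {0..1} s \<partial>lborel)"
proof -
  have "(\<integral>\<^sup>+z. h ((cmod z)\<^sup>2) \<partial>disc_area) = (\<integral>\<^sup>+s. h s \<partial>distr disc_area borel (\<lambda>z. (cmod z)\<^sup>2))"
    by (subst nn_integral_distr) auto
  then show ?thesis unfolding distr_disc_area by (simp add: nn_integral_uniform_measure divide_ennreal_def)
qed

section \<open>Vector-valued power series\<close>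

definition ps :: "(nat \<Rightarrow> 'e::complex_hilbert_space) \<Rightarrow> complex \<Rightarrow> 'e" where
  "ps b w = (\<Sum>k. (w ^ k) *\<^sub>C b k)"

lemma ps_summable: "disc_seq b \<Longrightarrow> cmod w < 1 \<Longrightarrow> summable (\<lambda>k. norm ((w ^ k) *\<^sub>C b k))"
  using disc_seqD [of b "cmod w"] by (simp add: norm_power)

lemma ps_sums: "disc_seq b \<Longrightarrow> cmod w < 1 \<Longrightarrow> (\<lambda>k. (w ^ k) *\<^sub>C b k) sums ps b w"
  unfolding ps_def by (rule summable_sums [OF summable_norm_cancel [OF ps_summable]])

definition ps_partial :: "nat \<Rightarrow> (nat \<Rightarrow> 'e::complex_hilbert_space) \<Rightarrow> complex \<Rightarrow> 'e" where
  "ps_partial N b w = (\<Sum>k\<le>N. (w ^ k) *\<^sub>C b k)"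

lemma ps_partial_tendsto: "disc_seq b \<Longrightarrow> cmod w < 1 \<Longrightarrow> (\<lambda>N. ps_partial N b w) \<longlonglongrightarrow> ps b w"
  unfolding ps_partial_def using ps_sums by (simp add: sums_def_le)

lemma norm_ps_partial_le:
  assumes "disc_seq b" "cmod w < 1"
  shows "norm (ps_partial N b w) \<le> (\<Sum>k. cmod w ^ k * norm (b k))"
proof -
  have "norm (ps_partial N b w) \<le> (\<Sum>k\<le>N. cmod w ^ k * norm (b k))"
    unfolding ps_partial_def by (rule sum_norm_le) (simp add: norm_power)
  also have "\<dots> \<le> (\<Sum>k. cmod w ^ k * norm (b k))"
    by (rule sum_le_suminf) (use disc_seqD [OF assms(1)] assms in auto)
  finally show ?thesis .
qed

lemma (in toeplitz) c_sum_left: "c j (\<Sum>i\<in>I. f i) y = (\<Sum>i\<in>I. c j (f i) y)"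
  by (induction I rule: infinite_finite_induct) (simp_all add: c_add_left)

lemma (in toeplitz) c_sum_right: "c j x (\<Sum>i\<in>I. f i) = (\<Sum>i\<in>I. c j x (f i))"
  by (induction I rule: infinite_finite_induct) (simp_all add: c_add_right)

text \<open>Enlarging the square of indices from \<open>N\<close> to \<open>Suc N\<close> adds
  exactly the pairs with maximum \<open>Suc N\<close>.\<close>

lemma (in toeplitz) sum_W_0:
  "(\<Sum>M\<le>N. t ^ M * W 0 b b M) = Re (\<Sum>k\<le>N. \<Sum>l\<le>N. complex_of_real (t ^ max k l) * c (int k - int l) (b k) (b l))"
proof (induction N)
  case 0
  show ?case by (simp add: W_def)
next
  case (Suc N)
  let ?g = "\<lambda>k l. complex_of_real (t ^ max k l) * c (int k - int l) (b k) (b l)"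
  have "(\<Sum>k\<le>Suc N. \<Sum>l\<le>Suc N. ?g k l) =
     (\<Sum>k\<le>N. \<Sum>l\<le>N. ?g k l) + ((\<Sum>k\<le>Suc N. ?g k (Suc N)) + (\<Sum>l<Suc N. ?g (Suc N) l))"
    by (simp add: sum.distrib lessThan_Suc_atMost add_ac)
  moreover have "(\<Sum>k\<le>Suc N. ?g k (Suc N)) + (\<Sum>l<Suc N. ?g (Suc N) l) =
     complex_of_real (t ^ Suc N) * ((\<Sum>k\<le>Suc N. (k choose 0) * c (int k - int (Suc N)) (b k) (b (Suc N))) +
                   (\<Sum>l<Suc N. (l choose 0) * c (int (Suc N) - int l) (b (Suc N)) (b l)))"
  proof -
    have "?g k (Suc N) = complex_of_real (t ^ Suc N) * ((k choose 0) * c (int k - int (Suc N)) (b k) (b (Suc N)))" if "k \<in> {..Suc N}" for k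
      using that by (simp add: max_def)
    moreover have "?g (Suc N) l = complex_of_real (t ^ Suc N) * ((l choose 0) * c (int (Suc N) - int l) (b (Suc N)) (b l))" if "l \<in> {..<Suc N}" for l
      using that by (simp add: max_def)
    ultimately show ?thesis unfolding distrib_left sum_distrib_left by (intro arg_cong2 [of _ _ _ _ "(+)"] sum.cong refl)
  qed
  moreover have "Re (complex_of_real r * z) = r * Re z" for r z by simp
  ultimately have "Re (\<Sum>k\<le>Suc N. \<Sum>l\<le>Suc N. ?g k l) = Re (\<Sum>k\<le>N. \<Sum>l\<le>N. ?g k l) + t ^ Suc N * W 0 b b (Suc N)"
    unfolding W_def by (simp only: plus_complex.simps)
  then show ?case using Suc.IH by (simp only: sum.atMost_Suc)
qed

section \<open>Circle means of the Poisson quadratic form\<close>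

context semi_spectral
begin

text \<open>The partial sums of the Poisson kernel and of the power series have the same length, so that
  all Fourier coefficients of the kernel met by the product are present.\<close>

definition quad_partial :: "nat \<Rightarrow> (nat \<Rightarrow> 'e) \<Rightarrow> complex \<Rightarrow> complex" where
  "quad_partial N b w = S (poisson_partial N w) (ps_partial N b w) (ps_partial N b w)"

definition quad :: "(nat \<Rightarrow> 'e) \<Rightarrow> complex \<Rightarrow> real" where
  "quad b w = Re (PS w (ps b w) (ps b w))"

lemma quad_partial_eq:
  "quad_partial N b w = (\<Sum>i\<in>{- int N..int N}. \<Sum>k\<le>N. \<Sum>l\<le>N. e_pow w i * (w ^ k * (cnj w ^ l * moment (- i) (b k) (b l))))"
  unfolding quad_partial_def S_poisson_partial ps_partial_def c_sum_left
  unfolding c_sum_right c_scaleC_left c_scaleC_right sum_distrib_left by (simp add: mult_ac)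

lemma Re_quad_partial_borel [measurable]: "(\<lambda>w. Re (quad_partial N b w)) \<in> borel_measurable borel"
  unfolding quad_partial_eq [abs_def] by (intro borel_measurable_continuous_onI continuous_intros)

lemma quad_partial_bound:
  assumes "disc_seq b" "cmod w < 1"
  shows "cmod (quad_partial N b w) \<le> 2 / (1 - cmod w) * K * ((\<Sum>k. cmod w ^ k * norm (b k)) * (\<Sum>k. cmod w ^ k * norm (b k)))"
proof -
  have "cmod (quad_partial N b w) \<le> 2 / (1 - cmod w) * K * (norm (ps_partial N b w) * norm (ps_partial N b w))"
    unfolding quad_partial_def by (rule norm_S_le) (use bdd_borel_poisson_partial norm_poisson_partial_le assms in auto)
  also have "\<dots> \<le> 2 / (1 - cmod w) * K * ((\<Sum>k. cmod w ^ k * norm (b k)) * (\<Sum>k. cmod w ^ k * norm (b k)))"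
    using norm_ps_partial_le [OF assms] assms K_nonneg
    by (intro mult_left_mono mult_mono) (auto intro: order_trans [OF norm_ge_zero])
  finally show ?thesis .
qed

text \<open>Kernel and vectors vary together. The bound on truncated kernels is independent of
  \<open>N\<close>, so the vectors may be replaced by their limit first; only the kernel then still
  varies.\<close>

lemma quad_partial_tendsto:
  assumes b: "disc_seq b" and w: "cmod w < 1"
  shows "(\<lambda>N. quad_partial N b w) \<longlonglongrightarrow> PS w (ps b w) (ps b w)"
proof -
  let ?C = "2 / (1 - cmod w) * K" and ?g = "ps b w"
  note bb = bdd_borel_poisson_partial
  have bound: "cmod (S (poisson_partial N w) x y) \<le> ?C * (norm x * norm y)" for N x y
    by (rule norm_S_le) (use bb norm_poisson_partial_le w in auto)
  have sub: "S (poisson_partial N w) (x - x') y = S (poisson_partial N w) x y - S (poisson_partial N w) x' y"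
     "S (poisson_partial N w) y (x - x') = S (poisson_partial N w) y x - S (poisson_partial N w) y x'" for N x x' y
    using S_add_left [OF bb, of N w "x - x'" x' y] S_add_right [OF bb, of N w y "x - x'" x'] by simp_all
  have "(\<lambda>N. quad_partial N b w - S (poisson_partial N w) ?g ?g) \<longlonglongrightarrow> 0"
  proof (rule Lim_null_comparison)
    show "\<forall>\<^sub>F N in sequentially. cmod (quad_partial N b w - S (poisson_partial N w) ?g ?g) \<le>
        ?C * (norm (ps_partial N b w - ?g) * norm (ps_partial N b w)) + ?C * (norm ?g * norm (ps_partial N b w - ?g))"
    proof (rule always_eventually, rule allI)
      fix N
      have "quad_partial N b w - S (poisson_partial N w) ?g ?g =
         S (poisson_partial N w) (ps_partial N b w - ?g) (ps_partial N b w) + S (poisson_partial N w) ?g (ps_partial N b w - ?g)"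
        unfolding quad_partial_def sub by simp
      then show "cmod (quad_partial N b w - S (poisson_partial N w) ?g ?g) \<le>
        ?C * (norm (ps_partial N b w - ?g) * norm (ps_partial N b w)) + ?C * (norm ?g * norm (ps_partial N b w - ?g))"
        using norm_triangle_mono [OF bound bound] by simp
    qed
    have "(\<lambda>N. ?C * (norm (ps_partial N b w - ?g) * norm (ps_partial N b w)) + ?C * (norm ?g * norm (ps_partial N b w - ?g))) \<longlonglongrightarrow>
        ?C * (norm (?g - ?g) * norm ?g) + ?C * (norm ?g * norm (?g - ?g))"
      by (intro tendsto_intros ps_partial_tendsto b w)
    then show "(\<lambda>N. ?C * (norm (ps_partial N b w - ?g) * norm (ps_partial N b w)) + ?C * (norm ?g * norm (ps_partial N b w - ?g))) \<longlonglongrightarrow> 0"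
      by simp
  qed
  from tendsto_add [OF this tendsto_S_poisson_partial [OF w, of ?g ?g]] show ?thesis by simp
qed

lemma quad_nonneg: "cmod w < 1 \<Longrightarrow> 0 \<le> quad b w"
  by (simp add: quad_def PS_diag_nonneg)

lemma quad_borel:
  assumes b: "disc_seq b"
  shows "(\<lambda>w. indicator unit_disc w * quad b w) \<in> borel_measurable borel"
proof (rule borel_measurable_LIMSEQ_real)
  show "(\<lambda>N. indicator unit_disc w * Re (quad_partial N b w)) \<longlonglongrightarrow> indicator unit_disc w * quad b w" for w
  proof (cases "w \<in> unit_disc")
    case True
    then show ?thesis using tendsto_Re [OF quad_partial_tendsto [OF b, of w]] by (simp add: quad_def)
  qed simp
qed measurable

text \<open>Only the frequency \<open>i = l - k\<close> survives integration over the circle, and it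
  lies in the range of summation since \<open>k\<close> and \<open>l\<close> are at most
  \<open>N\<close>. There the powers of \<open>z\<close> and \<open>cnj z\<close> combine to
  \<open>((cmod z)\<^sup>2) ^ max k l\<close>, the origin of the exponent in
  \<open>q\<close>.\<close>

lemma integral_quad_partial:
  assumes z: "cmod z < 1"
  shows "(LINT \<zeta>|arc_length. Re (quad_partial N b (\<zeta> * z))) = (\<Sum>M\<le>N. ((cmod z)\<^sup>2) ^ M * W 0 b b M)"
proof -
  let ?I = "{- int N..int N}"
  let ?m = "\<lambda>i k l. e_pow z i * (z ^ k * (cnj z ^ l * moment (- i) (b k) (b l)))"
  have unit: "quad_partial N b (\<zeta> * z) = (\<Sum>k\<le>N. \<Sum>l\<le>N. \<Sum>i\<in>?I. e_pow \<zeta> (i + int k - int l) * ?m i k l)" if "cmod \<zeta> = 1" for \<zeta>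
  proof -
    have "e_pow (\<zeta> * z) i * ((\<zeta> * z) ^ k * (cnj (\<zeta> * z) ^ l * x)) = e_pow \<zeta> (i + int k - int l) * (e_pow z i * (z ^ k * (cnj z ^ l * x)))" for i k l x
    proof -
      have "e_pow \<zeta> (i + int k - int l) = e_pow \<zeta> i * \<zeta> ^ k * cnj \<zeta> ^ l"
        using e_pow_add_unit [OF that, of "i + int k" "- int l"] e_pow_add_unit [OF that, of i "int k"] by simp
      then show ?thesis by (simp add: e_pow_mult power_mult_distrib mult_ac)
    qed
    then have "quad_partial N b (\<zeta> * z) = (\<Sum>i\<in>?I. \<Sum>k\<le>N. \<Sum>l\<le>N. e_pow \<zeta> (i + int k - int l) * ?m i k l)"
      unfolding quad_partial_eq by (intro sum.cong refl)
    also have "\<dots> = (\<Sum>k\<le>N. \<Sum>i\<in>?I. \<Sum>l\<le>N. e_pow \<zeta> (i + int k - int l) * ?m i k l)" by (rule sum.swap)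
    also have "\<dots> = (\<Sum>k\<le>N. \<Sum>l\<le>N. \<Sum>i\<in>?I. e_pow \<zeta> (i + int k - int l) * ?m i k l)"
      by (intro sum.cong refl sum.swap)
    finally show ?thesis .
  qed
  have int_e: "integrable arc_length (\<lambda>\<zeta>. e_pow \<zeta> j * x)" for j x
    by (rule integrable_arc_length [where B = "cmod x"]) (auto intro!: measurable_arc_length simp: norm_mult norm_e_pow)
  have "(LINT \<zeta>|arc_length. Re (quad_partial N b (\<zeta> * z))) =
     (LINT \<zeta>|arc_length. Re (\<Sum>k\<le>N. \<Sum>l\<le>N. \<Sum>i\<in>?I. e_pow \<zeta> (i + int k - int l) * ?m i k l))"
    by (rule Bochner_Integration.integral_cong) (simp_all add: unit)
  also have "\<dots> = Re (LINT \<zeta>|arc_length. (\<Sum>k\<le>N. \<Sum>l\<le>N. \<Sum>i\<in>?I. e_pow \<zeta> (i + int k - int l) * ?m i k l))"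
    by (rule integral_Re) (intro Bochner_Integration.integrable_sum int_e)
  also have "(LINT \<zeta>|arc_length. (\<Sum>k\<le>N. \<Sum>l\<le>N. \<Sum>i\<in>?I. e_pow \<zeta> (i + int k - int l) * ?m i k l)) =
      (\<Sum>k\<le>N. \<Sum>l\<le>N. \<Sum>i\<in>?I. (if i + int k - int l = 0 then 1 else 0) * ?m i k l)"
    by (simp only: Bochner_Integration.integral_sum Bochner_Integration.integrable_sum int_e
        integral_mult_left_zero integral_arc_length_e_pow)
  also have "\<dots> = (\<Sum>k\<le>N. \<Sum>l\<le>N. complex_of_real (((cmod z)\<^sup>2) ^ max k l) * moment (int k - int l) (b k) (b l))"
  proof (intro sum.cong refl)
    fix k l assume kl: "k \<in> {..N}" "l \<in> {..N}"
    have "(\<Sum>i\<in>?I. (if i + int k - int l = 0 then 1 else 0) * ?m i k l) = (\<Sum>i\<in>?I. if i = int l - int k then ?m i k l else 0)"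
      by (intro sum.cong) auto
    also have "\<dots> = ?m (int l - int k) k l" using kl by (subst sum.delta) auto
    also have "\<dots> = complex_of_real (((cmod z)\<^sup>2) ^ max k l) * moment (int k - int l) (b k) (b l)"
    proof -
      have "e_pow z (int l - int k) * (z ^ k * cnj z ^ l) = (z * cnj z) ^ max k l"
      proof (cases "k \<le> l")
        case True
        then obtain d where "l = k + d" using le_Suc_ex by blast
        then show ?thesis by (simp add: power_add power_mult_distrib mult_ac max_def)
      next
        case False
        then obtain d where d: "k = l + d" using le_Suc_ex nat_le_linear by blast
        then have "int l - int k = - int d" by simp
        then show ?thesis using d by (simp only: e_pow_int) (simp add: power_add power_mult_distrib mult_ac max_def)
      qed
      then show ?thesis by (simp add: mult.assoc [symmetric] flip: complex_norm_square)
    qed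
    finally show "(\<Sum>i\<in>?I. (if i + int k - int l = 0 then 1 else 0) * ?m i k l) =
       complex_of_real (((cmod z)\<^sup>2) ^ max k l) * moment (int k - int l) (b k) (b l)" .
  qed
  finally show ?thesis by (simp only: sum_W_0)
qed

lemma circle_formula:
  assumes b: "disc_seq b" and z: "cmod z < 1"
  shows "integrable arc_length (\<lambda>\<zeta>. quad b (\<zeta> * z))"
    and "(LINT \<zeta>|arc_length. quad b (\<zeta> * z)) = q 0 ((cmod z)\<^sup>2) b b"
proof -
  interpret P: prob_space arc_length by (rule prob_space_arc_length)
  let ?B = "2 / (1 - cmod z) * K * ((\<Sum>k. cmod z ^ k * norm (b k)) * (\<Sum>k. cmod z ^ k * norm (b k)))"
  have cz: "cmod (\<zeta> * z) = cmod z" if "\<zeta> \<in> space arc_length" for \<zeta> using that by (simp add: norm_mult)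
  have lim: "(\<lambda>N. Re (quad_partial N b (\<zeta> * z))) \<longlonglongrightarrow> quad b (\<zeta> * z)" if "\<zeta> \<in> space arc_length" for \<zeta>
    unfolding quad_def using cz [OF that] z by (intro tendsto_Re quad_partial_tendsto b) simp
  have meas: "(\<lambda>\<zeta>. Re (quad_partial N b (\<zeta> * z))) \<in> borel_measurable arc_length" for N
    by (rule measurable_arc_length) measurable
  have meas': "(\<lambda>\<zeta>. quad b (\<zeta> * z)) \<in> borel_measurable arc_length"
    by (rule borel_measurable_LIMSEQ_real [OF lim meas])
  have bound: "norm (Re (quad_partial N b (\<zeta> * z))) \<le> ?B" if "\<zeta> \<in> space arc_length" for N \<zeta>
    using quad_partial_bound [OF b, of "\<zeta> * z" N] z abs_Re_le_cmod [of "quad_partial N b (\<zeta> * z)"] unfolding cz [OF that] by simp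
  show "integrable arc_length (\<lambda>\<zeta>. quad b (\<zeta> * z))"
    by (rule integrable_dominated_convergence [where w = "\<lambda>_. ?B", OF meas' meas])
       (use lim bound in \<open>auto intro!: AE_I2\<close>)
  have "(\<lambda>N. LINT \<zeta>|arc_length. Re (quad_partial N b (\<zeta> * z))) \<longlonglongrightarrow> (LINT \<zeta>|arc_length. quad b (\<zeta> * z))"
    by (rule integral_dominated_convergence [where w = "\<lambda>_. ?B", OF meas' meas])
       (use lim bound in \<open>auto intro!: AE_I2\<close>)
  moreover have "(\<lambda>N. LINT \<zeta>|arc_length. Re (quad_partial N b (\<zeta> * z))) \<longlonglongrightarrow> q 0 ((cmod z)\<^sup>2) b b"
    unfolding integral_quad_partial [OF z] q_def using summable_sums [OF summable_W [OF b b, of "(cmod z)\<^sup>2" 0]] z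
    by (simp add: sums_def_le power_less_one_iff abs_square_less_1)
  ultimately show "(LINT \<zeta>|arc_length. quad b (\<zeta> * z)) = q 0 ((cmod z)\<^sup>2) b b" by (rule LIMSEQ_unique)
qed

lemma nn_circle_formula:
  assumes b: "disc_seq b" and z: "cmod z < 1"
  shows "(\<integral>\<^sup>+\<zeta>. ennreal (quad b (\<zeta> * z)) \<partial>arc_length) = ennreal (q 0 ((cmod z)\<^sup>2) b b)"
  unfolding circle_formula(2) [OF b z, symmetric]
  by (rule nn_integral_eq_integral [OF circle_formula(1) [OF b z]])
     (use z in \<open>auto intro!: AE_I2 quad_nonneg simp: norm_mult\<close>)

text \<open>The form of order zero at \<open>t\<close> is the mean of the nonnegative function
  \<open>quad\<close> over the circle of radius \<open>sqrt t\<close>.\<close>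

sublocale toeplitz_pos moment K
proof
  fix a :: "nat \<Rightarrow> 'e" and t :: real assume *: "disc_seq a" "0 \<le> t" "t < 1"
  define z where "z = complex_of_real (sqrt t)"
  have z: "cmod z < 1" "(cmod z)\<^sup>2 = t" using * by (auto simp: z_def)
  have "0 \<le> (LINT \<zeta>|arc_length. quad a (\<zeta> * z))"
    by (rule integral_nonneg_AE) (use z in \<open>auto intro!: AE_I2 quad_nonneg simp: norm_mult\<close>)
  then show "0 \<le> q 0 t a a" using circle_formula(2) [OF *(1) z(1)] z(2) by simp
qed

end

section \<open>Differentiation and uniqueness of power series\<close>

lemma has_vderiv_ps:
  fixes a :: "nat \<Rightarrow> 'e::complex_hilbert_space"
  assumes a: "disc_seq a" and z: "cmod z < 1"
  shows "has_vderiv (ps a) (ps (deriv_seq 1 a) z) z"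
proof -
  obtain r where r: "cmod z < r" "r < 1" using z dense by blast
  let ?S = "ball (0::complex) r" and ?d = "deriv_seq 1 a"
  have d: "disc_seq ?d" by (rule disc_seq_deriv_seq [OF a])
  have d_eq: "?d i = of_nat (Suc i) *\<^sub>C a (Suc i)" for i
    by (simp add: deriv_seq_def scaleR_conv_scaleC)
  have r0: "0 \<le> r" using r norm_ge_zero order_trans less_imp_le by blast
  have unif: "uniform_limit ?S (\<lambda>n x. \<Sum>i<n. (x ^ i) *\<^sub>C ?d i) (\<lambda>x. \<Sum>i. (x ^ i) *\<^sub>C ?d i) sequentially"
  proof (rule Weierstrass_m_test)
    show "summable (\<lambda>i. r ^ i * norm (?d i))" by (rule disc_seqD [OF d r0 r(2)])
    show "norm ((x ^ i) *\<^sub>C ?d i) \<le> r ^ i * norm (?d i)" if "x \<in> ?S" for i x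
      using that by (auto simp: norm_power intro!: mult_right_mono power_mono)
  qed
  have "\<exists>g. \<forall>x\<in>?S. (\<lambda>n. (x ^ n) *\<^sub>C a n) sums g x \<and> (g has_derivative (\<lambda>h. h *\<^sub>C ps ?d x)) (at x within ?S)"
  proof (rule has_derivative_series)
    show "convex ?S" by simp
    show "((\<lambda>x. (x ^ n) *\<^sub>C a n) has_derivative (\<lambda>h. h *\<^sub>C ((of_nat n * x ^ (n - 1)) *\<^sub>C a n))) (at x within ?S)" for n x
    proof -
      have bl: "bounded_linear (\<lambda>w. w *\<^sub>C a n)" by (rule bounded_bilinear.bounded_linear_left [OF bounded_bilinear_scaleC])
      have "((\<lambda>x. x ^ n) has_derivative (\<lambda>h. h * (of_nat n * x ^ (n - 1)))) (at x within ?S)"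
        by (auto intro!: derivative_eq_intros simp: mult_ac)
      from bounded_linear.has_derivative [OF bl this] show ?thesis by (simp add: scaleC_scaleC)
    qed
    show "\<forall>\<^sub>F n in sequentially. \<forall>x\<in>?S. \<forall>h. norm ((\<Sum>i<n. h *\<^sub>C ((of_nat i * x ^ (i - 1)) *\<^sub>C a i)) - h *\<^sub>C ps ?d x) \<le> e * norm h"
      if e: "e > 0" for e
    proof -
      obtain M where M: "\<And>n x. \<lbrakk>n \<ge> M; x \<in> ?S\<rbrakk> \<Longrightarrow> dist (\<Sum>i<n. (x ^ i) *\<^sub>C ?d i) (ps ?d x) < e"
        using uniform_limitD [OF unif e] unfolding eventually_sequentially ps_def by blast
      have "norm ((\<Sum>i<n. h *\<^sub>C ((of_nat i * x ^ (i - 1)) *\<^sub>C a i)) - h *\<^sub>C ps ?d x) \<le> e * norm h"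
        if "n \<ge> Suc M" "x \<in> ?S" for n x h
      proof -
        \<comment> \<open>The constant term has derivative zero, so \<open>n\<close> differentiated
          summands match \<open>n - 1\<close> summands of the series of
          \<open>deriv_seq 1 a\<close>.\<close>
        obtain p where p: "n = Suc p" "p \<ge> M" using \<open>n \<ge> Suc M\<close> by (metis Suc_le_D Suc_le_mono)
        have "(\<Sum>i<n. h *\<^sub>C ((of_nat i * x ^ (i - 1)) *\<^sub>C a i)) = h *\<^sub>C (\<Sum>i<p. (x ^ i) *\<^sub>C ?d i)"
          unfolding p sum.lessThan_Suc_shift scaleC_sum_right d_eq by (simp add: scaleC_scaleC mult_ac)
        then have "norm ((\<Sum>i<n. h *\<^sub>C ((of_nat i * x ^ (i - 1)) *\<^sub>C a i)) - h *\<^sub>C ps ?d x)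
            = norm h * dist (\<Sum>i<p. (x ^ i) *\<^sub>C ?d i) (ps ?d x)"
          by (simp add: dist_norm flip: scaleC_diff_right)
        also have "\<dots> \<le> norm h * e" using M [OF p(2) that(2)] by (intro mult_left_mono) auto
        finally show ?thesis by (simp add: mult.commute)
      qed
      then show ?thesis unfolding eventually_sequentially by blast
    qed
    show "0 \<in> ?S" using le_less_trans [OF norm_ge_zero r(1)] by simp
    show "(\<lambda>n. (0 ^ n) *\<^sub>C a n) sums ps a 0" by (rule ps_sums [OF a]) simp
  qed
  then obtain g where g': "\<forall>x\<in>?S. (\<lambda>n. (x ^ n) *\<^sub>C a n) sums g x \<and> (g has_derivative (\<lambda>h. h *\<^sub>C ps ?d x)) (at x within ?S)"
    by (rule exE)
  note g = conjunct1 [OF bspec [OF g']] conjunct2 [OF bspec [OF g']]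
  have zS: "z \<in> ?S" using r by simp
  have "g x = ps a x" if "x \<in> ?S" for x by (rule sums_unique2 [OF g(1) [OF that] ps_sums [OF a]]) (use that r in simp)
  moreover have "(g has_derivative (\<lambda>h. h *\<^sub>C ps ?d z)) (at z)" using g(2) [OF zS] unfolding at_within_open [OF zS open_ball] .
  ultimately show ?thesis unfolding has_vderiv_def
    using has_derivative_transform_within_open [of g _ z UNIV ?S "ps a"] zS by auto
qed

lemma vderiv_eq:
  assumes "has_vderiv f d z"
  shows "vderiv f z = d"
  unfolding vderiv_def
proof (rule the_equality)
  show "has_vderiv f d z" by (rule assms)
next
  fix d' assume "has_vderiv f d' z"
  then have "(\<lambda>h. h *\<^sub>C d') = (\<lambda>h. h *\<^sub>C d)" using assms unfolding has_vderiv_def by (rule has_derivative_unique)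
  then have "1 *\<^sub>C d' = 1 *\<^sub>C d" by (rule fun_cong)
  then show "d' = d" by simp
qed

lemma has_vderiv_transform:
  assumes "has_vderiv g d z" "z \<in> unit_disc" "\<And>x. x \<in> unit_disc \<Longrightarrow> g x = f x"
  shows "has_vderiv f d z"
  using has_derivative_transform_within_open [of g _ z UNIV unit_disc f] assms unfolding has_vderiv_def by auto

lemma deriv_seq_Suc: "deriv_seq 1 (deriv_seq n a) = deriv_seq (Suc n) a"
proof
  fix k
  have "fact (k + 1) / fact k * (fact (k + 1 + n) / fact (k + 1)) = (fact (k + Suc n) / fact k :: real)"
    by simp
  then show "deriv_seq 1 (deriv_seq n a) k = deriv_seq (Suc n) a k"
    unfolding deriv_seq_def scaleR_scaleR by simp
qed

lemma funpow_vderiv: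
  fixes a :: "nat \<Rightarrow> 'e::complex_hilbert_space"
  assumes a: "disc_seq a" and f: "\<And>z. z \<in> unit_disc \<Longrightarrow> f z = ps a z" and z: "z \<in> unit_disc"
  shows "(vderiv ^^ n) f z = ps (deriv_seq n a) z"
  using z
proof (induction n arbitrary: z)
  case 0
  have "deriv_seq 0 a = a" by (simp add: deriv_seq_def fun_eq_iff)
  then show ?case using f 0 by simp
next
  case (Suc n)
  have "has_vderiv (ps (deriv_seq n a)) (ps (deriv_seq 1 (deriv_seq n a)) z) z"
    by (rule has_vderiv_ps [OF disc_seq_deriv_seq [OF a]]) (use Suc.prems in simp)
  then have "has_vderiv ((vderiv ^^ n) f) (ps (deriv_seq 1 (deriv_seq n a)) z) z"
    by (rule has_vderiv_transform [OF _ Suc.prems]) (simp add: Suc.IH)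
  then show ?case by (simp add: vderiv_eq deriv_seq_Suc [unfolded One_nat_def])
qed

lemma has_power_series_disc_seq:
  fixes a :: "nat \<Rightarrow> 'e::complex_hilbert_space"
  assumes "has_power_series f a"
  shows "disc_seq a"
  unfolding disc_seq_def
proof (intro allI impI, elim conjE)
  fix r :: real assume r: "0 \<le> r" "r < 1"
  obtain r' where r': "r < r'" "r' < 1" using r dense by blast
  have "summable (\<lambda>j. (complex_of_real r' ^ j) *\<^sub>C a j)"
    using assms r r' unfolding has_power_series_def by (auto simp: sums_iff)
  then have "(\<lambda>j. (complex_of_real r' ^ j) *\<^sub>C a j) \<longlonglongrightarrow> 0" by (rule summable_LIMSEQ_zero)
  then have "Bseq (\<lambda>j. (complex_of_real r' ^ j) *\<^sub>C a j)" using convergentI convergent_imp_Bseq by blast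
  then obtain B where B: "\<And>j. norm ((complex_of_real r' ^ j) *\<^sub>C a j) \<le> B" by (auto simp: Bseq_def)
  show "summable (\<lambda>k. r ^ k * norm (a k))"
  proof (rule summable_comparison_test')
    show "summable (\<lambda>k. (r / r') ^ k * B)" using r r' by (intro summable_mult2 summable_geometric) simp
    show "norm (r ^ k * norm (a k)) \<le> (r / r') ^ k * B" for k
    proof -
      have "r ^ k * norm (a k) = (r / r') ^ k * (r' ^ k * norm (a k))" using r r' by (simp add: power_divide)
      also have "\<dots> \<le> (r / r') ^ k * B" using B [of k] r r' by (intro mult_left_mono) (auto simp: norm_power)
      finally show ?thesis using r by simp
    qed
  qed
qed

lemma has_power_series_iff:
  fixes a :: "nat \<Rightarrow> 'e::complex_hilbert_space"
  shows "has_power_series f a \<longleftrightarrow> disc_seq a \<and> (\<forall>z\<in>unit_disc. f z = ps a z)"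
proof
  assume h: "has_power_series f a"
  then have a: "disc_seq a" by (rule has_power_series_disc_seq)
  have "f z = ps a z" if "z \<in> unit_disc" for z
    using h that sums_unique2 [OF _ ps_sums [OF a, of z]] unfolding has_power_series_def by auto
  then show "disc_seq a \<and> (\<forall>z\<in>unit_disc. f z = ps a z)" using a by blast
qed (auto simp: has_power_series_def intro!: ps_sums)

lemma ps_0: "ps b 0 = b 0"
proof -
  have "(\<lambda>k. ((0::complex) ^ k) *\<^sub>C b k) = (\<lambda>k. if k = 0 then b k else 0)" by (auto simp: fun_eq_iff zero_power)
  then show ?thesis unfolding ps_def using sums_single [of 0 b] by (simp add: sums_iff)
qed

lemma has_power_series_unique:
  fixes a :: "nat \<Rightarrow> 'e::complex_hilbert_space"
  assumes "has_power_series f a" "has_power_series f b"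
  shows "a = b"
proof
  fix n
  have "(vderiv ^^ n) f 0 = fact n *\<^sub>R c n" if "has_power_series f c" for c
    using funpow_vderiv [of c f 0 n] that by (auto simp: has_power_series_iff ps_0 deriv_seq_def)
  from this [OF assms(1)] this [OF assms(2)] show "a n = b n" by simp
qed

lemma the_power_series: "has_power_series f a \<Longrightarrow> (THE a. has_power_series f a) = a"
  using has_power_series_unique by blast

text \<open>Parameters in (0,1) increasing to 1, for monotone convergence; they play the role of
  \<open>t\<close>, that is, of squared radii.\<close>

definition radius_seq :: "nat \<Rightarrow> real" where
  "radius_seq i = 1 - 1 / (real i + 2)"

lemma radius_seq: "0 < radius_seq i" "radius_seq i < 1" "i \<le> j \<Longrightarrow> radius_seq i \<le> radius_seq j"
  by (simp_all add: radius_seq_def frac_le)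

lemma radius_seq_tendsto: "radius_seq \<longlonglongrightarrow> 1"
proof -
  have "(\<lambda>i. inverse (real (i + 2))) \<longlonglongrightarrow> 0" by (rule LIMSEQ_ignore_initial_segment [OF lim_inverse_n])
  then have "(\<lambda>i. 1 - inverse (real (i + 2))) \<longlonglongrightarrow> 1 - 0" by (intro tendsto_intros)
  then show ?thesis by (simp add: radius_seq_def [abs_def] divide_inverse add.commute)
qed

lemma radius_seq_at_left: "filterlim radius_seq (at_left 1) sequentially"
  unfolding filterlim_at using radius_seq radius_seq_tendsto by (auto simp: less_imp_neq)

section \<open>Dirichlet type integrals as boundary values\<close>

context semi_spectral
begin

lemma Re_poisson_integral: "cmod z < 1 \<Longrightarrow> Re (cinner (poisson_integral \<mu> z (ps b z)) (ps b z)) = quad b z"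
  by (simp add: cinner_poisson_integral quad_def)

lemma q_borel:
  assumes b: "disc_seq b"
  shows "(\<lambda>s. indicator {0..<1} s * q 0 s b b) \<in> borel_measurable borel"
proof (rule borel_measurable_LIMSEQ_real)
  show "(\<lambda>N. indicator {0..<1} s * (\<Sum>M\<le>N. s ^ M * W 0 b b M)) \<longlonglongrightarrow> indicator {0..<1} s * q 0 s b b" for s :: real
  proof (cases "s \<in> {0..<1}")
    case True
    then have "(\<lambda>N. \<Sum>M\<le>N. s ^ M * W 0 b b M) \<longlonglongrightarrow> q 0 s b b"
      unfolding q_def using summable_sums [OF summable_W [OF b b, of s 0]] by (simp add: sums_def_le)
    then show ?thesis using True by simp
  qed simp
qed measurable

lemma nn_integral_quad:
  assumes b: "disc_seq b"
  shows "(\<integral>\<^sup>+z\<in>unit_disc. ennreal (quad b z * (1 - (cmod z)\<^sup>2) ^ p) \<partial>disc_area) =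
     (\<integral>\<^sup>+s. ennreal (indicator {0..<1} s * q 0 s b b * (1 - s) ^ p) \<partial>lborel)"
proof -
  define F where "F z = ennreal (indicator unit_disc z * quad b z * (1 - (cmod z)\<^sup>2) ^ p)" for z
  define h where "h s = ennreal (indicator {0..<1} s * q 0 s b b * (1 - s) ^ p)" for s
  note [measurable] = quad_borel [OF b] q_borel [OF b]
  have [measurable]: "F \<in> borel_measurable borel" "h \<in> borel_measurable borel" unfolding F_def h_def by measurable
  have inner: "(\<integral>\<^sup>+\<zeta>. F (\<zeta> * z) \<partial>arc_length) = h ((cmod z)\<^sup>2)" for z
  proof (cases "cmod z < 1")
    case True
    have sq: "(cmod z)\<^sup>2 < 1" using True by (simp add: abs_square_less_1)
    have "(\<integral>\<^sup>+\<zeta>. F (\<zeta> * z) \<partial>arc_length) = (\<integral>\<^sup>+\<zeta>. ennreal (quad b (\<zeta> * z)) * ennreal ((1 - (cmod z)\<^sup>2) ^ p) \<partial>arc_length)"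
      by (rule nn_integral_cong)
         (use True sq quad_nonneg in \<open>simp add: F_def norm_mult ennreal_mult'\<close>)
    also have "\<dots> = (\<integral>\<^sup>+\<zeta>. ennreal (quad b (\<zeta> * z)) \<partial>arc_length) * ennreal ((1 - (cmod z)\<^sup>2) ^ p)"
      by (rule nn_integral_multc) (use circle_formula(1) [OF b True] in measurable)
    also have "\<dots> = h ((cmod z)\<^sup>2)"
      using nn_circle_formula [OF b True] sq q0_nonneg [OF b, of "(cmod z)\<^sup>2"] by (simp add: h_def ennreal_mult')
    finally show ?thesis .
  next
    case False
    then have "\<not> (cmod z)\<^sup>2 < 1" using abs_square_less_1 [of "cmod z"] by simp
    then have "h ((cmod z)\<^sup>2) = 0" by (simp add: h_def)
    moreover have "(\<integral>\<^sup>+\<zeta>. F (\<zeta> * z) \<partial>arc_length) = (\<integral>\<^sup>+\<zeta>. 0 \<partial>arc_length)"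
      by (rule nn_integral_cong) (use False in \<open>simp add: F_def norm_mult\<close>)
    ultimately show ?thesis by simp
  qed
  have "(\<integral>\<^sup>+z\<in>unit_disc. ennreal (quad b z * (1 - (cmod z)\<^sup>2) ^ p) \<partial>disc_area) = (\<integral>\<^sup>+z. F z \<partial>disc_area)"
    by (rule nn_integral_cong) (simp add: F_def indicator_def)
  also have "\<dots> = (\<integral>\<^sup>+z. h ((cmod z)\<^sup>2) \<partial>disc_area)"
    by (simp add: nn_integral_disc_area_average inner)
  also have "\<dots> = (\<integral>\<^sup>+s. h s * indicator {0..1} s \<partial>lborel)" by (rule nn_integral_disc_area_radial) measurable
  also have "\<dots> = (\<integral>\<^sup>+s. h s \<partial>lborel)" by (rule nn_integral_cong) (simp add: h_def indicator_def)
  finally show ?thesis by (simp add: h_def)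
qed

text \<open>Both sides are integrals of the same nonnegative function of \<open>s\<close>, against
  the kernel \<open>(t - s) ^ (n - 1)\<close> on \<open>{0..t}\<close> and its limit at
  \<open>t = 1\<close>. The truncated kernels increase, so monotone convergence applies without
  assuming that the limit is finite.\<close>

lemma D_fun_tendsto:
  assumes n: "n > 0" and a: "disc_seq a" and f: "\<And>z. z \<in> unit_disc \<Longrightarrow> f z = ps a z"
  shows "(\<lambda>i. ennreal (q n (radius_seq i) a a)) \<longlonglongrightarrow> D_fun \<mu> n f"
proof -
  let ?b = "deriv_seq n a" and ?c = "1 / (fact n * fact (n - 1)) :: real"
  have b: "disc_seq ?b" by (rule disc_seq_deriv_seq [OF a])
  note [measurable] = q_borel [OF b]
  have c0: "0 < ?c" by simp
  \<comment> \<open>Cutting off with \<open>max 0\<close> makes each factor increase with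
    \<open>i\<close>. The indicator does the truncation, which matters for \<open>n = 1\<close>,
    where the power is 1 everywhere.\<close>
  define h where "h i s = ennreal ((max 0 (radius_seq i - s)) ^ (n - 1) * (indicator {0..<1} s * q 0 s ?b ?b) * ?c) * indicator {0..radius_seq i} s" for i s
  define u where "u s = ennreal (indicator {0..<1} s * q 0 s ?b ?b * (1 - s) ^ (n - 1) * ?c)" for s
  have [measurable]: "h i \<in> borel_measurable borel" for i unfolding h_def by measurable
  have nn: "0 \<le> indicator {0..<1} s * q 0 s ?b ?b" for s using q0_nonneg [OF b, of s] by (simp add: indicator_def)
  have "D_fun \<mu> n f = ennreal ?c * (\<integral>\<^sup>+z\<in>unit_disc. ennreal (quad ?b z * (1 - (cmod z)\<^sup>2) ^ (n - 1)) \<partial>disc_area)"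
    unfolding D_fun_def
  proof (rule arg_cong2 [of _ _ _ _ "(*)", OF refl nn_integral_cong])
    fix z :: complex
    show "ennreal (Re (cinner (poisson_integral \<mu> z ((vderiv ^^ n) f z)) ((vderiv ^^ n) f z)) * (1 - (cmod z)\<^sup>2) ^ (n - 1)) * indicator unit_disc z =
       ennreal (quad ?b z * (1 - (cmod z)\<^sup>2) ^ (n - 1)) * indicator unit_disc z"
      using funpow_vderiv [OF a f, of z n] Re_poisson_integral [of z ?b] by (cases "z \<in> unit_disc") simp_all
  qed
  also have "\<dots> = (\<integral>\<^sup>+s. ennreal ?c * ennreal (indicator {0..<1} s * q 0 s ?b ?b * (1 - s) ^ (n - 1)) \<partial>lborel)"
    unfolding nn_integral_quad [OF b] by (rule nn_integral_cmult [symmetric]) measurable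
  also have "\<dots> = (\<integral>\<^sup>+s. u s \<partial>lborel)"
  proof (rule nn_integral_cong)
    fix s :: real
    show "ennreal ?c * ennreal (indicator {0..<1} s * q 0 s ?b ?b * (1 - s) ^ (n - 1)) = u s"
      unfolding u_def using c0 by (subst ennreal_mult' [symmetric]) (auto simp: mult.commute)
  qed
  finally have D: "D_fun \<mu> n f = (\<integral>\<^sup>+s. u s \<partial>lborel)" .
  have "(\<integral>\<^sup>+s. h i s \<partial>lborel) = ennreal (q n (radius_seq i) a a)" for i
  proof -
    have I: "((\<lambda>s. (radius_seq i - s) ^ (n - 1) * q 0 s ?b ?b / (fact n * fact (n - 1))) has_integral q n (radius_seq i) a a) {0..radius_seq i}"
      using q_has_integral [OF a n, of "radius_seq i"] radius_seq [of i] by simp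
    have "(\<integral>\<^sup>+s. ennreal ((radius_seq i - s) ^ (n - 1) * q 0 s ?b ?b / (fact n * fact (n - 1))) * indicator {0..radius_seq i} s \<partial>lborel) = ennreal (q n (radius_seq i) a a)"
      by (rule nn_integral_has_integral_lebesgue' [OF _ I])
         (use radius_seq(2) [of i] in \<open>auto intro!: divide_nonneg_nonneg mult_nonneg_nonneg q0_nonneg b\<close>)
    moreover have "h i s = ennreal ((radius_seq i - s) ^ (n - 1) * q 0 s ?b ?b / (fact n * fact (n - 1))) * indicator {0..radius_seq i} s" for s
      using radius_seq(2) [of i] by (simp add: h_def indicator_def max_def)
    ultimately show ?thesis by simp
  qed
  moreover have "(\<lambda>i. \<integral>\<^sup>+s. h i s \<partial>lborel) \<longlonglongrightarrow> (\<integral>\<^sup>+s. u s \<partial>lborel)"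
  proof (rule nn_integral_LIMSEQ)
    show "incseq h"
    proof (intro incseq_SucI le_funI)
      fix i s
      have "radius_seq i \<le> radius_seq (Suc i)" by (rule radius_seq) simp
      then have "(max 0 (radius_seq i - s)) ^ (n - 1) \<le> (max 0 (radius_seq (Suc i) - s)) ^ (n - 1)"
        and "(indicator {0..radius_seq i} s :: ennreal) \<le> indicator {0..radius_seq (Suc i)} s"
        by (auto intro!: power_mono simp: indicator_def)
      then show "h i s \<le> h (Suc i) s"
        unfolding h_def by (intro mult_mono ennreal_leI mult_right_mono nn) (use c0 in auto)
    qed
    show "(\<lambda>i. h i s) \<longlonglongrightarrow> u s" for s
    proof (cases "s \<in> {0..<1}")
      case True
      have "\<forall>\<^sub>F i in sequentially. s < radius_seq i" using order_tendstoD(1) [OF radius_seq_tendsto, of s] True by simp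
      then have "\<forall>\<^sub>F i in sequentially. ennreal ((max 0 (radius_seq i - s)) ^ (n - 1) * (indicator {0..<1} s * q 0 s ?b ?b) * ?c) = h i s"
        by eventually_elim (use True in \<open>simp add: h_def indicator_def\<close>)
      moreover have "(\<lambda>i. ennreal ((max 0 (radius_seq i - s)) ^ (n - 1) * (indicator {0..<1} s * q 0 s ?b ?b) * ?c)) \<longlonglongrightarrow>
          ennreal ((max 0 (1 - s)) ^ (n - 1) * (indicator {0..<1} s * q 0 s ?b ?b) * ?c)"
        by (intro tendsto_ennrealI tendsto_intros radius_seq_tendsto)
      moreover have "ennreal ((max 0 (1 - s)) ^ (n - 1) * (indicator {0..<1} s * q 0 s ?b ?b) * ?c) = u s"
        using True by (simp add: u_def mult_ac)
      ultimately show ?thesis using Lim_transform_eventually by fastforce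
    qed (simp add: h_def u_def)
  qed measurable
  ultimately show ?thesis using D by simp
qed

text \<open>The forms along \<open>radius_seq\<close> increase to \<open>D_fun\<close>, so a finite
  \<open>D_fun\<close> bounds them, and monotonicity extends the bound to every
  \<open>t\<close>.\<close>

lemma
  assumes n: "n > 0" and a: "disc_seq a" and f: "\<And>z. z \<in> unit_disc \<Longrightarrow> f z = ps a z"
  shows D_fun_eq: "fin n a \<Longrightarrow> D_fun \<mu> n f = ennreal (D n a)"
    and D_fun_finite: "D_fun \<mu> n f < \<infinity> \<longleftrightarrow> fin n a"
proof -
  obtain p where p: "n = Suc p" using n by (metis gr0_implies_Suc)
  note lim = D_fun_tendsto [of n a f, OF n a f]
  show eq: "D_fun \<mu> n f = ennreal (D n a)" if "fin n a"
  proof (rule LIMSEQ_unique [OF lim])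
    show "(\<lambda>i. ennreal (q n (radius_seq i) a a)) \<longlonglongrightarrow> ennreal (D n a)"
      using filterlim_compose [OF tendsto_D_Suc [of p a] radius_seq_at_left] that
      by (intro tendsto_ennrealI) (simp add: p)
  qed
  have "fin n a" if "D_fun \<mu> n f < \<infinity>"
  proof (rule finI [OF a])
    fix t :: real assume t: "0 < t" "t < 1"
    obtain i where i: "t \<le> radius_seq i"
      using order_tendstoD(1) [OF radius_seq_tendsto t(2)] by (auto simp: eventually_sequentially intro: less_imp_le)
    have "incseq (\<lambda>i. ennreal (q n (radius_seq i) a a))"
      by (intro incseq_SucI ennreal_leI q_mono a n) (use radius_seq in \<open>auto intro: less_imp_le\<close>)
    then have "ennreal (q n (radius_seq i) a a) \<le> D_fun \<mu> n f" using lim by (rule incseq_le)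
    then have "q n (radius_seq i) a a \<le> enn2real (D_fun \<mu> n f)"
      using that by (metis enn2real_mono enn2real_ennreal q_nonneg a radius_seq less_imp_le infinity_ennreal_def)
    moreover have "q n t a a \<le> q n (radius_seq i) a a" using t i radius_seq by (intro q_mono a n) auto
    ultimately show "q n t a a \<le> enn2real (D_fun \<mu> n f)" by simp
  qed
  then show "D_fun \<mu> n f < \<infinity> \<longleftrightarrow> fin n a" using eq by auto
qed

text \<open>The mean over the circle of radius \<open>R\<close> is the form of order zero at
  \<open>R\<^sup>2\<close>, whose limit exists because \<open>fin 1 a\<close> holds.\<close>

lemma D_zero_eq:
  assumes fin: "fin 1 a" and f: "\<And>z. z \<in> unit_disc \<Longrightarrow> f z = ps a z"
  shows "D_zero \<mu> f = D 0 a"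
proof -
  let ?g = "\<lambda>R::real. LINT \<zeta>|arc_length.
         Re (cinner (poisson_integral \<mu> (of_real R * \<zeta>) (f (of_real R * \<zeta>))) (f (of_real R * \<zeta>)))"
  have a: "disc_seq a" by (rule fin_disc_seq [OF fin])
  have g: "?g R = q 0 (R\<^sup>2) a a" if R: "0 < R" "R < 1" for R
  proof -
    have "?g R = (LINT \<zeta>|arc_length. quad a (\<zeta> * of_real R))"
      by (rule Bochner_Integration.integral_cong)
         (use R in \<open>simp_all add: f Re_poisson_integral norm_mult mult.commute\<close>)
    then show ?thesis using circle_formula(2) [OF a, of "of_real R"] R by simp
  qed
  have "((\<lambda>R. q 0 (R\<^sup>2) a a) \<longlongrightarrow> D 0 a) (at_left 1)"
  proof (rule filterlim_compose [OF tendsto_D [of 0 a]])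
    show "fin (Suc 0) a" using fin by simp
    have "((\<lambda>R::real. R\<^sup>2) \<longlongrightarrow> 1\<^sup>2) (at_left 1)" by (intro tendsto_intros)
    moreover have "\<forall>\<^sub>F R::real in at_left 1. R\<^sup>2 \<in> {..<1} \<and> R\<^sup>2 \<noteq> 1"
      using eventually_at_left_1 by eventually_elim (auto simp: power2_eq_1_iff abs_square_less_1)
    ultimately show "filterlim (\<lambda>R::real. R\<^sup>2) (at_left 1) (at_left 1)" by (simp add: filterlim_at)
  qed
  moreover have "\<forall>\<^sub>F R in at_left 1. q 0 (R\<^sup>2) a a = ?g R"
    using eventually_at_left_1 by eventually_elim (simp add: g)
  ultimately have "(?g \<longlongrightarrow> D 0 a) (at_left 1)" by (rule Lim_transform_eventually)
  then show ?thesis unfolding D_zero_def by (intro tendsto_Lim) simp_all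
qed

end

section \<open>The function space and its operators\<close>

definition ev :: "(nat \<Rightarrow> 'e::complex_hilbert_space) \<Rightarrow> complex \<Rightarrow> 'e" where
  "ev a = (\<lambda>z. if z \<in> unit_disc then ps a z else 0)"

lemma has_power_series_ev: "disc_seq a \<Longrightarrow> has_power_series (ev a) a"
  by (simp add: has_power_series_iff ev_def)

lemma ev_inject: "disc_seq a \<Longrightarrow> disc_seq b \<Longrightarrow> ev a = ev b \<Longrightarrow> a = b"
  using has_power_series_ev has_power_series_unique by metis

lemma ev_eqI:
  assumes "disc_seq a" "\<And>z. z \<in> unit_disc \<Longrightarrow> (\<lambda>k. (z ^ k) *\<^sub>C a k) sums f z" "\<And>z. z \<notin> unit_disc \<Longrightarrow> f z = 0"
  shows "ev a = f"
proof
  fix z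
  show "ev a z = f z"
    using sums_unique2 [OF ps_sums [OF assms(1), of z] assms(2) [of z]] assms(3) by (simp add: ev_def)
qed

lemma ev_sums: "disc_seq a \<Longrightarrow> z \<in> unit_disc \<Longrightarrow> (\<lambda>k. (z ^ k) *\<^sub>C a k) sums ev a z"
  using ps_sums [of a z] by (simp add: ev_def)

lemma ev_outside: "z \<notin> unit_disc \<Longrightarrow> ev a z = 0"
  by (simp add: ev_def)

lemma ev_add: "disc_seq a \<Longrightarrow> disc_seq b \<Longrightarrow> ev (a + b) = (\<lambda>z. ev a z + ev b z)"
  by (rule ev_eqI) (simp_all add: disc_seq_add scaleC_add_right sums_add ev_sums ev_outside)

lemma ev_scaleC:
  assumes "disc_seq a"
  shows "ev (\<lambda>k. w *\<^sub>C a k) = (\<lambda>z. w *\<^sub>C ev a z)"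
proof (rule ev_eqI [OF disc_seq_scaleC [OF assms]])
  fix z :: complex assume z: "z \<in> unit_disc"
  have "bounded_linear (\<lambda>x::'a. w *\<^sub>C x)" by (rule bounded_bilinear.bounded_linear_right [OF bounded_bilinear_scaleC])
  from bounded_linear.sums [OF this ev_sums [OF assms z]]
  show "(\<lambda>k. (z ^ k) *\<^sub>C (w *\<^sub>C a k)) sums (w *\<^sub>C ev a z)" by (simp add: scaleC_scaleC mult.commute)
qed (simp add: ev_outside)

lemma ev_scaleR: "disc_seq a \<Longrightarrow> ev (r *\<^sub>R a) = (\<lambda>z. r *\<^sub>R ev a z)"
  using ev_scaleC [of a "complex_of_real r"] by (simp add: scaleR_fun_def scaleC_of_real)

lemma disc_seq_zero: "disc_seq (0 :: nat \<Rightarrow> 'e::real_normed_vector)"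
  using disc_seq_const [of "0::'e"] by (simp add: zero_fun_def)

lemma disc_seq_sum: "finite I \<Longrightarrow> (\<And>i. i \<in> I \<Longrightarrow> disc_seq (f i)) \<Longrightarrow> disc_seq (\<Sum>i\<in>I. f i)"
  by (induction I rule: finite_induct) (simp_all add: disc_seq_zero disc_seq_add)

lemma ev_zero: "ev 0 = (\<lambda>z. 0)"
  by (rule ev_eqI) (simp_all add: disc_seq_zero)

lemma ev_sum: "finite I \<Longrightarrow> (\<And>i. i \<in> I \<Longrightarrow> disc_seq (f i)) \<Longrightarrow> ev (\<Sum>i\<in>I. f i) = (\<lambda>z. \<Sum>i\<in>I. ev (f i) z)"
  by (induction I rule: finite_induct) (simp_all add: ev_zero ev_add disc_seq_sum)

lemma mult_z_ev:
  assumes "disc_seq a"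
  shows "mult_z (ev a) = ev (shift_up a)"
proof (rule ev_eqI [OF disc_seq_shift_up [OF assms], symmetric])
  fix z :: complex assume z: "z \<in> unit_disc"
  have "bounded_linear (\<lambda>x::'a. z *\<^sub>C x)" by (rule bounded_bilinear.bounded_linear_right [OF bounded_bilinear_scaleC])
  from bounded_linear.sums [OF this ev_sums [OF assms z]]
  have "(\<lambda>k. (z ^ Suc k) *\<^sub>C shift_up a (Suc k)) sums mult_z (ev a) z" by (simp add: scaleC_scaleC mult_z_def)
  from sums_Suc [OF this] show "(\<lambda>k. (z ^ k) *\<^sub>C shift_up a k) sums mult_z (ev a) z" by simp
qed (simp add: ev_outside mult_z_def)

definition index_set :: "nat \<Rightarrow> nat set" where
  "index_set m = {1..m - 1}"

lemma index_set_pos: "j \<in> index_set m \<Longrightarrow> 0 < j"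
  by (simp add: index_set_def)

section \<open>Transfer from sequences to the function space\<close>

locale dirichlet_tuple =
  fixes \<mu> :: "nat \<Rightarrow> complex set \<Rightarrow> 'e::complex_hilbert_space \<Rightarrow> 'e" and m :: nat
  assumes semi_spectral_mu: "j \<in> index_set m \<Longrightarrow> semi_spectral_measure (\<mu> j)"
begin

lemma semi_spectral_component: "j \<in> index_set m \<Longrightarrow> semi_spectral (\<mu> j)"
  using semi_spectral_mu by unfold_locales

sublocale toeplitz_tuple "\<lambda>j. semi_spectral.moment (\<mu> j)" "\<lambda>j. semi_spectral.K (\<mu> j)" "index_set m"
proof (rule toeplitz_tuple.intro)
  show "toeplitz_pos (semi_spectral.moment (\<mu> j)) (semi_spectral.K (\<mu> j))" if "j \<in> index_set m" for j
  proof -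
    interpret semi_spectral "\<mu> j" by (rule semi_spectral_component [OF that])
    show ?thesis by (rule toeplitz_pos_axioms)
  qed
qed (simp_all add: index_set_def)

abbreviation V :: "(complex \<Rightarrow> 'e) set" where "V \<equiv> H_space \<mu> m"

abbreviation ip :: "(complex \<Rightarrow> 'e) \<Rightarrow> (complex \<Rightarrow> 'e) \<Rightarrow> complex" where "ip \<equiv> H_inner \<mu> m"

lemma Dom_disc_seq: "a \<in> Dom \<Longrightarrow> disc_seq a"
  using Dom_bdd bdd_seq_disc_seq by blast

lemma V_eq: "V = ev ` Dom"
proof (intro equalityI subsetI)
  fix f assume f: "f \<in> V"
  then obtain a where a: "has_power_series f a" "summable (\<lambda>j. (norm (a j))\<^sup>2)" and out: "\<And>z. z \<notin> unit_disc \<Longrightarrow> f z = 0"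
    unfolding H_space_def hardy_space_def by blast
  have d: "disc_seq a" and fa: "\<And>z. z \<in> unit_disc \<Longrightarrow> f z = ps a z" using a(1) by (auto simp: has_power_series_iff)
  have "fin j j a" if j: "j \<in> index_set m" for j
  proof -
    have "D_fun (\<mu> j) j f < \<infinity>" using f j unfolding H_space_def H_single_def index_set_def by blast
    then show ?thesis using semi_spectral.D_fun_finite [OF semi_spectral_component [OF j] index_set_pos [OF j] d fa] by simp
  qed
  then have "a \<in> Dom" using a(2) Dom_iff by blast
  moreover have "f = ev a" using fa out by (auto simp: ev_def fun_eq_iff)
  ultimately show "f \<in> ev ` Dom" by blast
next
  fix f assume "f \<in> ev ` Dom"
  then obtain a where a: "a \<in> Dom" "f = ev a" by blast
  have d: "disc_seq a" by (rule Dom_disc_seq [OF a(1)])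
  have fa: "f z = ps a z" if "z \<in> unit_disc" for z using that a by (simp add: ev_def)
  have "f \<in> holomorphic_functions"
    unfolding holomorphic_functions_def
  proof (intro CollectI conjI ballI allI impI)
    fix z :: complex assume z: "z \<in> unit_disc"
    have "has_vderiv f (ps (deriv_seq 1 a) z) z"
      by (rule has_vderiv_transform [OF has_vderiv_ps [OF d] z]) (use z fa in auto)
    then show "\<exists>d. has_vderiv f d z" by blast
  qed (simp add: a ev_outside)
  moreover have "D_fun (\<mu> j) j f < \<infinity>" if j: "j \<in> index_set m" for j
    using semi_spectral.D_fun_finite [OF semi_spectral_component [OF j] index_set_pos [OF j] d fa] j a(1) Dom_iff by simp
  moreover have "f \<in> hardy_space"
    unfolding hardy_space_def using a has_power_series_ev [OF d] Dom_iff by (auto simp: ev_outside)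
  ultimately show "f \<in> V" by (auto simp: H_space_def H_single_def index_set_def)
qed

lemma ev_in_V: "a \<in> Dom \<Longrightarrow> ev a \<in> V"
  by (simp add: V_eq)

lemma H_norm_sq_ev:
  assumes a: "a \<in> Dom"
  shows "H_norm_sq \<mu> m (ev a) = form a a"
proof -
  have d: "disc_seq a" by (rule Dom_disc_seq [OF a])
  have "enn2real (D_fun (\<mu> j) j (ev a)) = D j j a" if j: "j \<in> index_set m" for j
  proof -
    have "fin j j a" using a j Dom_iff by blast
    then have "D_fun (\<mu> j) j (ev a) = ennreal (D j j a)"
      using semi_spectral.D_fun_eq [OF semi_spectral_component [OF j] index_set_pos [OF j] d, of "ev a"] by (simp add: ev_def)
    then show ?thesis using D_diag_nonneg [OF a j] by simp
  qed
  then show ?thesis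
    by (simp add: H_norm_sq_def hardy_norm_sq_def index_set_def [symmetric, unfolded One_nat_def] the_power_series [OF has_power_series_ev [OF d]] form_diag [OF a])
qed

text \<open>The complex structure, kept as a separate map because \<open>Dom\<close> and
  \<open>form\<close> are real; complex linear means real linear and commuting with
  \<open>rot\<close>.\<close>

definition rot :: "(nat \<Rightarrow> 'e) \<Rightarrow> nat \<Rightarrow> 'e" where
  "rot a = (\<lambda>k. \<i> *\<^sub>C a k)"

lemma rot_Dom [simp]: "a \<in> Dom \<Longrightarrow> rot a \<in> Dom"
  by (simp add: rot_def Dom_rotate)

lemma form_rot: "\<lbrakk>a \<in> Dom; b \<in> Dom\<rbrakk> \<Longrightarrow> form (rot a) (rot b) = form a b"
  by (simp add: rot_def form_rotate)

lemma rot_rot: "rot (rot a) = (-1) *\<^sub>R a"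
  by (simp add: rot_def fun_eq_iff scaleC_scaleC scaleC_minus_left)

lemma rot_add: "rot (a + b) = rot a + rot b"
  by (simp add: rot_def fun_eq_iff scaleC_add_right)

lemma rot_scaleR: "rot (r *\<^sub>R a) = r *\<^sub>R rot a"
  by (simp add: rot_def fun_eq_iff scaleC_scaleR)

lemma form_rot_right:
  assumes "a \<in> Dom" "b \<in> Dom"
  shows "form a (rot b) = - form (rot a) b"
proof -
  have "form a (rot b) = form (rot a) ((-1) *\<^sub>R b)"
    using form_rot [of a "rot b"] assms by (simp add: rot_rot del: scaleR_minus1_left scaleR_left.minus)
  then show ?thesis using s_scale' [of "rot a" b "-1"] assms by simp
qed

text \<open>In the polarization sum the roots 1 and -1 produce the real part and the roots
  \<open>\<i>\<close> and \<open>- \<i>\<close> the imaginary part, which is the real form against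
  \<open>rot b\<close>.\<close>

lemma H_inner_ev:
  assumes a: "a \<in> Dom" and b: "b \<in> Dom"
  shows "ip (ev a) (ev b) = Complex (form a b) (form a (rot b))"
proof -
  note da = Dom_disc_seq [OF a] and db = Dom_disc_seq [OF b]
  have pw: "(\<lambda>z. ev a z + w *\<^sub>C ev b z) = ev (a + (\<lambda>k. w *\<^sub>C b k))" for w
    by (simp add: ev_add da disc_seq_scaleC db ev_scaleC)
  have i2: "a + (\<lambda>k. (\<i>\<^sup>2) *\<^sub>C b k) = a - b" "a + (\<lambda>k. (\<i> ^ 3) *\<^sub>C b k) = a - rot b"
    "a + (\<lambda>k. (\<i> ^ 0) *\<^sub>C b k) = a + b" "a + (\<lambda>k. (\<i> ^ 1) *\<^sub>C b k) = a + rot b"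
    by (simp_all add: fun_eq_iff rot_def scaleC_minus_left power3_eq_cube)
  have sum4: "(\<Sum>k<4. g k) = g 0 + g 1 + g 2 + g 3" for g :: "nat \<Rightarrow> complex"
    by (simp add: eval_nat_numeral lessThan_Suc add_ac)
  have polar: "form (a + c) (a + c) - form (a - c) (a - c) = 4 * form a c" if "c \<in> Dom" for c
    using a that s_commute [of c a] by (simp add: s_simps)
  have "ip (ev a) (ev b) = (complex_of_real (form (a + b) (a + b)) - form (a - b) (a - b) +
      \<i> * (complex_of_real (form (a + rot b) (a + rot b)) - form (a - rot b) (a - rot b))) / 4"
    unfolding H_inner_def pw
    unfolding sum4 i2 using a b by (simp add: H_norm_sq_ev power3_eq_cube algebra_simps)
  also have "\<dots> = (complex_of_real (4 * form a b) + \<i> * complex_of_real (4 * form a (rot b))) / 4"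
    unfolding polar [OF b, symmetric] polar [OF rot_Dom [OF b], symmetric] by simp
  finally show ?thesis by (simp add: complex_eq_iff)
qed

lemma Re_H_inner_ev: "\<lbrakk>a \<in> Dom; b \<in> Dom\<rbrakk> \<Longrightarrow> Re (ip (ev a) (ev b)) = form a b"
  by (simp add: H_inner_ev)

definition operator :: "((nat \<Rightarrow> 'e) \<Rightarrow> nat \<Rightarrow> 'e) \<Rightarrow> bool" where
  "operator T \<longleftrightarrow> (\<forall>a\<in>Dom. T a \<in> Dom) \<and> (\<forall>a\<in>Dom. \<forall>b\<in>Dom. T (a + b) = T a + T b) \<and>
     (\<forall>r. \<forall>a\<in>Dom. T (r *\<^sub>R a) = r *\<^sub>R T a) \<and> (\<forall>a\<in>Dom. T (rot a) = rot (T a)) \<and>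
     (\<exists>C. \<forall>a\<in>Dom. form (T a) (T a) \<le> C * form a a)"

definition adj :: "((nat \<Rightarrow> 'e) \<Rightarrow> nat \<Rightarrow> 'e) \<Rightarrow> (nat \<Rightarrow> 'e) \<Rightarrow> nat \<Rightarrow> 'e" where
  "adj T g = (SOME h. h \<in> Dom \<and> (\<forall>u\<in>Dom. form (T u) g = form u h))"

lemma
  assumes T: "operator T" and g: "g \<in> Dom"
  shows adj_Dom [simp]: "adj T g \<in> Dom" and form_adj: "u \<in> Dom \<Longrightarrow> form u (adj T g) = form (T u) g"
proof -
  obtain C where "\<And>a. a \<in> Dom \<Longrightarrow> form (T a) (T a) \<le> C * form a a" using T unfolding operator_def by blast
  then have "\<exists>h. h \<in> Dom \<and> (\<forall>u\<in>Dom. form (T u) g = form u h)"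
    using adjoint [of T C g] T g unfolding operator_def by blast
  then have "adj T g \<in> Dom \<and> (\<forall>u\<in>Dom. form (T u) g = form u (adj T g))" unfolding adj_def by (rule someI_ex)
  then show "adj T g \<in> Dom" "u \<in> Dom \<Longrightarrow> form u (adj T g) = form (T u) g" by simp_all
qed

lemma operator_Dom: "operator T \<Longrightarrow> a \<in> Dom \<Longrightarrow> T a \<in> Dom"
  and operator_rot: "operator T \<Longrightarrow> a \<in> Dom \<Longrightarrow> T (rot a) = rot (T a)"
  by (simp_all add: operator_def)

lemma adj_rot:
  assumes T: "operator T" and g: "g \<in> Dom"
  shows "adj T (rot g) = rot (adj T g)"
proof (rule eq_of_s_eq)
  fix u assume u: "u \<in> Dom"
  show "form u (adj T (rot g)) = form u (rot (adj T g))"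
    using T g u by (simp add: form_adj form_rot_right operator_Dom operator_rot)
qed (use T g in simp_all)

lemma funpow_Dom: "(\<And>a. a \<in> Dom \<Longrightarrow> T a \<in> Dom) \<Longrightarrow> a \<in> Dom \<Longrightarrow> (T ^^ n) a \<in> Dom"
  by (induction n) simp_all

lemma funpow_rot:
  assumes "\<And>a. a \<in> Dom \<Longrightarrow> T a \<in> Dom" "\<And>a. a \<in> Dom \<Longrightarrow> T (rot a) = rot (T a)" "a \<in> Dom"
  shows "(T ^^ n) (rot a) = rot ((T ^^ n) a)"
  using assms(3) by (induction n) (simp_all add: assms(1,2) funpow_Dom)

lemma form_funpow_adj:
  assumes T: "operator T" and x: "x \<in> Dom" and y: "y \<in> Dom"
  shows "form ((adj T ^^ n) x) y = form x ((T ^^ n) y)"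
  using y
proof (induction n arbitrary: y)
  case (Suc n)
  have d: "(adj T ^^ n) x \<in> Dom" by (rule funpow_Dom [OF adj_Dom [OF T] x])
  have "form ((adj T ^^ Suc n) x) y = form ((adj T ^^ n) x) (T y)"
    using form_adj [OF T d Suc.prems] s_commute d Suc.prems T by (simp add: operator_Dom)
  also have "\<dots> = form x ((T ^^ n) (T y))" by (rule Suc.IH) (use T Suc.prems operator_Dom in blast)
  finally show ?case by (simp add: funpow_swap1)
qed simp

text \<open>The real adjoint handles real parts; since \<open>T\<close> commutes with
  \<open>rot\<close>, it handles imaginary parts too. Comparing real parts alone already gives
  uniqueness.\<close>

lemma adjoint_on_ev:
  assumes T: "operator T" and F: "\<And>a. a \<in> Dom \<Longrightarrow> F (ev a) = ev (T a)" and g: "g \<in> Dom"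
  shows "adjoint_on V ip F (ev g) = ev (adj T g)"
  unfolding adjoint_on_def
proof (rule the_equality)
  show "ev (adj T g) \<in> V \<and> (\<forall>f\<in>V. ip (F f) (ev g) = ip f (ev (adj T g)))"
  proof (intro conjI ballI)
    fix f assume "f \<in> V"
    then obtain u where u: "u \<in> Dom" "f = ev u" unfolding V_eq by blast
    show "ip (F f) (ev g) = ip f (ev (adj T g))"
      using T g u by (simp add: F H_inner_ev operator_Dom form_adj form_rot_right flip: operator_rot)
  qed (use T g ev_in_V in simp)
next
  fix h assume h: "h \<in> V \<and> (\<forall>f\<in>V. ip (F f) (ev g) = ip f h)"
  then obtain h' where h': "h' \<in> Dom" "h = ev h'" unfolding V_eq by blast
  have "h' = adj T g"
  proof (rule eq_of_s_eq)
    fix u assume u: "u \<in> Dom"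
    have "ip (F (ev u)) (ev g) = ip (ev u) (ev h')" using h u h'(2) ev_in_V by blast
    then have "Re (ip (ev (T u)) (ev g)) = Re (ip (ev u) (ev h'))" using F [OF u] by simp
    then show "form u h' = form u (adj T g)" using T u g h' by (simp add: Re_H_inner_ev operator_Dom form_adj)
  qed (use T g h' in simp_all)
  then show "h = ev (adj T g)" using h' by simp
qed

lemma funpow_ev:
  assumes "\<And>a. a \<in> Dom \<Longrightarrow> T a \<in> Dom" "\<And>a. a \<in> Dom \<Longrightarrow> F (ev a) = ev (T a)" "a \<in> Dom"
  shows "(F ^^ n) (ev a) = ev ((T ^^ n) a)"
  using assms(3) by (induction n) (simp_all add: assms(1,2) funpow_Dom)

lemma selfadjoint_on_ev:
  assumes F: "\<And>a. a \<in> Dom \<Longrightarrow> F (ev a) = ev (G a)" and G: "\<And>a. a \<in> Dom \<Longrightarrow> G a \<in> Dom"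
    and rot: "\<And>a. a \<in> Dom \<Longrightarrow> G (rot a) = rot (G a)"
    and sym: "\<And>a b. \<lbrakk>a \<in> Dom; b \<in> Dom\<rbrakk> \<Longrightarrow> form (G a) b = form a (G b)"
  shows "selfadjoint_on V ip F"
  unfolding selfadjoint_on_def V_eq by (auto simp: F G H_inner_ev sym simp flip: rot)

lemma operator_shift_up: "operator shift_up"
proof -
  have "shift_up (a + b) = shift_up a + shift_up b" "shift_up (r *\<^sub>R a) = r *\<^sub>R shift_up a" "shift_up (rot a) = rot (shift_up a)"
    for a b :: "nat \<Rightarrow> 'e" and r
    by (auto simp: fun_eq_iff shift_up_def rot_def split: nat.split)
  then show ?thesis unfolding operator_def using Dom_shift_up form_shift_up_le by blast
qed

lemma operator_shift_down: "operator shift_down"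
proof -
  have "shift_down (a + b) = shift_down a + shift_down b" "shift_down (r *\<^sub>R a) = r *\<^sub>R shift_down a"
    "shift_down (rot a) = rot (shift_down a)" for a b :: "nat \<Rightarrow> 'e" and r
    by (auto simp: fun_eq_iff shift_down_def rot_def)
  moreover have "\<exists>C. \<forall>a\<in>Dom. form (shift_down a) (shift_down a) \<le> C * form a a"
    by (rule exI [of _ 1]) (simp add: form_shift_down_le)
  ultimately show ?thesis unfolding operator_def using Dom_shift_down by blast
qed

text \<open>Forms of positive order depend only on \<open>shift_down\<close>, so adding a constant
  changes the squared norm by that of the constant alone. The sign of the constant is then
  irrelevant, and polarization gives orthogonality.\<close>

lemma form_shift_up_const:
  assumes u: "u \<in> Dom" and e: "e \<in> Dom" "shift_down e = 0"
  shows "form (shift_up u) e = 0"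
proof -
  have N: "form (shift_up u + v) (shift_up u + v) = form (shift_up u) (shift_up u) + (norm (v 0))\<^sup>2"
    if v: "v \<in> Dom" "shift_down v = 0" for v
  proof -
    let ?w = "shift_up u + v"
    have w: "?w \<in> Dom" and su: "shift_up u \<in> Dom" using u v by (simp_all add: Dom_shift_up)
    have v_Suc: "v (Suc k) = 0" for k using fun_cong [OF v(2), of k] by (simp add: shift_down_def)
    have sd: "shift_down ?w = u" by (simp add: fun_eq_iff shift_down_def v_Suc)
    have "D j j ?w = D j j (shift_up u)" if j: "j \<in> index_set m" for j
    proof -
      obtain n where n: "j = Suc n" "fin j (Suc n) ?w" using fin_pos [OF w j] .
      have f: "fin j (Suc n) (shift_up u)" using su j n(1) Dom_iff by blast
      show ?thesis
        using toeplitz_pos.D_shift_down [OF toeplitz_pos_component [OF j] n(2)] toeplitz_pos.D_shift_down [OF toeplitz_pos_component [OF j] f] n(1) sd by simp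
    qed
    moreover have "(\<Sum>k. (norm (?w k))\<^sup>2) = (\<Sum>k. (norm (shift_up u k))\<^sup>2) + (norm (v 0))\<^sup>2"
      using suminf_split_head [of "\<lambda>k. (norm (?w k))\<^sup>2"] suminf_split_head [of "\<lambda>k. (norm (shift_up u k))\<^sup>2"] w su Dom_iff
      by (simp add: v_Suc)
    ultimately show ?thesis by (simp add: form_diag [OF w] form_diag [OF su])
  qed
  have "shift_down ((-1) *\<^sub>R e) = 0" using e(2) by (simp add: fun_eq_iff shift_down_def)
  then have "form (shift_up u + e) (shift_up u + e) = form (shift_up u - e) (shift_up u - e)"
    using N [OF e] N [OF Dom_mem(3) [OF e(1)], of "-1"] by simp
  then show ?thesis using u e(1) Dom_shift_up s_commute [of e "shift_up u"] by (simp add: s_simps)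
qed

abbreviation A :: "(nat \<Rightarrow> 'e) \<Rightarrow> nat \<Rightarrow> 'e" where "A \<equiv> adj shift_up"

lemma mult_z_ev_Dom: "a \<in> Dom \<Longrightarrow> mult_z (ev a) = ev (shift_up a)"
  by (simp add: mult_z_ev Dom_disc_seq)

lemma adjoint_mult_z_ev: "a \<in> Dom \<Longrightarrow> adjoint_on V ip mult_z (ev a) = ev (A a)"
  by (rule adjoint_on_ev [OF operator_shift_up mult_z_ev_Dom])

text \<open>The difference of the two arguments is a constant sequence, orthogonal to the range of
  \<open>shift_up\<close> and hence in the kernel of its adjoint.\<close>

lemma A_shift_up_shift_down:
  assumes a: "a \<in> Dom"
  shows "A (shift_up (shift_down a)) = A a"
proof (rule eq_of_s_eq)
  let ?e = "a - shift_up (shift_down a)"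
  fix u assume u: "u \<in> Dom"
  have sd: "shift_up (shift_down a) \<in> Dom" using a Dom_shift_up Dom_shift_down by blast
  have "shift_down ?e = 0" by (simp add: fun_eq_iff shift_down_def)
  then have "form (shift_up u) ?e = 0" using u a sd by (intro form_shift_up_const) simp_all
  then show "form u (A (shift_up (shift_down a))) = form u (A a)"
    using u a sd operator_shift_up by (simp add: form_adj s_simps Dom_shift_up)
qed (use a operator_shift_up Dom_shift_up Dom_shift_down in simp_all)

text \<open>The product of the adjoint with \<open>M_z\<close> sends
  \<open>ev (shift_down a)\<close> to the adjoint applied to \<open>ev a\<close>, and it is
  injective because \<open>shift_up\<close> does not decrease the norm. Injectivity determines the
  value of \<open>inv_into\<close> there.\<close>

lemma left_inverse_ev:
  assumes a: "a \<in> Dom"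
  shows "left_inverse_on V ip mult_z (ev a) = ev (shift_down a)"
proof -
  let ?h = "adjoint_on V ip mult_z \<circ> mult_z"
  have h: "?h (ev b) = ev (A (shift_up b))" if "b \<in> Dom" for b
    using that by (simp add: mult_z_ev_Dom adjoint_mult_z_ev Dom_shift_up)
  have A: "A b \<in> Dom" if "b \<in> Dom" for b using that operator_shift_up by simp
  have "inj_on ?h V"
  proof (rule inj_onI)
    fix f g assume fg: "f \<in> V" "g \<in> V" "?h f = ?h g"
    then obtain u v where uv: "u \<in> Dom" "f = ev u" "v \<in> Dom" "g = ev v" unfolding V_eq by blast
    define d where "d = u - v"
    have d: "d \<in> Dom" using uv by (simp add: d_def)
    have "A (shift_up u) = A (shift_up v)"
      using fg(3) uv h A Dom_shift_up Dom_disc_seq by (intro ev_inject) auto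
    then have "form (shift_up d) (shift_up u) = form (shift_up d) (shift_up v)"
      using form_adj [OF operator_shift_up, of "shift_up u" d] form_adj [OF operator_shift_up, of "shift_up v" d] uv d Dom_shift_up by simp
    moreover have "shift_up d = shift_up u - shift_up v" by (auto simp: d_def fun_eq_iff shift_up_def split: nat.split)
    ultimately have "form (shift_up d) (shift_up d) = 0" using uv d Dom_shift_up by (simp add: s_simps)
    then have "form d d = 0" using form_shift_up_ge [OF d] s_nonneg [OF d] by simp
    then have "d = 0" using s_definite d by blast
    then show "f = g" using uv by (simp add: d_def)
  qed
  moreover have "ev (shift_down a) \<in> V" using a Dom_shift_down ev_in_V by blast
  ultimately have "inv_into V ?h (?h (ev (shift_down a))) = ev (shift_down a)" by (rule inv_into_f_f)
  moreover have "?h (ev (shift_down a)) = adjoint_on V ip mult_z (ev a)"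
    using a Dom_shift_down by (simp only: h A_shift_up_shift_down adjoint_mult_z_ev)
  ultimately show ?thesis by (simp add: left_inverse_on_def)
qed

section \<open>Quadratic forms of the operators beta\<close>

definition beta_seq :: "nat \<Rightarrow> (nat \<Rightarrow> 'e) \<Rightarrow> nat \<Rightarrow> 'e" where
  "beta_seq k a = (\<Sum>j\<le>k. (real (k choose j) * (-1) ^ (k - j)) *\<^sub>R (A ^^ j) ((shift_up ^^ j) a))"

lemma A_shift_Dom: "a \<in> Dom \<Longrightarrow> (A ^^ j) ((shift_up ^^ j) a) \<in> Dom"
  using operator_shift_up by (intro funpow_Dom) (simp_all add: Dom_shift_up)

lemma beta_ev:
  assumes a: "a \<in> Dom"
  shows "beta_on V ip k mult_z (ev a) = ev (beta_seq k a)"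
proof -
  have "(adjoint_on V ip mult_z ^^ j) ((mult_z ^^ j) (ev a)) = ev ((A ^^ j) ((shift_up ^^ j) a))" for j
  proof -
    have "(mult_z ^^ j) (ev a) = ev ((shift_up ^^ j) a)"
      by (rule funpow_ev [where T = shift_up and F = mult_z, OF Dom_shift_up mult_z_ev_Dom a])
    moreover have "(adjoint_on V ip mult_z ^^ j) (ev b) = ev ((A ^^ j) b)" if "b \<in> Dom" for b
      by (rule funpow_ev [where T = A and F = "adjoint_on V ip mult_z", OF adj_Dom [OF operator_shift_up] adjoint_mult_z_ev that])
    ultimately show ?thesis using a Dom_funpow_shift_up by simp
  qed
  then show ?thesis
    using a unfolding beta_on_def beta_seq_def
    by (simp add: ev_sum ev_scaleR disc_seq_scaleR Dom_disc_seq A_shift_Dom)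
qed

lemma beta_seq_Dom [simp]: "a \<in> Dom \<Longrightarrow> beta_seq k a \<in> Dom"
  unfolding beta_seq_def by (intro subspace_sum [OF subspace_Dom] Dom_mem A_shift_Dom)

lemma rot_zero: "rot 0 = 0"
  by (simp add: rot_def fun_eq_iff)

lemma rot_sum: "rot (\<Sum>i\<in>I. f i) = (\<Sum>i\<in>I. rot (f i))"
  by (induction I rule: infinite_finite_induct)
     (simp_all only: sum.infinite sum.empty sum.insert rot_add rot_zero not_False_eq_True)

lemma beta_seq_rot:
  assumes "a \<in> Dom"
  shows "beta_seq k (rot a) = rot (beta_seq k a)"
proof -
  have "(A ^^ j) ((shift_up ^^ j) (rot a)) = rot ((A ^^ j) ((shift_up ^^ j) a))" for j
    using funpow_rot [of shift_up a j] funpow_rot [of A "(shift_up ^^ j) a" j] operator_shift_up assms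
    by (simp add: operator_Dom operator_rot adj_rot Dom_funpow_shift_up)
  then show ?thesis by (simp add: beta_seq_def rot_sum rot_scaleR)
qed

lemma s_sum_left:
  "finite I \<Longrightarrow> (\<And>i. i \<in> I \<Longrightarrow> f i \<in> Dom) \<Longrightarrow> b \<in> Dom \<Longrightarrow> form (\<Sum>i\<in>I. f i) b = (\<Sum>i\<in>I. form (f i) b)"
  by (induction I rule: finite_induct) (simp_all add: s_add subspace_sum [OF subspace_Dom])

lemma form_beta_seq:
  assumes a: "a \<in> Dom" and b: "b \<in> Dom"
  shows "form (beta_seq k a) b = (\<Sum>j\<le>k. (real (k choose j) * (-1) ^ (k - j)) * form ((shift_up ^^ j) a) ((shift_up ^^ j) b))"
proof -
  have "form (beta_seq k a) b = (\<Sum>j\<le>k. form ((real (k choose j) * (-1) ^ (k - j)) *\<^sub>R (A ^^ j) ((shift_up ^^ j) a)) b)"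
    unfolding beta_seq_def by (rule s_sum_left) (use a b A_shift_Dom Dom_mem in auto)
  also have "\<dots> = (\<Sum>j\<le>k. (real (k choose j) * (-1) ^ (k - j)) * form ((A ^^ j) ((shift_up ^^ j) a)) b)"
    by (intro sum.cong refl s_scale A_shift_Dom a b)
  finally show ?thesis
    by (simp only: form_funpow_adj [OF operator_shift_up Dom_funpow_shift_up [OF a] b])
qed

lemma form_beta_seq_commute:
  assumes a: "a \<in> Dom" and b: "b \<in> Dom"
  shows "form (beta_seq k a) b = form a (beta_seq k b)"
  using form_beta_seq [OF a b] form_beta_seq [OF b a] s_commute [OF beta_seq_Dom [OF b] a]
    s_commute [OF Dom_funpow_shift_up [OF a] Dom_funpow_shift_up [OF b]] by simp

lemma form_beta_seq_diag: "a \<in> Dom \<Longrightarrow> form (beta_seq k a) a = alt_diff k (\<lambda>i. form ((shift_up ^^ i) a) ((shift_up ^^ i) a))"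
  by (simp add: form_beta_seq alt_diff_def)

text \<open>\<open>beta_seq k\<close> is symmetric and commutes with \<open>rot\<close>, so its form
  against \<open>rot a\<close> equals its own negative and the imaginary part vanishes.\<close>

lemma H_inner_beta:
  assumes a: "a \<in> Dom"
  shows "ip (beta_on V ip k mult_z (ev a)) (ev a) = complex_of_real (form (beta_seq k a) a)"
proof -
  have "form (beta_seq k a) (rot a) = form (rot (beta_seq k a)) a"
    using form_beta_seq_commute [OF a rot_Dom [OF a], of k] s_commute [OF a, of "rot (beta_seq k a)"] a by (simp add: beta_seq_rot)
  then have "form (beta_seq k a) (rot a) = 0" using form_rot_right [of "beta_seq k a" a] a by simp
  then show ?thesis using a by (simp add: beta_ev H_inner_ev complex_eq_iff)
qed

lemma funpow_left_inverse_ev: "a \<in> Dom \<Longrightarrow> (left_inverse_on V ip mult_z ^^ n) (ev a) = ev ((shift_down ^^ n) a)"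
  by (rule funpow_ev [where T = shift_down and F = "left_inverse_on V ip mult_z", OF Dom_shift_down left_inverse_ev])

lemma fin_one:
  assumes a: "a \<in> Dom" and r: "r \<in> index_set m"
  shows "fin r 1 a"
proof -
  interpret t: toeplitz_pos "semi_spectral.moment (\<mu> r)" "semi_spectral.K (\<mu> r)" by (rule toeplitz_pos_component [OF r])
  have "t.fin r a" using a r Dom_iff by blast
  have "t.fin k a" if "k \<le> r" for k
    using that by (induction rule: inc_induct) (auto intro: \<open>t.fin r a\<close> t.fin_pred)
  then show ?thesis using index_set_pos [OF r] by simp
qed

text \<open>The difference of order \<open>r\<close> is a sum over components
  \<open>j \<ge> r\<close>. The component \<open>j = r\<close> is \<open>D_zero\<close>; the others
  form the limit in \<open>alt_diff_form_sums\<close>, and for \<open>r = m - 1\<close> there are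
  none.\<close>

lemma beta_seq_decomposition:
  assumes a: "a \<in> Dom" and r: "r \<in> index_set m"
  shows "(\<lambda>n. form (beta_seq (Suc r) ((shift_down ^^ Suc n) a)) ((shift_down ^^ Suc n) a)) sums (form (beta_seq r a) a - D_zero (\<mu> r) (ev a))"
    and "0 \<le> D_zero (\<mu> r) (ev a)"
proof -
  obtain p where p: "r = Suc p" using index_set_pos [OF r] by (cases r) auto
  have f1: "fin r 1 a" by (rule fin_one [OF a r])
  have Dz: "D_zero (\<mu> r) (ev a) = D r 0 a"
    by (rule semi_spectral.D_zero_eq [OF semi_spectral_component [OF r] f1]) (simp add: ev_def)
  show "0 \<le> D_zero (\<mu> r) (ev a)"
    unfolding Dz using toeplitz_pos.D_nonneg [OF toeplitz_pos_component [OF r], of 0 a] toeplitz_pos.fin_pred [OF toeplitz_pos_component [OF r], of 0 a] f1 by simp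
  have "form (beta_seq r a) a = (\<Sum>j\<in>{j\<in>index_set m. r \<le> j}. D j (j - r) a)"
    unfolding form_beta_seq_diag [OF a] p by (rule alt_diff_form [OF a])
  also have "{j\<in>index_set m. r \<le> j} = insert r {j\<in>index_set m. Suc r \<le> j}" using r by auto
  finally have "form (beta_seq r a) a - D_zero (\<mu> r) (ev a) = (\<Sum>j\<in>{j\<in>index_set m. Suc r \<le> j}. D j (j - r) a)"
    by (simp add: Dz finite_J)
  moreover have "form (beta_seq (Suc r) ((shift_down ^^ Suc n) a)) ((shift_down ^^ Suc n) a) =
      alt_diff (Suc r) (\<lambda>i. form ((shift_up ^^ i) ((shift_down ^^ Suc n) a)) ((shift_up ^^ i) ((shift_down ^^ Suc n) a)))" for n
    by (rule form_beta_seq_diag [OF Dom_funpow_shift_down [OF a]])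
  ultimately show "(\<lambda>n. form (beta_seq (Suc r) ((shift_down ^^ Suc n) a)) ((shift_down ^^ Suc n) a)) sums (form (beta_seq r a) a - D_zero (\<mu> r) (ev a))"
    using alt_diff_form_sums [OF a, of r] by (simp only:)
qed

end

theorem theorem4p4:
  fixes \<mu> :: "nat \<Rightarrow> complex set \<Rightarrow> 'e::complex_hilbert_space \<Rightarrow> 'e"
    and m :: nat
  defines "V \<equiv> H_space \<mu> m"
    and "ip \<equiv> H_inner \<mu> m"
  defines "\<beta> \<equiv> (\<lambda>k. beta_on V ip k mult_z)"
    and "L \<equiv> left_inverse_on V ip mult_z"
  assumes "separable_space (euclidean :: 'e topology)"
    and "m \<ge> 2"
    and "\<And>j. j \<in> {1..m - 1} \<Longrightarrow> semi_spectral_measure (\<mu> j)"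
  shows "(\<forall>r \<in> {1..m - 1}. \<forall>f \<in> V.
            summable (\<lambda>n. ip (\<beta> (r + 1) ((L ^^ Suc n) f)) ((L ^^ Suc n) f)) \<and>
            ip (\<beta> r f) f =
              complex_of_real (D_zero (\<mu> r) f) +
              (\<Sum>n. ip (\<beta> (r + 1) ((L ^^ Suc n) f)) ((L ^^ Suc n) f))) \<and>
         (\<forall>r \<in> {1..m - 1}.
            ge_operator_series V ip (\<beta> r)
              (\<lambda>n. (adjoint_on V ip L ^^ n) \<circ> \<beta> (r + 1) \<circ> (L ^^ n)))"
proof -
  interpret dirichlet_tuple \<mu> m by unfold_locales (use assms(7) in \<open>simp add: index_set_def\<close>)
  have V: "V = ev ` Dom" unfolding V_def by (rule V_eq)
  have L: "(L ^^ n) (ev a) = ev ((shift_down ^^ n) a)" if "a \<in> Dom" for a n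
    unfolding L_def V_def ip_def by (rule funpow_left_inverse_ev [OF that])
  have beta: "\<beta> k (ev a) = ev (beta_seq k a)" if "a \<in> Dom" for a k
    unfolding \<beta>_def V_def ip_def by (rule beta_ev [OF that])
  have ip_beta: "ip (\<beta> k (ev a)) (ev a) = complex_of_real (form (beta_seq k a) a)" if "a \<in> Dom" for a k
    unfolding \<beta>_def V_def ip_def by (rule H_inner_beta [OF that])
  let ?AL = "adj shift_down"
  have AL: "adjoint_on V ip L (ev a) = ev (?AL a)" if "a \<in> Dom" for a
    unfolding L_def V_def ip_def by (rule adjoint_on_ev [OF operator_shift_down left_inverse_ev that])
  let ?G = "\<lambda>k n a. (?AL ^^ n) (beta_seq k ((shift_down ^^ n) a))"
  have C: "((adjoint_on V ip L ^^ n) \<circ> \<beta> k \<circ> (L ^^ n)) (ev a) = ev (?G k n a)" if "a \<in> Dom" for a k n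
    using that by (simp add: L beta Dom_funpow_shift_down funpow_ev [where T = ?AL and F = "adjoint_on V ip L", OF adj_Dom [OF operator_shift_down] AL])
  have G_Dom: "?G k n a \<in> Dom" if "a \<in> Dom" for a k n
    using that by (intro funpow_Dom) (simp_all add: operator_shift_down Dom_funpow_shift_down)
  \<comment> \<open>Moving the powers of the adjoint of \<open>L\<close> to the other argument turns
    the operator series into the scalar series of the first part.\<close>
  have G_form: "form (?G k n a) b = form (beta_seq k ((shift_down ^^ n) a)) ((shift_down ^^ n) b)" if "a \<in> Dom" "b \<in> Dom" for a b k n
    using that by (intro form_funpow_adj operator_shift_down) (simp_all add: Dom_funpow_shift_down)
  have self_beta: "selfadjoint_on V ip (\<beta> k)" for k
    unfolding V_def ip_def by (rule selfadjoint_on_ev [where G = "beta_seq k"]) (simp_all add: beta beta_seq_rot form_beta_seq_commute)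
  have self_C: "selfadjoint_on V ip ((adjoint_on V ip L ^^ n) \<circ> \<beta> k \<circ> (L ^^ n))" for k n
  proof -
    have rot: "?G k n (rot a) = rot (?G k n a)" if "a \<in> Dom" for a
    proof -
      have "(shift_down ^^ n) (rot a) = rot ((shift_down ^^ n) a)"
        by (rule funpow_rot [where T = shift_down, OF Dom_shift_down operator_rot [OF operator_shift_down] that])
      moreover have "(?AL ^^ n) (rot b) = rot ((?AL ^^ n) b)" if "b \<in> Dom" for b
        by (rule funpow_rot [where T = ?AL, OF adj_Dom [OF operator_shift_down] adj_rot [OF operator_shift_down] that])
      ultimately show ?thesis using that by (simp add: beta_seq_rot Dom_funpow_shift_down)
    qed
    have "form (?G k n a) b = form a (?G k n b)" if "a \<in> Dom" "b \<in> Dom" for a b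
      using G_form that s_commute G_Dom form_beta_seq_commute Dom_funpow_shift_down beta_seq_Dom by metis
    then have "selfadjoint_on (H_space \<mu> m) (H_inner \<mu> m) ((adjoint_on V ip L ^^ n) \<circ> \<beta> k \<circ> (L ^^ n))"
      by (intro selfadjoint_on_ev [where G = "?G k n"]) (use C G_Dom rot in auto)
    then show ?thesis by (simp add: V_def ip_def)
  qed
  have part1: "summable (\<lambda>n. ip (\<beta> (r + 1) ((L ^^ Suc n) f)) ((L ^^ Suc n) f)) \<and>
            ip (\<beta> r f) f = complex_of_real (D_zero (\<mu> r) f) +
              (\<Sum>n. ip (\<beta> (r + 1) ((L ^^ Suc n) f)) ((L ^^ Suc n) f))"
    if r: "r \<in> index_set m" and f: "f \<in> V" for r f
  proof -
    obtain a where a: "a \<in> Dom" "f = ev a" using f V by blast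
    have "ip (\<beta> (r + 1) ((L ^^ Suc n) f)) ((L ^^ Suc n) f) =
        complex_of_real (form (beta_seq (Suc r) ((shift_down ^^ Suc n) a)) ((shift_down ^^ Suc n) a))" for n
      unfolding a(2) L [OF a(1)] ip_beta [OF Dom_funpow_shift_down [OF a(1)]] by simp
    then have "(\<lambda>n. ip (\<beta> (r + 1) ((L ^^ Suc n) f)) ((L ^^ Suc n) f)) sums
        complex_of_real (form (beta_seq r a) a - D_zero (\<mu> r) f)"
      using sums_of_real [OF beta_seq_decomposition(1) [OF a(1) r], where 'a = complex] a(2) by (simp only:)
    then show ?thesis using ip_beta [OF a(1), of r] a(2) by (simp add: sums_iff)
  qed
  have part2: "ge_operator_series V ip (\<beta> r) (\<lambda>n. (adjoint_on V ip L ^^ n) \<circ> \<beta> (r + 1) \<circ> (L ^^ n))"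
    if r: "r \<in> index_set m" for r
    unfolding ge_operator_series_def
  proof (intro conjI ballI allI impI self_beta self_C)
    fix f assume "f \<in> V"
    then obtain a where a: "a \<in> Dom" "f = ev a" using V by blast
    have "Re (ip (((adjoint_on V ip L ^^ Suc n) \<circ> \<beta> (r + 1) \<circ> (L ^^ Suc n)) f) f) =
        form (beta_seq (Suc r) ((shift_down ^^ Suc n) a)) ((shift_down ^^ Suc n) a)" for n
      unfolding a(2) C [OF a(1)] unfolding ip_def Re_H_inner_ev [OF G_Dom [OF a(1)] a(1)] G_form [OF a(1) a(1)] by simp
    then have s: "(\<lambda>n. Re (ip (((adjoint_on V ip L ^^ Suc n) \<circ> \<beta> (r + 1) \<circ> (L ^^ Suc n)) f) f)) sums
        (form (beta_seq r a) a - D_zero (\<mu> r) f)"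
      using beta_seq_decomposition(1) [OF a(1) r] a(2) by (simp only:)
    then show "summable (\<lambda>n. Re (ip (((adjoint_on V ip L ^^ Suc n) \<circ> \<beta> (r + 1) \<circ> (L ^^ Suc n)) f) f))"
      by (rule sums_summable)
    \<comment> \<open>The two sides differ by \<open>D_zero (\<mu> r) f\<close>, nonnegative as a
      limit of circle means of a nonnegative function.\<close>
    show "(\<Sum>n. Re (ip (((adjoint_on V ip L ^^ Suc n) \<circ> \<beta> (r + 1) \<circ> (L ^^ Suc n)) f) f)) \<le> Re (ip (\<beta> r f) f)"
      using sums_unique [OF s] beta_seq_decomposition(2) [OF a(1) r] ip_beta [OF a(1), of r] a(2) by simp
  qed
  show ?thesis
    unfolding index_set_def [symmetric]
  proof (rule conjI)
    show "\<forall>r\<in>index_set m. \<forall>f\<in>V. summable (\<lambda>n. ip (\<beta> (r + 1) ((L ^^ Suc n) f)) ((L ^^ Suc n) f)) \<and>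
            ip (\<beta> r f) f = complex_of_real (D_zero (\<mu> r) f) +
              (\<Sum>n. ip (\<beta> (r + 1) ((L ^^ Suc n) f)) ((L ^^ Suc n) f))"
      by (intro ballI part1)
    show "\<forall>r\<in>index_set m. ge_operator_series V ip (\<beta> r) (\<lambda>n. (adjoint_on V ip L ^^ n) \<circ> \<beta> (r + 1) \<circ> (L ^^ n))"
      by (intro ballI part2)
  qed
qed

end
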